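(* If $f:\mathbb T\to\mathbb R$ is analytic, then there is $\lambda(f)>0$ such that for every $\lambda>\lambda(f)$ and every $\omega\in\mathbb R\setminus\mathbb Q$, for the operators $\mathfrak h_{\theta,\lambda}$: 1. $\beta^-_{(\omega,\theta)}(p)=0$ for all $\theta\in\mathbb T$ and $p>0$; 2. if $\omega$ is Diophantine, then $\beta^+_{(\omega,\theta)}(p)=0$ for all $\theta\in\mathbb T$ and $p>0$.
   Context: $\mathbb T=\mathbb R/\mathbb Z$. For $\lambda>0$ and $\theta\in\mathbb T$, $\mathfrak h_{\theta,\lambda}$ is the operator on $\ell^2(\mathbb Z)$ given by $(\mathfrak h_{\theta,\lambda}u)(n)=u(n-1)+u(n+1)+\lambda f(n\omega+\theta)u(n)$. Diophantine: let $p_n/q_n$ be the continued fraction approximants of $\omega$; $\omega$ is Diophantine if for some $\kappa>0$, $q_{n+1}<q_n^{1+\kappa}$ for all large $n$. Transport exponents: $a(n,t)=\frac12\left(|\langle e^{-it\mathfrak h_{\theta,\lambda}}\delta_0,\delta_n\rangle|^2+|\langle e^{-it\mathfrak h_{\theta,\lambda}}\delta_1,\delta_n\rangle|^2\right)$, $a_T(n)=\frac2T\int_0^\infty e^{-2t/T}a(n,t)\,dt$, $\langle|X|^p(T)\rangle=\sum_n(1+|n|)^pa(n,T)$, $\langle|X|_T^p\rangle=\sum_n(1+|n|)^pa_T(n)$, and for $p>0$ $$\beta^+_{(\omega,\theta)}(p)=\limsup_{t\to\infty}\frac{\ln\langle|X|^p(t)\rangle}{p\ln t},\qquad \beta^-_{(\omega,\theta)}(p)=\liminf_{t\to\infty}\frac{\ln\langle|X|_t^p\rangle}{p\ln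 t}.$$
   Formalization: The function f is assumed to be non-constant: for constant f the operator is a shifted free Laplacian with ballistic transport, so both exponents equal 1 for every λ and the claim as printed fails. *)

theory Defs
  imports "HOL-Analysis.Analysis"
begin

typedef ell2 = "{u :: int \<Rightarrow> complex. (\<lambda>n. (cmod (u n))\<^sup>2) summable_on UNIV}"
  morphisms ell2_fun ell2_of
  by (rule exI[of _ "\<lambda>_. 0"]) simp

setup_lifting type_definition_ell2

lemma ell2_summable: "(\<lambda>n. (cmod (ell2_fun u n))\<^sup>2) summable_on UNIV"
  using ell2_fun[of u] by simp

lemma sq_summable_bound:
  fixes f g :: "int \<Rightarrow> complex" and h :: "int \<Rightarrow> real"
  assumes f: "(\<lambda>n. (cmod (f n))\<^sup>2) summable_on UNIV"
    and g: "(\<lambda>n. (cmod (g n))\<^sup>2) summable_on UNIV"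
    and h: "\<And>n. 0 \<le> h n" "\<And>n. h n \<le> c * (cmod (f n))\<^sup>2 + d * (cmod (g n))\<^sup>2"
  shows "h summable_on UNIV"
proof -
  have "(\<lambda>n. c * (cmod (f n))\<^sup>2 + d * (cmod (g n))\<^sup>2) summable_on UNIV"
    by (intro summable_on_add summable_on_cmult_right f g)
  then show ?thesis
    by (rule summable_on_comparison_test) (use h in auto)
qed

lemma cmod_add_sq_le: "(cmod (x + y))\<^sup>2 \<le> 2 * (cmod x)\<^sup>2 + 2 * (cmod y)\<^sup>2"
proof -
  have "(cmod (x + y))\<^sup>2 \<le> (cmod x + cmod y)\<^sup>2"
    by (intro power_mono norm_triangle_ineq) simp
  also have "\<dots> \<le> 2 * (cmod x)\<^sup>2 + 2 * (cmod y)\<^sup>2"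
    using sum_squares_bound[of "cmod x" "cmod y"] by (simp add: power2_sum)
  finally show ?thesis .
qed

lemma ell2_prod_summable:
  assumes f: "(\<lambda>n::int. (cmod (f n))\<^sup>2) summable_on UNIV"
    and g: "(\<lambda>n. (cmod (g n))\<^sup>2) summable_on UNIV"
  shows "(\<lambda>n. f n * cnj (g n)) summable_on UNIV"
proof (rule abs_summable_summable, rule sq_summable_bound[OF f g, of _ 1 1])
  fix n
  have "2 * (cmod (f n) * cmod (g n)) \<le> (cmod (f n))\<^sup>2 + (cmod (g n))\<^sup>2"
    using sum_squares_bound[of "cmod (f n)" "cmod (g n)"] by simp
  moreover have "0 \<le> cmod (f n) * cmod (g n)"
    by simp
  ultimately show "norm (f n * cnj (g n)) \<le> 1 * (cmod (f n))\<^sup>2 + 1 * (cmod (g n))\<^sup>2"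
    unfolding norm_mult complex_mod_cnj by linarith
qed simp

instantiation ell2 :: real_vector
begin

lift_definition zero_ell2 :: ell2 is "\<lambda>_. 0" by simp

lift_definition plus_ell2 :: "ell2 \<Rightarrow> ell2 \<Rightarrow> ell2" is "\<lambda>u v n. u n + v n"
  by (erule (1) sq_summable_bound[where c = 2 and d = 2]) (simp_all add: cmod_add_sq_le)

lift_definition uminus_ell2 :: "ell2 \<Rightarrow> ell2" is "\<lambda>u n. - u n" by simp

lift_definition minus_ell2 :: "ell2 \<Rightarrow> ell2 \<Rightarrow> ell2" is "\<lambda>u v n. u n - v n"
  by (erule (1) sq_summable_bound[where c = 2 and d = 2])
    (use cmod_add_sq_le[where y = "- y" for y] in \<open>simp_all\<close>)

lift_definition scaleR_ell2 :: "real \<Rightarrow> ell2 \<Rightarrow> ell2" is "\<lambda>r u n. complex_of_real r * u n"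
  by (simp add: norm_mult power_mult_distrib summable_on_cmult_right)

instance
  by standard (transfer; simp add: fun_eq_iff algebra_simps)+

end

lift_definition cinner :: "ell2 \<Rightarrow> ell2 \<Rightarrow> complex" is
  "\<lambda>u v. \<Sum>\<^sub>\<infinity>n. u n * cnj (v n)" .

instantiation ell2 :: real_inner
begin

definition inner_ell2 :: "ell2 \<Rightarrow> ell2 \<Rightarrow> real" where
  "inner_ell2 u v = Re (cinner u v)"

definition norm_ell2 :: "ell2 \<Rightarrow> real" where
  "norm_ell2 u = sqrt (\<Sum>\<^sub>\<infinity>n. (cmod (ell2_fun u n))\<^sup>2)"

definition sgn_ell2 :: "ell2 \<Rightarrow> ell2" where
  "sgn_ell2 u = u /\<^sub>R norm u"

definition dist_ell2 :: "ell2 \<Rightarrow> ell2 \<Rightarrow> real" where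
  "dist_ell2 u v = norm (u - v)"

definition uniformity_ell2 :: "(ell2 \<times> ell2) filter" where
  "uniformity_ell2 = (INF e\<in>{0<..}. principal {(x, y). dist x y < e})"

definition open_ell2 :: "ell2 set \<Rightarrow> bool" where
  "open_ell2 U \<longleftrightarrow> (\<forall>x\<in>U. eventually (\<lambda>(x', y). x' = x \<longrightarrow> y \<in> U) uniformity)"

instance
proof
  fix u v w :: ell2 and r :: real and U :: "ell2 set"
  show "dist u v = norm (u - v)" by (fact dist_ell2_def)
  show "sgn u = u /\<^sub>R norm u" by (fact sgn_ell2_def)
  show "uniformity = (INF e\<in>{0<..}. principal {(x::ell2, y). dist x y < e})"
    by (fact uniformity_ell2_def)
  show "open U \<longleftrightarrow> (\<forall>x\<in>U. eventually (\<lambda>(x', y). x' = x \<longrightarrow> y \<in> U) uniformity)"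
    by (fact open_ell2_def)
  have S: "(\<lambda>n. ell2_fun a n * cnj (ell2_fun b n)) summable_on UNIV" for a b
    by (intro ell2_prod_summable ell2_summable)
  have c: "cinner a b = (\<Sum>\<^sub>\<infinity>n. ell2_fun a n * cnj (ell2_fun b n))" for a b
    by (simp add: cinner.rep_eq)
  have "cnj (cinner u v) = cinner v u"
    unfolding c infsum_cnj[symmetric] by (simp add: mult.commute)
  then show "inner u v = inner v u"
    unfolding inner_ell2_def by (metis complex_cnj(1) cnj.simps(1))
  have "cinner (u + v) w = cinner u w + cinner v w"
    unfolding c infsum_add[OF S S, symmetric] by (simp add: plus_ell2.rep_eq distrib_right)
  then show "inner (u + v) w = inner u w + inner v w"
    by (simp add: inner_ell2_def)
  have "cinner (r *\<^sub>R u) v = complex_of_real r * cinner u v"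
    unfolding c infsum_cmult_right'[symmetric] by (simp add: scaleR_ell2.rep_eq mult.assoc)
  then show "inner (r *\<^sub>R u) v = r * inner u v"
    by (simp add: inner_ell2_def)
  have n: "inner u u = (\<Sum>\<^sub>\<infinity>n. (cmod (ell2_fun u n))\<^sup>2)"
    unfolding inner_ell2_def c infsum_Re[OF S, symmetric]
    by (simp only: complex_norm_square[symmetric] Re_complex_of_real)
  show "0 \<le> inner u u"
    unfolding n by (intro infsum_nonneg) simp
  show "norm u = sqrt (inner u u)"
    unfolding n by (fact norm_ell2_def)
  show "inner u u = 0 \<longleftrightarrow> u = 0"
  proof
    assume "inner u u = 0"
    then have "(cmod (ell2_fun u m))\<^sup>2 = 0" for m
      by (intro nonneg_infsum_le_0D[of "\<lambda>n. (cmod (ell2_fun u n))\<^sup>2" UNIV])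
        (simp_all add: n ell2_summable)
    then show "u = 0"
      by (simp add: ell2_fun_inject[symmetric] zero_ell2.rep_eq fun_eq_iff)
  next
    assume "u = 0"
    then have "ell2_fun u m = 0" for m
      by (simp add: zero_ell2.rep_eq)
    then show "inner u u = 0"
      by (simp add: n)
  qed
qed

end

lemma ell2_norm_sq: "(norm u)\<^sup>2 = (\<Sum>\<^sub>\<infinity>n. (cmod (ell2_fun u n))\<^sup>2)"
  unfolding norm_ell2_def by (intro real_sqrt_pow2 infsum_nonneg) simp

lemma ell2_finite_sum_le: "finite F \<Longrightarrow> (\<Sum>n\<in>F. (cmod (ell2_fun u n))\<^sup>2) \<le> (norm u)\<^sup>2"
  unfolding ell2_norm_sq by (intro finite_sum_le_infsum ell2_summable) auto

lemma ell2_coord_le: "cmod (ell2_fun u n) \<le> norm u"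
  using ell2_finite_sum_le[of "{n}" u] by (simp add: power2_le_iff_abs_le)

instance ell2 :: banach
proof
  fix X :: "nat \<Rightarrow> ell2"
  assume X: "Cauchy X"
  have "Cauchy (\<lambda>k. ell2_fun (X k) n)" for n
  proof (rule metric_CauchyI)
    fix e :: real assume "e > 0"
    then obtain M where M: "\<And>j k. j \<ge> M \<Longrightarrow> k \<ge> M \<Longrightarrow> dist (X j) (X k) < e"
      using metric_CauchyD[OF X] by metis
    have "dist (ell2_fun (X j) n) (ell2_fun (X k) n) < e" if "j \<ge> M" "k \<ge> M" for j k
      using M[OF that] ell2_coord_le[of "X j - X k" n]
      by (simp add: dist_norm minus_ell2.rep_eq)
    then show "\<exists>M. \<forall>j\<ge>M. \<forall>k\<ge>M. dist (ell2_fun (X j) n) (ell2_fun (X k) n) < e"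
      by blast
  qed
  then have "\<exists>l. (\<lambda>k. ell2_fun (X k) n) \<longlonglongrightarrow> l" for n
    using Cauchy_convergent convergent_def by blast
  then obtain l where l: "\<And>n. (\<lambda>k. ell2_fun (X k) n) \<longlonglongrightarrow> l n"
    by metis
  have fin: "(\<Sum>n\<in>F. (cmod (ell2_fun (X j) n - l n))\<^sup>2) \<le> e\<^sup>2"
    if M: "\<And>j k. j \<ge> M \<Longrightarrow> k \<ge> M \<Longrightarrow> dist (X j) (X k) < e" and j: "j \<ge> M" and "finite F"
    for M j e F
  proof (rule tendsto_upperbound)
    show "(\<lambda>k. \<Sum>n\<in>F. (cmod (ell2_fun (X j) n - ell2_fun (X k) n))\<^sup>2)
        \<longlonglongrightarrow> (\<Sum>n\<in>F. (cmod (ell2_fun (X j) n - l n))\<^sup>2)"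
      by (intro tendsto_intros l)
    have "(\<Sum>n\<in>F. (cmod (ell2_fun (X j) n - ell2_fun (X k) n))\<^sup>2) \<le> e\<^sup>2" if "k \<ge> M" for k
    proof -
      have "(\<Sum>n\<in>F. (cmod (ell2_fun (X j) n - ell2_fun (X k) n))\<^sup>2) \<le> (norm (X j - X k))\<^sup>2"
        using ell2_finite_sum_le[OF \<open>finite F\<close>, of "X j - X k"] by (simp add: minus_ell2.rep_eq)
      also have "\<dots> \<le> e\<^sup>2"
        using M[OF j that] by (intro power_mono) (simp_all add: dist_norm)
      finally show ?thesis .
    qed
    then show "\<forall>\<^sub>F k in sequentially.
        (\<Sum>n\<in>F. (cmod (ell2_fun (X j) n - ell2_fun (X k) n))\<^sup>2) \<le> e\<^sup>2"
      by (auto simp: eventually_sequentially)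
  qed simp
  have summ: "(\<lambda>n. (cmod (ell2_fun (X j) n - l n))\<^sup>2) summable_on UNIV"
    if M: "\<And>j k. j \<ge> M \<Longrightarrow> k \<ge> M \<Longrightarrow> dist (X j) (X k) < e" and j: "j \<ge> M" for M j e
    by (rule nonneg_bdd_above_summable_on)
      (use fin[OF M j] in \<open>auto simp: bdd_above_def\<close>)
  obtain M0 where M0: "\<And>j k. j \<ge> M0 \<Longrightarrow> k \<ge> M0 \<Longrightarrow> dist (X j) (X k) < 1"
    using metric_CauchyD[OF X, of 1] by auto
  have "(\<lambda>n. (cmod (l n))\<^sup>2) summable_on UNIV"
  proof (rule sq_summable_bound[OF ell2_summable[of "X M0"] summ[OF M0 order_refl],
        where c = 2 and d = 2])
    show "(cmod (l n))\<^sup>2 \<le> 2 * (cmod (ell2_fun (X M0) n))\<^sup>2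
        + 2 * (cmod (ell2_fun (X M0) n - l n))\<^sup>2" for n
      using cmod_add_sq_le[of "ell2_fun (X M0) n" "- (ell2_fun (X M0) n - l n)"]
      by (simp add: norm_minus_commute)
  qed simp_all
  then have L: "ell2_fun (ell2_of l) = l"
    by (intro ell2_of_inverse) simp
  have "X \<longlonglongrightarrow> ell2_of l"
  proof (rule metric_LIMSEQ_I)
    fix e :: real assume e: "e > 0"
    then obtain M where M: "\<And>j k. j \<ge> M \<Longrightarrow> k \<ge> M \<Longrightarrow> dist (X j) (X k) < e / 2"
      using metric_CauchyD[OF X, of "e / 2"] by (metis half_gt_zero)
    have "dist (X j) (ell2_of l) < e" if j: "j \<ge> M" for j
    proof -
      have "(norm (X j - ell2_of l))\<^sup>2 \<le> (e / 2)\<^sup>2"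
        unfolding ell2_norm_sq minus_ell2.rep_eq L
        by (rule infsum_le_finite_sums[OF summ[OF M j] fin[OF M j]])
      then have "norm (X j - ell2_of l) \<le> e / 2"
        using e by (simp add: power2_le_iff_abs_le)
      then show ?thesis
        using e by (simp add: dist_norm)
    qed
    then show "\<exists>M. \<forall>j\<ge>M. dist (X j) (ell2_of l) < e"
      by blast
  qed
  then show "convergent X"
    by (auto simp: convergent_def)
qed

lift_definition ket :: "int \<Rightarrow> ell2" is "\<lambda>m n. if n = m then 1 else 0"
  by (rule summable_on_cong_neutral[THEN iffD1, OF _ _ _ summable_on_finite[of "{m}" for m]])
     auto

text \<open>
  Elements of \<open>ell2 \<Rightarrow>\<^sub>L ell2\<close> are real-linear; multiplication by a complex scalar is therefore
  itself one of them.
\<close>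

lemma ell2_local_op:
  fixes T :: "(int \<Rightarrow> complex) \<Rightarrow> int \<Rightarrow> complex"
  assumes add: "\<And>u v n. T (\<lambda>m. u m + v m) n = T u n + T v n"
    and scale: "\<And>r u n. T (\<lambda>m. complex_of_real r * u m) n = complex_of_real r * T u n"
    and bound: "\<And>u n. (cmod (T u n))\<^sup>2
      \<le> a * (cmod (u (n - 1)))\<^sup>2 + a * (cmod (u (n + 1)))\<^sup>2 + c * (cmod (u n))\<^sup>2"
  shows "ell2_fun (Blinfun (\<lambda>u. ell2_of (T (ell2_fun u))) u) = T (ell2_fun u)"
proof -
  let ?g = "\<lambda>u n. (cmod (ell2_fun u n))\<^sup>2"
  have bij: "bij_betw (\<lambda>n::int. n + k) UNIV UNIV" for k
    by (rule bij_betwI[where g = "\<lambda>n. n - k"]) auto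
  have sh: "(\<lambda>n. ?g u (n + k)) summable_on UNIV" "(\<Sum>\<^sub>\<infinity>n. ?g u (n + k)) = (norm u)\<^sup>2" for u k
    using summable_on_reindex_bij_betw[OF bij, of "?g u" k] ell2_summable[of u]
      infsum_reindex_bij_betw[OF bij, of "?g u" k]
    by (simp_all add: ell2_norm_sq)
  let ?B = "\<lambda>u n. a * ?g u (n + -1) + a * ?g u (n + 1) + c * ?g u n"
  have B: "?B u summable_on UNIV" for u
    by (intro summable_on_add summable_on_cmult_right sh ell2_summable)
  have le: "(cmod (T (ell2_fun u) n))\<^sup>2 \<le> ?B u n" for u n
    using bound[of "ell2_fun u" n] by simp
  have S: "(\<lambda>n. (cmod (T (ell2_fun u) n))\<^sup>2) summable_on UNIV" for u
    by (rule summable_on_comparison_test[OF B le]) simp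
  then have R: "ell2_fun (ell2_of (T (ell2_fun u))) = T (ell2_fun u)" for u
    by (intro ell2_of_inverse) simp
  have "bounded_linear (\<lambda>u. ell2_of (T (ell2_fun u)))"
  proof (rule bounded_linear_intro[where K = "sqrt \<bar>2 * a + c\<bar>"])
    show "ell2_of (T (ell2_fun (u + v))) = ell2_of (T (ell2_fun u)) + ell2_of (T (ell2_fun v))" for u v
      using R[of "u + v"] by (simp add: ell2_fun_inject[symmetric] R plus_ell2.rep_eq add fun_eq_iff)
    show "ell2_of (T (ell2_fun (r *\<^sub>R u))) = r *\<^sub>R ell2_of (T (ell2_fun u))" for r u
      using R[of "r *\<^sub>R u"] by (simp add: ell2_fun_inject[symmetric] R scaleR_ell2.rep_eq scale fun_eq_iff)
    fix u
    have "(norm (ell2_of (T (ell2_fun u))))\<^sup>2 \<le> (\<Sum>\<^sub>\<infinity>n. ?B u n)"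
      unfolding ell2_norm_sq R by (rule infsum_mono[OF S B le])
    also have "\<dots> = (\<Sum>\<^sub>\<infinity>n. a * ?g u (n + -1)) + (\<Sum>\<^sub>\<infinity>n. a * ?g u (n + 1)) + (\<Sum>\<^sub>\<infinity>n. c * ?g u n)"
      by (subst infsum_add,
          intro summable_on_add summable_on_cmult_right sh ell2_summable,
          intro summable_on_cmult_right ell2_summable,
          subst infsum_add, (intro summable_on_cmult_right sh)+, rule refl)
    also have "\<dots> = a * (norm u)\<^sup>2 + a * (norm u)\<^sup>2 + c * (norm u)\<^sup>2"
      unfolding infsum_cmult_right' sh(2) ell2_norm_sq[symmetric] ..
    also have "\<dots> = (2 * a + c) * (norm u)\<^sup>2"
      by (simp add: algebra_simps)
    also have "\<dots> \<le> \<bar>2 * a + c\<bar> * (norm u)\<^sup>2"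
      by (intro mult_right_mono) auto
    also have "\<dots> = (norm u * sqrt \<bar>2 * a + c\<bar>)\<^sup>2"
      unfolding power_mult_distrib by simp
    finally show "norm (ell2_of (T (ell2_fun u))) \<le> norm u * sqrt \<bar>2 * a + c\<bar>"
      by (rule power2_le_imp_le) simp
  qed
  then show ?thesis
    by (simp add: bounded_linear_Blinfun_apply R)
qed

definition scalar_op :: "complex \<Rightarrow> ell2 \<Rightarrow>\<^sub>L ell2" where
  "scalar_op c = Blinfun (\<lambda>u. ell2_of (\<lambda>n. c * ell2_fun u n))"

definition op_exp :: "(ell2 \<Rightarrow>\<^sub>L ell2) \<Rightarrow> (ell2 \<Rightarrow>\<^sub>L ell2)" where
  "op_exp A = (\<Sum>k. (((\<lambda>B. A o\<^sub>L B) ^^ k) id_blinfun) /\<^sub>R fact k)"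

lemma op_exp_summable: "summable (\<lambda>k. (((\<lambda>B. A o\<^sub>L B) ^^ k) id_blinfun :: ell2 \<Rightarrow>\<^sub>L ell2) /\<^sub>R fact k)"
proof (rule summable_comparison_test'[where N = 0])
  show "summable (\<lambda>k. norm A ^ k /\<^sub>R fact k)"
    by (rule summable_exp_generic)
  fix k :: nat
  have "norm (((\<lambda>B. A o\<^sub>L B) ^^ k) id_blinfun) \<le> norm A ^ k"
  proof (induction k)
    case 0
    show ?case by (simp add: norm_blinfun_id_le)
  next
    case (Suc k)
    then show ?case
      using norm_blinfun_compose[of A "((\<lambda>B. A o\<^sub>L B) ^^ k) id_blinfun"]
        mult_left_mono[OF Suc norm_ge_zero[of A]] by simp
  qed
  then show "norm ((((\<lambda>B. A o\<^sub>L B) ^^ k) id_blinfun) /\<^sub>R fact k) \<le> norm A ^ k /\<^sub>R fact k"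
    by (simp add: mult_left_mono)
qed

definition schroedinger ::
    "(real \<Rightarrow> real) \<Rightarrow> real \<Rightarrow> real \<Rightarrow> real \<Rightarrow> (ell2 \<Rightarrow>\<^sub>L ell2)" where
  "schroedinger f lam \<omega> \<theta> = Blinfun (\<lambda>u. ell2_of (\<lambda>n.
     ell2_fun u (n - 1) + ell2_fun u (n + 1)
       + complex_of_real (lam * f (of_int n * \<omega> + \<theta>)) * ell2_fun u n))"

lemma scalar_op_apply: "ell2_fun (scalar_op c u) n = c * ell2_fun u n"
proof -
  have "ell2_fun (scalar_op c u) = (\<lambda>n. c * ell2_fun u n)"
    unfolding scalar_op_def
    by (rule ell2_local_op[where a = 0 and c = "(cmod c)\<^sup>2"])
      (simp_all add: algebra_simps norm_mult power_mult_distrib)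
  then show ?thesis by simp
qed

lemma schroedinger_apply:
  assumes "bounded (range f)"
  shows "ell2_fun (schroedinger f lam \<omega> \<theta> u) n = ell2_fun u (n - 1) + ell2_fun u (n + 1)
    + complex_of_real (lam * f (of_int n * \<omega> + \<theta>)) * ell2_fun u n"
proof -
  obtain C where C: "\<And>x. \<bar>f x\<bar> \<le> C"
    using assms by (auto simp: bounded_iff)
  let ?T = "\<lambda>u n. u (n - 1) + u (n + 1) + complex_of_real (lam * f (of_int n * \<omega> + \<theta>)) * u n"
  have "ell2_fun (schroedinger f lam \<omega> \<theta> u) = ?T (ell2_fun u)"
    unfolding schroedinger_def
  proof (rule ell2_local_op[where a = 4 and c = "2 * (\<bar>lam\<bar> * C)\<^sup>2"])
    fix u :: "int \<Rightarrow> complex" and n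
    let ?V = "complex_of_real (lam * f (of_int n * \<omega> + \<theta>))"
    have "cmod ?V \<le> \<bar>lam\<bar> * C"
      unfolding norm_of_real abs_mult by (intro mult_left_mono C) simp
    then have "(cmod (?V * u n))\<^sup>2 \<le> (\<bar>lam\<bar> * C)\<^sup>2 * (cmod (u n))\<^sup>2"
      unfolding norm_mult power_mult_distrib[of "cmod ?V"]
      by (intro mult_right_mono power_mono) auto
    then show "(cmod (?T u n))\<^sup>2 \<le> 4 * (cmod (u (n - 1)))\<^sup>2 + 4 * (cmod (u (n + 1)))\<^sup>2
        + 2 * (\<bar>lam\<bar> * C)\<^sup>2 * (cmod (u n))\<^sup>2"
      using cmod_add_sq_le[of "u (n - 1) + u (n + 1)" "?V * u n"]
        cmod_add_sq_le[of "u (n - 1)" "u (n + 1)"] by linarith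
  qed (simp_all add: algebra_simps)
  then show ?thesis by simp
qed

definition evolution :: "(ell2 \<Rightarrow>\<^sub>L ell2) \<Rightarrow> real \<Rightarrow> (ell2 \<Rightarrow>\<^sub>L ell2)" where
  "evolution H t = op_exp (scalar_op (- \<i> * complex_of_real t) o\<^sub>L H)"

text \<open>
  Functions on the circle \<open>\<real> / \<int>\<close> are functions on \<open>\<real>\<close> of period 1.
\<close>

definition real_analytic :: "(real \<Rightarrow> real) \<Rightarrow> bool" where
  "real_analytic f \<longleftrightarrow>
     (\<forall>x. \<exists>a. \<exists>r>0. \<forall>y. \<bar>y - x\<bar> < r \<longrightarrow> (\<lambda>k. a k * (y - x) ^ k) sums f y)"

definition analytic_on_circle :: "(real \<Rightarrow> real) \<Rightarrow> bool" where
  "analytic_on_circle f \<longleftrightarrow> (\<forall>x. f (x + 1) = f x) \<and> real_analytic f"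

lemma analytic_on_circle_bounded:
  assumes "analytic_on_circle f"
  shows "bounded (range f)"
proof -
  have per: "f (x + 1) = f x" for x
    using assms by (simp add: analytic_on_circle_def)
  have pern: "f (x + real n) = f x" for x n
  proof (induction n)
    case (Suc n)
    then show ?case using per[of "x + real n"] by (simp add: algebra_simps)
  qed simp
  have peri: "f (x + of_int k) = f x" for x k
  proof (cases k)
    case (nonneg n)
    then show ?thesis by (simp add: pern)
  next
    case (neg n)
    then show ?thesis using pern[of "x + of_int k" "Suc n"] by simp
  qed
  have "isCont f x" for x
  proof -
    obtain a r where r: "r > 0" and
      a: "\<And>y. \<bar>y - x\<bar> < r \<Longrightarrow> (\<lambda>k. a k * (y - x) ^ k) sums f y"
      using assms unfolding analytic_on_circle_def real_analytic_def by metis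
    have "summable (\<lambda>k. a k * (r / 2) ^ k)"
      using a[of "x + r / 2"] r by (auto simp: sums_iff)
    then have "isCont (\<lambda>z. \<Sum>k. a k * z ^ k) (x - x)"
      by (rule isCont_powser) (use r in auto)
    then have "isCont (\<lambda>y. \<Sum>k. a k * (y - x) ^ k) x"
      by (intro isCont_o2[of x "\<lambda>y. y - x" "\<lambda>z. \<Sum>k. a k * z ^ k"]) (auto intro!: continuous_intros)
    moreover have "\<forall>\<^sub>F y in nhds x. (\<Sum>k. a k * (y - x) ^ k) = f y"
      unfolding eventually_nhds_metric using r a by (auto simp: dist_real_def sums_iff)
    ultimately show ?thesis
      by (simp add: isCont_cong)
  qed
  then have "compact (f ` {0..1})"
    by (intro compact_continuous_image continuous_at_imp_continuous_on) auto
  moreover have "range f \<subseteq> f ` {0..1}"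
  proof clarify
    fix x
    have "f x = f (frac x)"
      using peri[of "frac x" "\<lfloor>x\<rfloor>"] unfolding frac_def by simp
    moreover have "frac x \<in> {0..1}"
      using frac_lt_1[of x] by (simp add: less_imp_le)
    ultimately show "f x \<in> f ` {0..1}" by blast
  qed
  ultimately show ?thesis
    using bounded_subset compact_imp_bounded by blast
qed

text \<open>Complete quotients, obtained by iterating the Gauss map.\<close>

fun cf_complete :: "real \<Rightarrow> nat \<Rightarrow> real" where
  "cf_complete \<omega> 0 = \<omega>"
| "cf_complete \<omega> (Suc n) = 1 / frac (cf_complete \<omega> n)"

definition cf_coeff :: "real \<Rightarrow> nat \<Rightarrow> int" where
  "cf_coeff \<omega> n = \<lfloor>cf_complete \<omega> n\<rfloor>"

text \<open>Denominators of the approximants \<open>p\<^sub>n / q\<^sub>n = [a\<^sub>0; a\<^sub>1, \<dots>, a\<^sub>n]\<close>.\<close>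

fun cf_denom :: "real \<Rightarrow> nat \<Rightarrow> int" where
  "cf_denom \<omega> 0 = 1"
| "cf_denom \<omega> (Suc 0) = cf_coeff \<omega> 1"
| "cf_denom \<omega> (Suc (Suc n)) =
     cf_coeff \<omega> (Suc (Suc n)) * cf_denom \<omega> (Suc n) + cf_denom \<omega> n"

definition diophantine :: "real \<Rightarrow> bool" where
  "diophantine \<omega> \<longleftrightarrow> (\<exists>\<kappa>>0. \<forall>\<^sub>F n in sequentially.
     real_of_int (cf_denom \<omega> (Suc n)) < real_of_int (cf_denom \<omega> n) powr (1 + \<kappa>))"

definition transition_prob :: "(ell2 \<Rightarrow>\<^sub>L ell2) \<Rightarrow> int \<Rightarrow> real \<Rightarrow> real" where
  "transition_prob H n t =
     ((cmod (cinner (evolution H t (ket 0)) (ket n)))\<^sup>2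
      + (cmod (cinner (evolution H t (ket 1)) (ket n)))\<^sup>2) / 2"

definition avg_transition_prob :: "(ell2 \<Rightarrow>\<^sub>L ell2) \<Rightarrow> int \<Rightarrow> real \<Rightarrow> real" where
  "avg_transition_prob H n T =
     2 / T * (LBINT t:{0..}. exp (- 2 * t / T) * transition_prob H n t)"

text \<open>
  For the nearest-neighbour operators with bounded potential considered here both series below
  converge, since matrix elements of the evolution decay superexponentially in \<open>\<bar>n\<bar>\<close> for fixed
  \<open>t\<close>, and those of the average exponentially for fixed \<open>T\<close>; so the real-valued \<^const>\<open>infsum\<close> is
  the genuine sum.
\<close>

definition moment :: "(ell2 \<Rightarrow>\<^sub>L ell2) \<Rightarrow> real \<Rightarrow> real \<Rightarrow> real" where
  "moment H p t = (\<Sum>\<^sub>\<infinity>n. (1 + \<bar>real_of_int n\<bar>) powr p * transition_prob H n t)"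

definition avg_moment :: "(ell2 \<Rightarrow>\<^sub>L ell2) \<Rightarrow> real \<Rightarrow> real \<Rightarrow> real" where
  "avg_moment H p T = (\<Sum>\<^sub>\<infinity>n. (1 + \<bar>real_of_int n\<bar>) powr p * avg_transition_prob H n T)"

definition beta_plus :: "(ell2 \<Rightarrow>\<^sub>L ell2) \<Rightarrow> real \<Rightarrow> ereal" where
  "beta_plus H p = Limsup at_top (\<lambda>t. ereal (ln (moment H p t) / (p * ln t)))"

definition beta_minus :: "(ell2 \<Rightarrow>\<^sub>L ell2) \<Rightarrow> real \<Rightarrow> ereal" where
  "beta_minus H p = Liminf at_top (\<lambda>T. ereal (ln (avg_moment H p T) / (p * ln T)))"

end

theory Submission
  imports Defs "HOL-Complex_Analysis.Complex_Analysis" "HOL-Number_Theory.Number_Theory"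
    "HOL-Real_Asymp.Real_Asymp"
begin

text \<open>
  The amplitude \<open>\<langle>e\<^sup>-\<^sup>i\<^sup>t\<^sup>H \<delta>\<^sub>0, \<delta>\<^sub>k\<rangle>\<close> is a contour integral of \<open>e\<^sup>-\<^sup>i\<^sup>t\<^sup>z\<close> times the resolvent kernel over
  a circle around the spectrum whose upper part is replaced by a segment of the line \<open>Im z = \<eta>\<close>,
  where \<open>\<eta>\<close> is of order \<open>1 / t\<close>. The resolvent of a half line has norm at most \<open>1 / \<eta>\<close>, so the kernel
  decays by the factor \<open>1 / (\<eta> M)\<close> across every block of \<open>N\<close> sites in which some solution with
  Dirichlet data grows to size \<open>M\<close>; \<open>M\<close> of order \<open>\<eta>\<^sup>-\<^sup>2\<close> then bounds the moments by a power of \<open>N\<close>.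

  Let \<open>P n x\<close> be the solution after \<open>n\<close> steps with initial phase \<open>x\<close>. It extends to a
  periodic holomorphic function on a strip, of size at most \<open>(C \<lambda>)\<^sup>n\<close>, while on a suitable line
  \<open>Im x = y\<close> in the inner half of the strip \<open>\<lambda> f\<close> stays at distance \<open>\<delta> \<lambda>\<close> from the energy, so that
  \<open>P n\<close> has size at least \<open>(\<delta> \<lambda> / 2)\<^sup>n\<close> there. By the three lines theorem the maximum of \<open>P n\<close> over
  the circle is at least \<open>e\<^sup>n\<close> for large \<open>\<lambda>\<close>, and its derivative is at most \<open>O(n)\<close> times this maximum. Hence any
  net of mesh \<open>c / n\<close> meets a point with \<open>P n \<ge> e\<^sup>n / 2\<close>, in particular an orbit of length \<open>q\<close>
  for a denominator \<open>q \<ge> C n\<close> of an approximant of \<open>\<omega>\<close>. Thus \<open>N\<close> is of order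
  \<open>q\<close> with \<open>n\<close> of order \<open>ln t\<close>: for a Diophantine frequency \<open>N\<close> is polylogarithmic in \<open>t\<close> for all
  large \<open>t\<close>, and in general it is so along a sequence of times.
\<close>

subsection \<open>Approximants and the density of finite orbits\<close>

text \<open>An interval \<open>[- L, L]\<close> stands in for the spectral theory of the whole line:
  its resolvent is an explicit rational function of \<open>z\<close>, bounded by
  \<open>1 / Im z\<close> through an energy identity. It is compared with the whole line only on a
  circle of radius twice the bound \<open>B + 2\<close> of the operator, where the Neumann series
  converges. Below the segment that series suffices, because \<open>exp (-itz)\<close> is at most
  \<open>exp (\<eta> t)\<close> there; above it this factor can be as large as
  \<open>exp (t R)\<close>, which is why the contour is pulled down. Growth is needed at every phase
  and every complex energy of the segment, so it is extracted from the maximum over the circle. The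
  line at half height suffices because the square of \<open>\<delta> \<lambda> / 2\<close> exceeds
  the outer bound \<open>C \<lambda>\<close> by a factor of order \<open>\<lambda>\<close>. The
  frequency enters the estimates only through \<open>dense_orbit\<close>, so threshold and constants
  are uniform in frequency and phase. The time \<open>t\<close> and the scale \<open>T\<close> are
  kept apart, with a loss \<open>exp (t / T)\<close>, so that one bound serves a fixed time as well
  as the exponential average.\<close>

fun cf_num :: "real \<Rightarrow> nat \<Rightarrow> int" where
  "cf_num \<omega> 0 = cf_coeff \<omega> 0"
| "cf_num \<omega> (Suc 0) = cf_coeff \<omega> 1 * cf_coeff \<omega> 0 + 1"
| "cf_num \<omega> (Suc (Suc n)) =
     cf_coeff \<omega> (Suc (Suc n)) * cf_num \<omega> (Suc n) + cf_num \<omega> n"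

lemma cf_complete_irrational:
  assumes "\<omega> \<notin> \<rat>"
  shows "cf_complete \<omega> n \<notin> \<rat>"
proof (induction n)
  case (Suc n)
  have "cf_complete \<omega> n = of_int \<lfloor>cf_complete \<omega> n\<rfloor> + 1 / cf_complete \<omega> (Suc n)"
    by (simp add: frac_def)
  then show ?case
    using Suc by (metis Rats_1 Rats_add Rats_divide Rats_of_int)
qed (use assms in simp)

lemma frac_cf_complete:
  assumes "\<omega> \<notin> \<rat>"
  shows "0 < frac (cf_complete \<omega> n)"
  using cf_complete_irrational[OF assms, of n] Ints_subset_Rats by (auto simp: frac_gt_0_iff)

lemma cf_complete_gt_1:
  assumes "\<omega> \<notin> \<rat>"
  shows "1 < cf_complete \<omega> (Suc n)"
  using frac_cf_complete[OF assms, of n] frac_lt_1[of "cf_complete \<omega> n"] by simp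

lemma cf_coeff_ge_1:
  assumes "\<omega> \<notin> \<rat>"
  shows "1 \<le> cf_coeff \<omega> (Suc n)"
  using cf_complete_gt_1[OF assms, of n] unfolding cf_coeff_def by (simp add: le_floor_iff)

lemma cf_complete_split:
  assumes "\<omega> \<notin> \<rat>"
  shows "cf_complete \<omega> n * cf_complete \<omega> (Suc n)
    = of_int (cf_coeff \<omega> n) * cf_complete \<omega> (Suc n) + 1"
proof -
  have "cf_complete \<omega> n = of_int (cf_coeff \<omega> n) + frac (cf_complete \<omega> n)"
    by (simp add: frac_def cf_coeff_def)
  moreover have "frac (cf_complete \<omega> n) * cf_complete \<omega> (Suc n) = 1"
    using frac_cf_complete[OF assms, of n] by simp
  ultimately show ?thesis
    by (metis distrib_right)
qed


lemma cf_induct [case_names 0 1 step]: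
  assumes "P 0" "P (Suc 0)" "\<And>n. P n \<Longrightarrow> P (Suc n) \<Longrightarrow> P (Suc (Suc n))"
  shows "P (n::nat)"
  using assms by (induction n rule: induct_nat_012) auto

lemma cf_denom_pos:
  assumes "\<omega> \<notin> \<rat>"
  shows "0 < cf_denom \<omega> n"
proof (induction n rule: cf_induct)
  case 1
  show ?case using cf_coeff_ge_1[OF assms, of 0] by simp
next
  case (step n)
  then show ?case
    using mult_pos_pos[of "cf_coeff \<omega> (Suc (Suc n))" "cf_denom \<omega> (Suc n)"]
      cf_coeff_ge_1[OF assms, of "Suc n"] by (simp add: add_pos_pos)
qed simp

lemma cf_denom_mono:
  assumes "\<omega> \<notin> \<rat>"
  shows "cf_denom \<omega> n \<le> cf_denom \<omega> (Suc n)"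
proof (cases n)
  case 0
  then show ?thesis using cf_coeff_ge_1[OF assms, of 0] by simp
next
  case (Suc m)
  have "cf_denom \<omega> (Suc m) * 1 \<le> cf_denom \<omega> (Suc m) * cf_coeff \<omega> (Suc (Suc m))"
    using cf_denom_pos[OF assms, of "Suc m"] cf_coeff_ge_1[OF assms, of "Suc m"]
    by (intro mult_left_mono) auto
  then show ?thesis
    using cf_denom_pos[OF assms, of m] Suc by (simp add: mult.commute)
qed

lemma cf_denom_ge:
  assumes "\<omega> \<notin> \<rat>"
  shows "int n \<le> cf_denom \<omega> n"
proof (induction n rule: cf_induct)
  case 1
  show ?case using cf_coeff_ge_1[OF assms, of 0] by simp
next
  case (step n)
  have "cf_denom \<omega> (Suc n) * 1 \<le> cf_denom \<omega> (Suc n) * cf_coeff \<omega> (Suc (Suc n))"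
    using cf_denom_pos[OF assms, of "Suc n"] cf_coeff_ge_1[OF assms, of "Suc n"]
    by (intro mult_left_mono) auto
  then show ?case
    using step cf_denom_pos[OF assms, of n] unfolding cf_denom.simps mult.commute[of "cf_coeff _ _"]
    by linarith
qed simp

lemma cf_det:
  "cf_num \<omega> (Suc n) * cf_denom \<omega> n - cf_num \<omega> n * cf_denom \<omega> (Suc n) = (-1) ^ n"
proof (induction n)
  case (Suc n)
  have "cf_num \<omega> (Suc (Suc n)) * cf_denom \<omega> (Suc n) - cf_num \<omega> (Suc n) * cf_denom \<omega> (Suc (Suc n))
    = - (cf_num \<omega> (Suc n) * cf_denom \<omega> n - cf_num \<omega> n * cf_denom \<omega> (Suc n))"
    by (simp add: algebra_simps)
  then show ?case using Suc by simp
qed simp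

lemma cf_coprime: "coprime (cf_num \<omega> n) (cf_denom \<omega> n)"
proof (rule coprimeI)
  fix c assume "c dvd cf_num \<omega> n" "c dvd cf_denom \<omega> n"
  then have "c dvd cf_num \<omega> (Suc n) * cf_denom \<omega> n - cf_num \<omega> n * cf_denom \<omega> (Suc n)"
    by simp
  then show "is_unit c"
    unfolding cf_det using dvd_trans[of c "(-1) ^ n" 1] by simp
qed

text \<open>The classical identity that makes \<open>\<omega>\<close> a Moebius image of a complete
  quotient, with denominators cleared. One step trades the quotient \<open>x\<close> for the next
  one \<open>y\<close> through \<open>x * y = a * y + 1\<close>, so the induction step multiplies by
  \<open>y\<close>.\<close>

lemma cf_moebius:
  assumes "\<omega> \<notin> \<rat>"
  shows "\<omega> * (cf_complete \<omega> (Suc (Suc n)) * of_int (cf_denom \<omega> (Suc n)) + of_int (cf_denom \<omega> n))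
    = cf_complete \<omega> (Suc (Suc n)) * of_int (cf_num \<omega> (Suc n)) + of_int (cf_num \<omega> n)"
proof (induction n)
  case 0
  define x1 x2 a0 a1 where "x1 = cf_complete \<omega> 1" and "x2 = cf_complete \<omega> 2"
    and "a0 = real_of_int (cf_coeff \<omega> 0)" and "a1 = real_of_int (cf_coeff \<omega> 1)"
  have "\<omega> * x1 = a0 * x1 + 1" "x1 * x2 = a1 * x2 + 1"
    using cf_complete_split[OF assms, of 0] cf_complete_split[OF assms, of 1]
    by (simp_all add: x1_def x2_def a0_def a1_def numeral_2_eq_2 del: cf_complete.simps(2))
  then have "(\<omega> * x1) * (a1 * x2 + 1) = (a0 * x1 + 1) * (x1 * x2)" "x1 * (a0 * (x1 * x2)) = x1 * (a0 * (a1 * x2 + 1))"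
    by simp_all
  then have "x1 * (\<omega> * (x2 * a1 + 1)) = x1 * (x2 * (a1 * a0 + 1) + a0)"
    by (simp add: algebra_simps)
  moreover have "x1 \<noteq> 0"
    using cf_complete_gt_1[OF assms, of 0] by (simp add: x1_def del: cf_complete.simps(2))
  ultimately have "\<omega> * (x2 * a1 + 1) = x2 * (a1 * a0 + 1) + a0"
    by simp
  then show ?case
    by (simp add: x2_def a0_def a1_def numeral_2_eq_2 del: cf_complete.simps(2))
next
  case (Suc n)
  define x y a where "x = cf_complete \<omega> (Suc (Suc n))" and "y = cf_complete \<omega> (Suc (Suc (Suc n)))"
    and "a = real_of_int (cf_coeff \<omega> (Suc (Suc n)))"
  define p p' q q' where "p = real_of_int (cf_num \<omega> n)" and "p' = real_of_int (cf_num \<omega> (Suc n))"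
    and "q = real_of_int (cf_denom \<omega> n)" and "q' = real_of_int (cf_denom \<omega> (Suc n))"
  have IH: "\<omega> * (x * q' + q) = x * p' + p"
    using Suc by (simp add: x_def p_def p'_def q_def q'_def)
  have xy: "x * y = a * y + 1"
    using cf_complete_split[OF assms, of "Suc (Suc n)"] by (simp add: x_def y_def a_def del: cf_complete.simps(2))
  have "y * (\<omega> * (x * q' + q)) = y * (x * p' + p)"
    using IH by simp
  then have "\<omega> * ((x * y) * q' + y * q) = (x * y) * p' + y * p"
    by (simp add: algebra_simps)
  then have "\<omega> * (y * (a * q' + q) + q') = y * (a * p' + p) + p'"
    unfolding xy by (simp add: algebra_simps)
  then show ?case
    by (simp add: x_def y_def a_def p_def p'_def q_def q'_def del: cf_complete.simps(2))
qed

text \<open>Multiplied by \<open>x * q' + q\<close>, with \<open>x\<close> the complete quotient,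
  the error becomes the determinant \<open>p' * q - p * q'\<close> up to sign, of modulus 1. The
  bound by its own denominator, not the next one, is enough for orbits of length \<open>q'\<close>:
  they deviate from the rational rotation by at most \<open>1 / q'\<close>.\<close>

lemma cf_approx:
  assumes "\<omega> \<notin> \<rat>"
  shows "\<bar>of_int (cf_denom \<omega> (Suc n)) * \<omega> - of_int (cf_num \<omega> (Suc n))\<bar>
    \<le> 1 / of_int (cf_denom \<omega> (Suc n))"
proof -
  define x where "x = cf_complete \<omega> (Suc (Suc n))"
  define p p' q q' where "p = real_of_int (cf_num \<omega> n)" and "p' = real_of_int (cf_num \<omega> (Suc n))"
    and "q = real_of_int (cf_denom \<omega> n)" and "q' = real_of_int (cf_denom \<omega> (Suc n))"
  have pos: "0 < q" "0 < q'" "1 < x"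
    using cf_denom_pos[OF assms, of n] cf_denom_pos[OF assms, of "Suc n"]
      cf_complete_gt_1[OF assms, of "Suc n"] by (auto simp: q_def q'_def x_def simp del: cf_complete.simps(2))
  have det: "p' * q - p * q' = (-1) ^ n"
    unfolding p_def p'_def q_def q'_def
    by (metis cf_det of_int_diff of_int_mult of_int_power of_int_minus of_int_1)
  have "\<omega> * (x * q' + q) = x * p' + p"
    using cf_moebius[OF assms, of n] by (simp add: x_def p_def p'_def q_def q'_def)
  moreover have "(q' * \<omega> - p') * (x * q' + q) = q' * (\<omega> * (x * q' + q)) - p' * (x * q' + q)"
    by (simp add: algebra_simps)
  ultimately have "(q' * \<omega> - p') * (x * q' + q) = q' * (x * p' + p) - p' * (x * q' + q)"
    by simp
  also have "\<dots> = - (p' * q - p * q')"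
    by (simp add: algebra_simps)
  finally have "(q' * \<omega> - p') * (x * q' + q) = - (p' * q - p * q')" .
  then have "\<bar>(q' * \<omega> - p') * (x * q' + q)\<bar> = 1"
    unfolding det by (simp only: abs_minus_cancel power_abs) simp
  moreover have "\<bar>x * q' + q\<bar> = x * q' + q"
    using pos by simp
  ultimately have "\<bar>q' * \<omega> - p'\<bar> * (x * q' + q) = 1"
    unfolding abs_mult by simp
  moreover have "\<bar>q' * \<omega> - p'\<bar> * q' \<le> \<bar>q' * \<omega> - p'\<bar> * (x * q' + q)"
  proof (rule mult_left_mono)
    show "q' \<le> x * q' + q"
      using pos mult_right_mono[of 1 x q'] by linarith
  qed simp
  ultimately show ?thesis
    using pos by (simp add: field_simps p'_def q'_def)
qed

text \<open>As \<open>p\<close> is invertible modulo \<open>q\<close>, some \<open>m\<close> makes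
  \<open>m * p / q\<close> agree modulo 1 with the multiple of \<open>1 / q\<close> just below
  \<open>x - \<theta>\<close>. This costs \<open>1 / q\<close>, and replacing \<open>p / q\<close>
  by \<open>\<omega>\<close> costs another \<open>1 / q\<close>.\<close>

lemma orbit_dense:
  fixes p q :: int and \<omega> \<theta> x :: real
  assumes "0 < q" "coprime p q" "\<bar>of_int q * \<omega> - of_int p\<bar> \<le> 1 / of_int q"
  shows "\<exists>m l. 1 \<le> m \<and> m \<le> q \<and> \<bar>\<theta> + of_int m * \<omega> - (x + of_int l)\<bar> \<le> 2 / of_int q"
proof -
  define c where "c = \<lfloor>of_int q * (x - \<theta>)\<rfloor>"
  have c: "\<bar>of_int q * (x - \<theta>) - of_int c\<bar> \<le> 1"
    unfolding c_def by linarith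
  obtain m0 where m0: "[p * m0 = 1] (mod q)"
    using assms(2) cong_solve_coprime_int by blast
  \<comment> \<open>Shifting before and after the reduction picks the representative in
    \<open>1..q\<close> instead of \<open>0..q - 1\<close>.\<close>
  define m where "m = (m0 * c - 1) mod q + 1"
  have m: "1 \<le> m" "m \<le> q"
    using assms(1) pos_mod_bound[of q "m0 * c - 1"] pos_mod_sign[of q "m0 * c - 1"]
    unfolding m_def by linarith+
  have "[m = m0 * c] (mod q)"
    unfolding m_def by (simp add: cong_def mod_simps)
  then have "[p * m = p * (m0 * c)] (mod q)"
    by (rule cong_scalar_left)
  also have "[p * (m0 * c) = c] (mod q)"
    using cong_scalar_right[OF m0, of c] by (simp add: mult.assoc)
  finally obtain l where l: "p * m = c + q * l"
    by (metis cong_iff_lin cong_sym)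
  have q: "0 < real_of_int q" using assms(1) by simp
  have "real_of_int q * (\<theta> + of_int m * \<omega> - (x + of_int l))
    = of_int m * (of_int q * \<omega> - of_int p) + (of_int (p * m - q * l) - of_int q * (x - \<theta>))"
    by (simp add: algebra_simps)
  also have "of_int (p * m - q * l) = real_of_int c"
    using l by simp
  finally have "real_of_int q * \<bar>\<theta> + of_int m * \<omega> - (x + of_int l)\<bar>
    = \<bar>of_int m * (of_int q * \<omega> - of_int p) + (of_int c - of_int q * (x - \<theta>))\<bar>"
    using q by (metis abs_mult abs_of_pos)
  also have "\<dots> \<le> of_int m * \<bar>of_int q * \<omega> - of_int p\<bar> + 1"
    using c m by (simp add: abs_mult abs_minus_commute abs_triangle_ineq[THEN order_trans])
  also have "of_int m * \<bar>of_int q * \<omega> - of_int p\<bar> \<le> of_int q * (1 / of_int q)"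
    using m assms(3) by (intro mult_mono) auto
  finally have "real_of_int q * \<bar>\<theta> + of_int m * \<omega> - (x + of_int l)\<bar> \<le> 2"
    using q by simp
  then show ?thesis
    using m q by (intro exI[of _ m] exI[of _ l]) (simp add: field_simps)
qed

text \<open>The localization estimate uses nothing else about the frequency. Times start at 1 so
  that, in a block after site \<open>s\<close>, growth begins strictly to the right of
  \<open>s\<close>.\<close>

definition dense_orbit :: "real \<Rightarrow> nat \<Rightarrow> bool" where
  "dense_orbit \<omega> q \<longleftrightarrow> (\<forall>\<theta> x. \<exists>m l::int. 1 \<le> m \<and> m \<le> int q \<and>
     \<bar>\<theta> + of_int m * \<omega> - (x + of_int l)\<bar> \<le> 2 / real q)"

lemma dense_orbit_cf_denom:
  assumes "\<omega> \<notin> \<rat>"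
  shows "dense_orbit \<omega> (nat (cf_denom \<omega> (Suc n)))"
  using orbit_dense[OF cf_denom_pos[OF assms] cf_coprime cf_approx[OF assms]]
    cf_denom_pos[OF assms, of "Suc n"]
  unfolding dense_orbit_def by auto

lemma dense_orbit_uminus:
  assumes "dense_orbit \<omega> q"
  shows "dense_orbit (- \<omega>) q"
  unfolding dense_orbit_def
proof (intro allI)
  fix \<theta> x
  obtain m l :: int where "1 \<le> m" "m \<le> int q" "\<bar>- \<theta> + of_int m * \<omega> - (- x + of_int l)\<bar> \<le> 2 / real q"
    using assms unfolding dense_orbit_def by blast
  then show "\<exists>m l::int. 1 \<le> m \<and> m \<le> int q \<and> \<bar>\<theta> + of_int m * - \<omega> - (x + of_int l)\<bar> \<le> 2 / real q"
    by (intro exI[of _ m] exI[of _ "- l"]) (simp add: abs_minus_commute algebra_simps)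
qed

lemma dense_orbit_ge:
  assumes "\<omega> \<notin> \<rat>"
  shows "\<exists>q\<ge>n. dense_orbit \<omega> q"
  using dense_orbit_cf_denom[OF assms, of n] cf_denom_ge[OF assms, of "Suc n"]
  by (intro exI[of _ "nat (cf_denom \<omega> (Suc n))"]) auto

text \<open>Take the first denominator that reaches \<open>x\<close>. Its predecessor is below
  \<open>x\<close>, so the Diophantine inequality keeps it under
  \<open>x powr (1 + \<kappa>)\<close>, provided \<open>x\<close> is past the index from which that
  inequality holds.\<close>

lemma dense_orbit_between:
  assumes "\<omega> \<notin> \<rat>" "diophantine \<omega>"
  shows "\<exists>\<kappa>>0. \<forall>\<^sub>F x in at_top. \<exists>q. x \<le> real q \<and> real q \<le> x powr (1 + \<kappa>) \<and> dense_orbit \<omega> q"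
proof -
  obtain \<kappa> where \<kappa>: "\<kappa> > 0" "\<forall>\<^sub>F n in sequentially.
     real_of_int (cf_denom \<omega> (Suc n)) < real_of_int (cf_denom \<omega> n) powr (1 + \<kappa>)"
    using assms(2) unfolding diophantine_def by blast
  then obtain n0 where n0: "\<And>n. n \<ge> n0 \<Longrightarrow>
     real_of_int (cf_denom \<omega> (Suc n)) < real_of_int (cf_denom \<omega> n) powr (1 + \<kappa>)"
    unfolding eventually_sequentially by blast
  have "\<exists>q. x \<le> real q \<and> real q \<le> x powr (1 + \<kappa>) \<and> dense_orbit \<omega> q"
    if x: "x > real_of_int (cf_denom \<omega> n0)" for x
  proof -
    define P where "P n \<longleftrightarrow> x \<le> real_of_int (cf_denom \<omega> n)" for n
    have "P (nat \<lceil>x\<rceil>)"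
      using cf_denom_ge[OF assms(1), of "nat \<lceil>x\<rceil>"] unfolding P_def by linarith
    define n where "n = (LEAST n. P n)"
    have Pn: "P n" and least: "\<And>k. k < n \<Longrightarrow> \<not> P k"
      unfolding n_def using \<open>P (nat \<lceil>x\<rceil>)\<close> by (auto intro: LeastI dest: not_less_Least)
    have mono: "cf_denom \<omega> i \<le> cf_denom \<omega> j" if "i \<le> j" for i j
      using lift_Suc_mono_le[of "cf_denom \<omega>", OF cf_denom_mono[OF assms(1)] that] by blast
    have "n0 < n"
    proof (rule ccontr)
      assume "\<not> n0 < n"
      then have "real_of_int (cf_denom \<omega> n) \<le> real_of_int (cf_denom \<omega> n0)" using mono by simp
      then show False using Pn x unfolding P_def by linarith
    qed
    then obtain k where k: "n = Suc k" "n0 \<le> k" by (metis less_Suc_eq_le lessE)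
    have "real_of_int (cf_denom \<omega> n) \<le> real_of_int (cf_denom \<omega> k) powr (1 + \<kappa>)"
      using n0[OF k(2)] k(1) by simp
    also have "\<dots> \<le> x powr (1 + \<kappa>)"
      using least[of k] k(1) \<kappa>(1) cf_denom_pos[OF assms(1), of k] unfolding P_def
      by (intro powr_mono2) auto
    finally show ?thesis
      using Pn dense_orbit_cf_denom[OF assms(1), of k] cf_denom_pos[OF assms(1), of n] k(1)
      unfolding P_def by (intro exI[of _ "nat (cf_denom \<omega> n)"]) auto
  qed
  then have "\<forall>\<^sub>F x in at_top. \<exists>q. x \<le> real q \<and> real q \<le> x powr (1 + \<kappa>) \<and> dense_orbit \<omega> q"
    by (rule eventually_mono[OF eventually_gt_at_top])
  then show ?thesis
    using \<kappa>(1) by blast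
qed

subsection \<open>Holomorphic extension of the potential\<close>

lemma periodic_int:
  assumes "\<And>x. f (x + 1) = f (x::real)"
  shows "f (x + of_int k) = f x"
proof -
  have n: "f (x + real n) = f x" for x n
  proof (induction n)
    case (Suc n)
    then show ?case using assms[of "x + real n"] by (simp add: algebra_simps)
  qed simp
  show ?thesis
  proof (cases k)
    case (nonneg n)
    then show ?thesis by (simp add: n)
  next
    case (neg n)
    then show ?thesis using n[of "x + of_int k" "Suc n"] by simp
  qed
qed

lemma powser_holomorphic:
  assumes "\<And>y. \<bar>y - x\<bar> < r \<Longrightarrow> (\<lambda>k. a k * (y - x) ^ k) sums f y"
  shows "\<exists>F. F holomorphic_on ball (complex_of_real x) r
    \<and> (\<forall>y. \<bar>y - x\<bar> < r \<longrightarrow> F (of_real y) = of_real (f y))"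
proof -
  let ?a = "\<lambda>k. complex_of_real (a k)"
  have sum: "summable (\<lambda>k. ?a k * (w - of_real x) ^ k)" if w: "w \<in> ball (of_real x) r" for w
  proof -
    \<comment> \<open>Convergence at the real point \<open>x + s\<close> gives convergence of the
      complex series in the smaller disc.\<close>
    obtain s where s: "cmod (w - of_real x) < s" "s < r"
      using w dense[of "cmod (w - of_real x)" r] by (auto simp: dist_norm norm_minus_commute)
    have s0: "0 \<le> s" using s(1) norm_ge_zero order_less_imp_le order_trans by metis
    have "summable (\<lambda>k. a k * s ^ k)"
      using assms[of "x + s"] s s0 by (auto simp: sums_iff)
    then have "summable (\<lambda>k. ?a k * of_real s ^ k)"
      using summable_of_real[of "\<lambda>k. a k * s ^ k", where 'a = complex] by simp
    then show ?thesis
      by (rule powser_inside) (use s s0 in simp)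
  qed
  define F where "F w = (\<Sum>k. ?a k * (w - of_real x) ^ k)" for w
  have "F holomorphic_on ball (of_real x) r"
    by (rule power_series_holomorphic[where a = ?a]) (use sum in \<open>auto simp: F_def summable_sums\<close>)
  moreover have "F (of_real y) = of_real (f y)" if "\<bar>y - x\<bar> < r" for y
    using sums_of_real[OF assms[OF that], where 'a = complex] unfolding F_def by (simp add: sums_iff)
  ultimately show ?thesis by blast
qed

lemma holomorphic_eq_on_real:
  assumes hol: "F holomorphic_on S" "G holomorphic_on S" and S: "open S" "connected S"
    and x: "of_real x \<in> S"
    and eq: "\<And>y::real. of_real y \<in> S \<Longrightarrow> F (of_real y) = G (of_real y)"
    and w: "w \<in> S"
  shows "F w = G w"
proof -
  obtain e where e: "e > 0" "ball (complex_of_real x) e \<subseteq> S"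
    using S x open_contains_ball by blast
  define U where "U = complex_of_real ` {x..<x+e}"
  have US: "U \<subseteq> S"
    using e by (auto simp: U_def dist_norm simp flip: of_real_diff intro!: subsetD[OF e(2)])
  have "complex_of_real x islimpt U"
  proof (rule islimptI)
    fix T assume T: "complex_of_real x \<in> T" "open T"
    then obtain d where d: "d > 0" "ball (complex_of_real x) d \<subseteq> T"
      using open_contains_ball by blast
    define y where "y = x + min d e / 2"
    have "of_real y \<in> U"
      unfolding U_def by (rule imageI) (use d(1) e(1) in \<open>auto simp: y_def\<close>)
    moreover have "of_real y \<in> ball (complex_of_real x) d" "y \<noteq> x"
      using d(1) e(1) by (auto simp: y_def dist_norm min_def simp flip: of_real_diff)
    ultimately have "of_real y \<in> U" "of_real y \<in> ball (complex_of_real x) d" "y \<noteq> x"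
      by auto
    then show "\<exists>z\<in>U. z \<in> T \<and> z \<noteq> complex_of_real x"
      using d(2) by (intro bexI[of _ "of_real y"]) auto
  qed
  then have "(\<lambda>w. F w - G w) w = 0"
    using hol S US x w
    by (intro analytic_continuation[of "\<lambda>w. F w - G w" S U "of_real x" w])
       (auto intro!: holomorphic_intros simp: eq U_def)
  then show ?thesis by simp
qed

lemma compact_strip:
  fixes A :: "real set"
  assumes "compact A" "compact B"
  shows "compact {w. Re w \<in> A \<and> Im w \<in> B}"
proof -
  have "{w. Re w \<in> A \<and> Im w \<in> B} = (\<lambda>(x, y). Complex x y) ` (A \<times> B)"
    by (force simp: image_iff complex_eq_iff)
  moreover have "continuous_on (A \<times> B) (\<lambda>(x, y). Complex x y)"
    by (auto simp: case_prod_unfold Complex_eq intro!: continuous_intros)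
  ultimately show ?thesis
    using assms by (metis compact_Times compact_continuous_image)
qed

text \<open>The power series extend \<open>f\<close> to discs with real centres. Two discs that meet
  in \<open>w\<close> both contain the real point \<open>Re w\<close>, and their intersection is
  convex, so the extensions agree there by the identity theorem. Compactness of one period gives a
  strip of positive width.\<close>

lemma analytic_on_circle_extends:
  assumes "analytic_on_circle f"
  shows "\<exists>h>0. \<exists>F. F holomorphic_on {w. \<bar>Im w\<bar> < h} \<and> (\<forall>w. \<bar>Im w\<bar> < h \<longrightarrow> F (w + 1) = F w)
    \<and> (\<forall>x. F (of_real x) = of_real (f x))"
proof -
  have per: "f (x + 1) = f x" for x
    using assms by (simp add: analytic_on_circle_def)
  have "\<exists>r>0. \<exists>F. F holomorphic_on ball (complex_of_real x) r
      \<and> (\<forall>y. \<bar>y - x\<bar> < r \<longrightarrow> F (of_real y) = of_real (f y))" for x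
    using assms powser_holomorphic[of x _ _ f] unfolding analytic_on_circle_def real_analytic_def
    by metis
  then obtain r0 F0 where r0: "\<And>x. r0 x > 0"
    and F0: "\<And>x. F0 x holomorphic_on ball (complex_of_real x) (r0 x)"
      "\<And>x y. \<bar>y - x\<bar> < r0 x \<Longrightarrow> F0 x (of_real y) = of_real (f y)"
    by metis
  \<comment> \<open>Radii and local extensions are chosen for centres in \<open>[0, 1)\<close> and
    transported by integers, which makes the glued function periodic.\<close>
  define r where "r x = r0 (frac x)" for x
  define F1 where "F1 x w = F0 (frac x) (w - of_int \<lfloor>x\<rfloor>)" for x w
  define B where "B x = ball (complex_of_real x) (r x)" for x
  have r: "r x > 0" for x by (simp add: r_def r0)
  have Bshift: "w - of_int \<lfloor>x\<rfloor> \<in> ball (complex_of_real (frac x)) (r0 (frac x)) \<longleftrightarrow> w \<in> B x" for w x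
    by (simp add: B_def r_def dist_norm frac_def algebra_simps)
  have F1: "F1 x holomorphic_on B x" for x
  proof -
    have "(F0 (frac x) \<circ> (\<lambda>w. w - of_int \<lfloor>x\<rfloor>)) holomorphic_on B x"
      by (rule holomorphic_on_compose_gen[OF _ F0(1)[of "frac x"]])
         (use Bshift in \<open>auto intro!: holomorphic_intros\<close>)
    then show ?thesis by (simp add: F1_def[abs_def] o_def)
  qed
  have F1real: "F1 x (of_real y) = of_real (f y)" if "of_real y \<in> B x" for x y
  proof -
    have "\<bar>(y - of_int \<lfloor>x\<rfloor>) - frac x\<bar> < r0 (frac x)"
      using that by (simp add: B_def r_def dist_norm frac_def abs_minus_commute flip: of_real_diff)
    then have "F0 (frac x) (of_real (y - of_int \<lfloor>x\<rfloor>)) = of_real (f (y - of_int \<lfloor>x\<rfloor>))"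
      by (rule F0(2))
    also have "f (y - of_int \<lfloor>x\<rfloor>) = f y"
      using periodic_int[of f "y - of_int \<lfloor>x\<rfloor>" "\<lfloor>x\<rfloor>"] per by simp
    finally show ?thesis by (simp add: F1_def)
  qed
  have agree: "F1 x w = F1 y w" if "w \<in> B x" "w \<in> B y" for x y w
  proof (rule holomorphic_eq_on_real[where S = "B x \<inter> B y" and x = "Re w" and F = "F1 x" and G = "F1 y"])
    have "cmod (of_real (Re w) - of_real u) \<le> cmod (w - of_real u)" for u
      using abs_Re_le_cmod[of "w - of_real u"] by (simp flip: of_real_diff)
    then show "of_real (Re w) \<in> B x \<inter> B y"
      using that by (auto simp: B_def dist_norm norm_minus_commute intro: le_less_trans)
    show "connected (B x \<inter> B y)"
      unfolding B_def by (intro convex_connected convex_Int) auto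
      show "F1 x holomorphic_on B x \<inter> B y" "F1 y holomorphic_on B x \<inter> B y"
      using F1 by (auto intro: holomorphic_on_subset)
    show "open (B x \<inter> B y)" by (simp add: B_def open_Int)
    show "w \<in> B x \<inter> B y" using that by simp
    show "F1 x (of_real u) = F1 y (of_real u)" if "of_real u \<in> B x \<inter> B y" for u
      using that F1real by simp
  qed
  define F where "F w = F1 (SOME x. w \<in> B x) w" for w
  have F: "F w = F1 x w" if "w \<in> B x" for x w
    unfolding F_def by (rule agree[OF someI[of "\<lambda>x. w \<in> B x"]]) (use that in auto)
  have inU: "of_real x \<in> B x" for x
    by (simp add: B_def r)
  have Fhol: "F holomorphic_on (\<Union>x. B x)"
  proof (rule holomorphic_on_UN_open)
    show "F holomorphic_on B x" for x
      using F1[of x] F by (simp cong: holomorphic_cong)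
  qed (simp add: B_def)
  have Bp: "w + 1 \<in> B (x + 1) \<longleftrightarrow> w \<in> B x" for w x
    by (simp add: B_def r_def dist_norm frac_def)
  have Fper: "F (w + 1) = F w" if "w \<in> B x" for w x
    using F[OF that] F[of "w + 1" "x + 1"] that Bp by (simp add: F1_def frac_def)
  have "\<exists>h>0. \<forall>w. Re w \<in> {0..1} \<and> \<bar>Im w\<bar> < h \<longrightarrow> w \<in> (\<Union>x. B x)"
  proof -
    let ?K = "{w. Re w \<in> {0..1} \<and> Im w \<in> {0}}"
    have "compact ?K" by (intro compact_strip) auto
    moreover have "?K \<subseteq> (\<Union>x. B x)"
    proof
      fix w assume "w \<in> ?K"
      then have "w = of_real (Re w)" by (auto simp: complex_eq_iff)
      then show "w \<in> (\<Union>x. B x)" using inU by (metis UN_iff iso_tuple_UNIV_I)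
    qed
    moreover have "open (\<Union>x. B x)" by (auto simp: B_def)
    ultimately obtain e where e: "e > 0" "(\<Union>w\<in>?K. cball w e) \<subseteq> (\<Union>x. B x)"
      using compact_subset_open_imp_cball_epsilon_subset[of ?K "\<Union>x. B x"] by metis
    have "w \<in> (\<Union>x. B x)" if "Re w \<in> {0..1}" "\<bar>Im w\<bar> < e" for w
    proof -
      have "w - of_real (Re w) = \<i> * of_real (Im w)"
        by (simp add: complex_eq_iff)
      then have "dist (complex_of_real (Re w)) w = \<bar>Im w\<bar>"
        by (simp add: dist_norm norm_minus_commute norm_mult)
      then have "w \<in> cball (of_real (Re w)) e"
        using that by simp
      then show ?thesis using e(2) that(1) by (auto dest!: subsetD)
    qed
    then show ?thesis using e(1) by blast
  qed
  then obtain h where h: "h > 0" "\<And>w. Re w \<in> {0..1} \<Longrightarrow> \<bar>Im w\<bar> < h \<Longrightarrow> w \<in> (\<Union>x. B x)"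
    by blast
  have U: "\<exists>x. w \<in> B x" if "\<bar>Im w\<bar> < h" for w
  proof -
    have "Re (w - of_int \<lfloor>Re w\<rfloor>) \<in> {0..1}" "\<bar>Im (w - of_int \<lfloor>Re w\<rfloor>)\<bar> < h"
      using that by (auto; linarith)+
    then have "w - of_int \<lfloor>Re w\<rfloor> \<in> (\<Union>x. B x)" by (rule h(2))
    then obtain x where x: "w - of_int \<lfloor>Re w\<rfloor> \<in> B x" by blast
    have "w \<in> B (x + of_int \<lfloor>Re w\<rfloor>)"
      using x by (simp add: B_def r_def dist_norm frac_def algebra_simps)
    then show ?thesis by blast
  qed
  have "F holomorphic_on {w. \<bar>Im w\<bar> < h}"
    using U by (intro holomorphic_on_subset[OF Fhol]) auto
  moreover have "F (of_real x) = of_real (f x)" for x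
    using F[OF inU] F1real[OF inU] by simp
  ultimately show ?thesis
    using h(1) U Fper by blast
qed

subsection \<open>Periodic holomorphic functions in a strip\<close>

lemma open_strip: "open {w. \<bar>Im w\<bar> < h}"
  by (intro open_Collect_less continuous_intros)

lemma convex_strip: "convex {w. \<bar>Im w\<bar> < h}"
proof -
  have "{w. \<bar>Im w\<bar> < h} = {w. Im w < h} \<inter> {w. Im w > - h}" by auto
  then show ?thesis by (simp add: convex_Int convex_halfspace_Im_lt convex_halfspace_Im_gt)
qed

lemma periodic_strip_int:
  assumes per: "\<And>w. \<bar>Im w\<bar> < h \<Longrightarrow> g (w + 1) = g (w :: complex)" and w: "\<bar>Im w\<bar> < h"
  shows "g (w + of_int k) = g w"
proof -
  have n: "g (w + of_nat n) = g w" if "\<bar>Im w\<bar> < h" for w n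
  proof (induction n)
    case (Suc n)
    then show ?case using per[of "w + of_nat n"] that by (simp add: algebra_simps)
  qed simp
  show ?thesis
  proof (cases k)
    case (nonneg n)
    then show ?thesis using w by (simp add: n)
  next
    case (neg n)
    then show ?thesis using n[of "w + of_int k" "Suc n"] w by simp
  qed
qed

text \<open>Only the modulus is assumed periodic: the exponential factor used next is not periodic,
  but its modulus depends on \<open>Im w\<close> alone.\<close>

lemma periodic_three_lines_aux:
  assumes hol: "g holomorphic_on {w. \<bar>Im w\<bar> < h'}" and h: "0 < h" "h < h'"
    and per: "\<And>w. \<bar>Im w\<bar> < h' \<Longrightarrow> cmod (g (w + 1)) = cmod (g w)"
    and bd: "\<And>x::real. cmod (g (of_real x)) \<le> S" "\<And>x::real. cmod (g (of_real x + \<i> * of_real h)) \<le> S"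
    and w: "0 \<le> Im w" "Im w \<le> h"
  shows "cmod (g w) \<le> S"
proof -
  \<comment> \<open>Three periods wide: a maximum point moved to \<open>0 <= Re < 1\<close> is
    interior unless it lies on a horizontal edge.\<close>
  define K where "K = {w. Re w \<in> {-1..2} \<and> Im w \<in> {0..h}}"
  have K: "compact K" unfolding K_def by (intro compact_strip) auto
  have Ksub: "K \<subseteq> {w. \<bar>Im w\<bar> < h'}" using h by (auto simp: K_def)
  have contK: "continuous_on K (\<lambda>w. cmod (g w))"
    using hol Ksub by (intro continuous_intros holomorphic_on_imp_continuous_on)
      (auto intro: holomorphic_on_subset)
  have "K \<noteq> {}" using h by (auto simp: K_def intro!: exI[of _ 0])
  then obtain \<xi> where \<xi>: "\<xi> \<in> K" "\<And>w. w \<in> K \<Longrightarrow> cmod (g w) \<le> cmod (g \<xi>)"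
    using continuous_attains_sup[OF K _ contK] by blast
  have red: "cmod (g (v + of_int k)) = cmod (g v)" if "\<bar>Im v\<bar> < h'" for v k
    using periodic_strip_int[of h' "\<lambda>w. complex_of_real (cmod (g w))" v k] per that by simp
  define \<zeta> where "\<zeta> = \<xi> - of_int \<lfloor>Re \<xi>\<rfloor>"
  have \<zeta>: "0 \<le> Re \<zeta>" "Re \<zeta> < 1" "Im \<zeta> = Im \<xi>"
    unfolding \<zeta>_def by (auto; linarith)+
  have g\<zeta>: "cmod (g \<zeta>) = cmod (g \<xi>)"
    using red[of \<zeta> "\<lfloor>Re \<xi>\<rfloor>"] \<zeta>(3) \<xi>(1) Ksub by (auto simp: \<zeta>_def)
  have bdry: "cmod (g v) \<le> S" if "Im v = 0 \<or> Im v = h" for v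
  proof -
    have "v = of_real (Re v) \<or> v = of_real (Re v) + \<i> * of_real h"
      using that by (auto simp: complex_eq_iff)
    then show ?thesis using bd by metis
  qed
  have max: "cmod (g \<xi>) \<le> S"
  proof (cases "Im \<zeta> = 0 \<or> Im \<zeta> = h")
    case True
    then show ?thesis using bdry g\<zeta> by metis
  next
    case False
    define U where "U = {w. -1 < Re w \<and> Re w < 2 \<and> 0 < Im w \<and> Im w < h}"
    have Ueq: "U = {w. Re w > -1} \<inter> {w. Re w < 2} \<inter> {w. Im w > 0} \<inter> {w. Im w < h}"
      by (auto simp: U_def)
    have U: "open U" "convex U"
      unfolding Ueq by (intro open_Int open_halfspace_Re_gt open_halfspace_Re_lt open_halfspace_Im_gt
        open_halfspace_Im_lt convex_Int convex_halfspace_Re_gt convex_halfspace_Re_lt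
        convex_halfspace_Im_gt convex_halfspace_Im_lt)+
    have UK: "U \<subseteq> K" by (auto simp: U_def K_def)
    have \<zeta>U: "\<zeta> \<in> U" using \<zeta> False \<xi>(1) by (auto simp: U_def K_def)
    \<comment> \<open>An interior maximum makes \<open>g\<close> constant inside; continuity along
      the vertical segment \<open>p\<close> carries the value down to the real axis, where the bound
      is given.\<close>
    have "g constant_on U"
      by (rule maximum_modulus_principle[of g U U \<zeta>])
        (use U UK \<zeta>U \<xi>(2) g\<zeta> Ksub in \<open>auto intro: holomorphic_on_subset[OF hol] convex_connected\<close>)
    then have const: "g v = g \<zeta>" if "v \<in> U" for v
      using that \<zeta>U by (auto simp: constant_on_def)
    define p where "p t = of_real (Re \<zeta>) + \<i> * of_real t" for t :: real
    have "((\<lambda>t. cmod (g (p t))) \<longlongrightarrow> cmod (g (p 0))) (at 0 within {0..h})"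
    proof -
      have "continuous_on {0..h} (\<lambda>t. cmod (g (p t)))"
        by (rule continuous_on_compose2[OF contK]) (use \<zeta> in \<open>auto simp: p_def K_def intro!: continuous_intros\<close>)
      then show ?thesis using h by (simp add: continuous_on_def)
    qed
    moreover have "\<forall>\<^sub>F t in at 0 within {0..h}. cmod (g (p t)) = cmod (g \<xi>)"
      unfolding eventually_at using h(1) \<zeta> g\<zeta>
      by (intro exI[of _ h]) (auto simp: p_def U_def dist_real_def intro!: arg_cong[where f = cmod] const simp flip: g\<zeta>)
    ultimately have "((\<lambda>t. cmod (g \<xi>)) \<longlongrightarrow> cmod (g (p 0))) (at (0::real) within {0..h})"
      using tendsto_cong by fast
    moreover have "at (0::real) within {0..h} \<noteq> bot"
      using h(1) by (simp add: trivial_limit_within islimpt_greaterThanLessThan1 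
         islimpt_subset[of 0 "{0<..<h}"] subset_iff)
    ultimately have "cmod (g \<xi>) = cmod (g (p 0))"
      using tendsto_const tendsto_unique by blast
    also have "\<dots> \<le> S" using bd(1)[of "Re \<zeta>"] by (simp add: p_def)
    finally show ?thesis .
  qed
  define v where "v = w - of_int \<lfloor>Re w\<rfloor>"
  have "v \<in> K" unfolding v_def K_def using w by (auto; linarith)
  then have "cmod (g v) \<le> S" using \<xi>(2) max by fastforce
  then show ?thesis using red[of v "\<lfloor>Re w\<rfloor>"] w h by (simp add: v_def)
qed

text \<open>Multiplication by \<open>exp (\<i> * \<alpha> * w)\<close>, of modulus
  \<open>exp (- \<alpha> * Im w)\<close>, equalises the bounds on the two lines.\<close>

lemma periodic_three_lines:
  assumes hol: "g holomorphic_on {w. \<bar>Im w\<bar> < h'}" and h: "0 < h" "h < h'"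
    and per: "\<And>w. \<bar>Im w\<bar> < h' \<Longrightarrow> g (w + 1) = g w"
    and bd: "\<And>x::real. cmod (g (of_real x)) \<le> S"
      "\<And>x::real. cmod (g (of_real x + \<i> * of_real h)) \<le> S * exp (\<alpha> * h)"
    and w: "0 \<le> Im w" "Im w \<le> h"
  shows "cmod (g w) \<le> S * exp (\<alpha> * Im w)"
proof -
  define k where "k w = g w * exp (\<i> * of_real \<alpha> * w)" for w
  have nk: "cmod (k w) = cmod (g w) * exp (- \<alpha> * Im w)" for w
    by (simp add: k_def norm_mult)
  have "cmod (k w) \<le> S"
  proof (rule periodic_three_lines_aux[OF _ h _ _ _ w])
    show "k holomorphic_on {w. \<bar>Im w\<bar> < h'}"
      unfolding k_def[abs_def] by (intro holomorphic_intros hol)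
    show "cmod (k (of_real x + \<i> * of_real h)) \<le> S" for x
      using bd(2)[of x] by (simp add: nk exp_minus field_simps)
  qed (use bd per in \<open>auto simp: nk\<close>)
  then show ?thesis by (simp add: nk exp_minus field_simps)
qed

lemma periodic_three_lines_both_sides:
  assumes hol: "g holomorphic_on {w. \<bar>Im w\<bar> < h'}" and h: "0 < h" "h < h'"
    and per: "\<And>w. \<bar>Im w\<bar> < h' \<Longrightarrow> g (w + 1) = g w"
    and bd: "\<And>x::real. cmod (g (of_real x)) \<le> S"
      "\<And>w. \<bar>Im w\<bar> = h \<Longrightarrow> cmod (g w) \<le> S * exp (\<alpha> * h)"
    and w: "\<bar>Im w\<bar> \<le> h"
  shows "cmod (g w) \<le> S * exp (\<alpha> * \<bar>Im w\<bar>)"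
proof (cases "0 \<le> Im w")
  case True
  then show ?thesis
    using periodic_three_lines[OF hol h per bd(1), where \<alpha> = \<alpha> and w = w] bd(2) w h by simp
next
  case False
  have "cmod ((\<lambda>w. g (- w)) (- w)) \<le> S * exp (\<alpha> * Im (- w))"
  proof (rule periodic_three_lines[OF _ h])
    have "(g \<circ> uminus) holomorphic_on {w. \<bar>Im w\<bar> < h'}"
      by (intro holomorphic_on_compose_gen[OF _ hol] holomorphic_intros) auto
    then show "(\<lambda>w. g (- w)) holomorphic_on {w. \<bar>Im w\<bar> < h'}"
      by (simp add: o_def)
    show "g (- (w + 1)) = g (- w)" if "\<bar>Im w\<bar> < h'" for w
      using per[of "- w - 1"] that by simp
    show "cmod (g (- complex_of_real x)) \<le> S" for x
      using bd(1)[of "- x"] by simp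
    show "cmod (g (- (complex_of_real x + \<i> * complex_of_real h))) \<le> S * exp (\<alpha> * h)" for x
      by (rule bd(2)) (use h in simp)
  qed (use False w in auto)
  then show ?thesis using False by simp
qed

text \<open>Discs of radius \<open>r\<close> about real points stay in the strip, so Cauchy's
  inequality bounds the derivative on the real line by \<open>D / r\<close>; periodicity removes the
  integer \<open>l\<close>.\<close>

lemma sup_le_on_net:
  fixes x y :: real
  assumes hol: "g holomorphic_on {w. \<bar>Im w\<bar> < h'}" and r: "0 < r" "r < h'"
    and per: "\<And>w. \<bar>Im w\<bar> < h' \<Longrightarrow> g (w + 1) = g w"
    and bd: "\<And>w. \<bar>Im w\<bar> \<le> r \<Longrightarrow> cmod (g w) \<le> D"
    and close: "\<bar>x - (y + of_int l)\<bar> \<le> e"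
  shows "cmod (g (of_real y)) \<le> cmod (g (of_real x)) + D / r * e"
proof -
  have "cmod (deriv g w) \<le> D / r" if "w \<in> \<real>" for w
  proof -
    have sub: "cball w r \<subseteq> {w. \<bar>Im w\<bar> \<le> r}"
    proof
      fix v assume "v \<in> cball w r"
      then have "cmod (v - w) \<le> r" by (simp add: dist_norm norm_minus_commute)
      then show "v \<in> {w. \<bar>Im w\<bar> \<le> r}"
        using abs_Im_le_cmod[of "v - w"] that by (auto simp: complex_is_Real_iff)
    qed
    have hol': "g holomorphic_on cball w r"
      using sub r by (intro holomorphic_on_subset[OF hol]) auto
    have "cmod ((deriv ^^ 1) g w) \<le> fact 1 * D / r ^ 1"
    proof (rule Cauchy_inequality)
      show "g holomorphic_on ball w r" "continuous_on (cball w r) g"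
        using hol' by (auto intro: holomorphic_on_subset holomorphic_on_imp_continuous_on)
      show "cmod (g x) \<le> D" if "cmod (w - x) = r" for x
        by (rule bd) (use sub that in \<open>auto simp: dist_norm subset_iff\<close>)
    qed (use r in auto)
    then show ?thesis by simp
  qed
  moreover have "(g has_field_derivative deriv g w) (at w within \<real>)" if "w \<in> \<real>" for w
    using holomorphic_derivI[OF hol open_strip, of w] that r
    by (auto simp: complex_is_Real_iff)
  ultimately have "cmod (g (of_real (y + of_int l)) - g (of_real x)) \<le> D / r * cmod (of_real (y + of_int l) - of_real x)"
    by (intro field_differentiable_bound[where S = "\<real>" and f' = "deriv g"]) (auto simp: convex_Reals)
  also have "\<dots> \<le> D / r * e"
  proof (rule mult_left_mono)
    have "0 \<le> D" using bd[of 0] r norm_ge_zero order_trans by (metis abs_zero less_eq_real_def zero_complex.simps(2))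
    then show "0 \<le> D / r" using r by simp
    show "cmod (of_real (y + of_int l) - of_real x) \<le> e"
      using close unfolding of_real_diff[symmetric] norm_of_real by (simp add: abs_minus_commute)
  qed
  finally have "cmod (g (of_real (y + of_int l)) - g (of_real x)) \<le> D / r * e" .
  moreover have "g (of_real (y + of_int l)) = g (of_real y)"
    using periodic_strip_int[of h' g "of_real y" l] per r by simp
  ultimately show ?thesis
    using norm_triangle_ineq2[of "g (of_real y)" "g (of_real x)"] by simp
qed

text \<open>The case \<open>h = 0\<close> gives the maximum over the circle itself.\<close>

lemma periodic_strip_attains_sup:
  fixes G :: "complex \<Rightarrow> real"
  assumes cont: "continuous_on {w. \<bar>Im w\<bar> < h'} G" and h: "0 \<le> h" "h < h'"
    and per: "\<And>w. \<bar>Im w\<bar> < h' \<Longrightarrow> G (w + 1) = G w"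
  shows "\<exists>w0. \<bar>Im w0\<bar> \<le> h \<and> (\<forall>w. \<bar>Im w\<bar> \<le> h \<longrightarrow> G w \<le> G w0)"
proof -
  define K where "K = {w. Re w \<in> {0..1} \<and> Im w \<in> {-h..h}}"
  have "compact K" unfolding K_def by (intro compact_strip) auto
  moreover have "continuous_on K G"
    using cont by (rule continuous_on_subset) (use h in \<open>auto simp: K_def\<close>)
  moreover have "K \<noteq> {}" using h by (auto simp: K_def intro!: exI[of _ 0])
  ultimately obtain w0 where w0: "w0 \<in> K" "\<And>w. w \<in> K \<Longrightarrow> G w \<le> G w0"
    using continuous_attains_sup by metis
  have "G w \<le> G w0" if "\<bar>Im w\<bar> \<le> h" for w
  proof -
    have "w - of_int \<lfloor>Re w\<rfloor> \<in> K"
      unfolding K_def using that by (auto; linarith)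
    then have "G (w - of_int \<lfloor>Re w\<rfloor>) \<le> G w0" by (rule w0(2))
    moreover have "G (w - of_int \<lfloor>Re w\<rfloor>) = G w"
      using periodic_strip_int[of h' G "w - of_int \<lfloor>Re w\<rfloor>" "\<lfloor>Re w\<rfloor>"] per that h by simp
    ultimately show ?thesis by simp
  qed
  moreover have "\<bar>Im w0\<bar> \<le> h" using w0(1) by (auto simp: K_def)
  ultimately show ?thesis by blast
qed

text \<open>The trick of Sorets and Spencer: moving the phase off the real axis keeps the potential away
  from the energy.\<close>

lemma horizontal_line_avoiding_value:
  assumes hol: "F holomorphic_on {w. \<bar>Im w\<bar> < h'}" and h: "0 < h" "h < h'"
    and per: "\<And>w. \<bar>Im w\<bar> < h' \<Longrightarrow> F (w + 1) = F w"
    and nonconst: "\<not> F constant_on range complex_of_real"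
  shows "\<exists>y d. 0 \<le> y \<and> y \<le> h \<and> 0 < d \<and> (\<forall>x::real. d \<le> cmod (F (Complex x y) - E))"
proof -
  define K where "K = {w. Re w \<in> {0..1} \<and> Im w \<in> {0..h}}"
  have K: "compact K" unfolding K_def by (intro compact_strip) auto
  \<comment> \<open>In one compact period a nonconstant \<open>F\<close> takes the value
    \<open>E\<close> finitely often, so only finitely many heights are excluded.\<close>
  have "finite {w \<in> K. F w - E = 0}"
  proof (rule holomorphic_compact_finite_zeros[OF _ open_strip convex_connected[OF convex_strip] K])
    show "(\<lambda>w. F w - E) holomorphic_on {w. \<bar>Im w\<bar> < h'}"
      by (intro holomorphic_intros hol)
    show "\<not> (\<lambda>w. F w - E) constant_on {w. \<bar>Im w\<bar> < h'}"
    proof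
      assume "(\<lambda>w. F w - E) constant_on {w. \<bar>Im w\<bar> < h'}"
      then obtain c where c: "\<And>w. \<bar>Im w\<bar> < h' \<Longrightarrow> F w - E = c"
        by (auto simp: constant_on_def)
      have "F (of_real x) = c + E" for x
        using c[of "of_real x"] h by (simp add: diff_eq_eq)
      then have "F constant_on range complex_of_real"
        by (auto simp: constant_on_def)
      then show False using nonconst by simp
    qed
  qed (use h in \<open>auto simp: K_def\<close>)
  then have "finite (Im ` {w \<in> K. F w - E = 0})" by simp
  moreover have "infinite {0..h}" using h by simp
  ultimately have "\<not> {0..h} \<subseteq> Im ` {w \<in> K. F w - E = 0}"
    using finite_subset by blast
  then obtain y where y: "y \<in> {0..h}" "y \<notin> Im ` {w \<in> K. F w - E = 0}"
    by blast
  define G where "G x = cmod (F (Complex x y) - E)" for x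
  have "continuous_on {0..1} G"
  proof -
    have "continuous_on {0..1} (\<lambda>x. F (Complex x y))"
      by (rule continuous_on_compose2[OF holomorphic_on_imp_continuous_on[OF hol]])
        (use y h in \<open>auto simp: Complex_eq intro!: continuous_intros\<close>)
    then show ?thesis unfolding G_def by (intro continuous_intros)
  qed
  then obtain x1 where x1: "x1 \<in> {0..1}" "\<And>x. x \<in> {0..1} \<Longrightarrow> G x1 \<le> G x"
    using continuous_attains_inf[of "{0..1::real}" G] by auto
  have "Complex x1 y \<in> K" using x1(1) y(1) by (simp add: K_def)
  then have "F (Complex x1 y) - E \<noteq> 0" using y(2) by (force simp: image_iff)
  then have "0 < G x1" by (simp add: G_def)
  moreover have "G x1 \<le> G x" for x
  proof -
    have "F (Complex (frac x) y + of_int \<lfloor>x\<rfloor>) = F (Complex (frac x) y)"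
      by (rule periodic_strip_int[of h' F]) (use per y h in auto)
    moreover have "Complex (frac x) y + of_int \<lfloor>x\<rfloor> = Complex x y"
      by (simp add: complex_eq_iff frac_def)
    ultimately have "G x = G (frac x)" by (simp add: G_def)
    moreover have "frac x \<in> {0..1}" using frac_lt_1[of x] by (simp add: less_imp_le)
    ultimately show ?thesis using x1(2) by simp
  qed
  ultimately show ?thesis
    using y(1) unfolding G_def by (intro exI[of _ y] exI[of _ "cmod (F (Complex x1 y) - E)"]) auto
qed

text \<open>Compactness of the ball of energies: a line that avoids \<open>E'\<close> by
  \<open>D E'\<close> avoids every \<open>E\<close> within \<open>D E' / 2\<close> by half as much.
  Only the distance becomes uniform; the height may still depend on \<open>E\<close>.\<close>

lemma horizontal_line_uniform:
  assumes hol: "F holomorphic_on {w. \<bar>Im w\<bar> < h'}" and h: "0 < h" "h < h'"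
    and per: "\<And>w. \<bar>Im w\<bar> < h' \<Longrightarrow> F (w + 1) = F w"
    and nonconst: "\<not> F constant_on range complex_of_real"
  shows "\<exists>d>0. \<forall>E. cmod E \<le> C \<longrightarrow>
    (\<exists>y. 0 \<le> y \<and> y \<le> h \<and> (\<forall>x::real. d \<le> cmod (F (Complex x y) - E)))"
proof -
  obtain Y D where YD: "\<And>E. 0 \<le> Y E" "\<And>E. Y E \<le> h" "\<And>E. 0 < D E"
    "\<And>E x. D E \<le> cmod (F (Complex x (Y E)) - E)"
    using horizontal_line_avoiding_value[OF assms] by metis
  have "cball 0 C \<subseteq> (\<Union>E\<in>cball 0 C. ball E (D E / 2))"
    using YD(3) by (auto intro!: bexI)
  then obtain T where T: "T \<subseteq> cball (0::complex) C" "finite T" "cball 0 C \<subseteq> (\<Union>E\<in>T. ball E (D E / 2))"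
    using compactE_image[of "cball 0 C" "cball 0 C" "\<lambda>E. ball E (D E / 2)"] by auto
  define d where "d = Min (insert 1 ((\<lambda>E. D E / 2) ` T))"
  have d: "0 < d" using T(2) YD(3) by (auto simp: d_def)
  have d2: "d \<le> D E / 2" if "E \<in> T" for E
    unfolding d_def by (rule Min_le) (use T(2) that in auto)
  have "\<exists>y. 0 \<le> y \<and> y \<le> h \<and> (\<forall>x::real. d \<le> cmod (F (Complex x y) - E))" if "cmod E \<le> C" for E
  proof -
    have "E \<in> cball 0 C" using that by simp
    then have "E \<in> (\<Union>E\<in>T. ball E (D E / 2))" using T(3) by blast
    then obtain E' where E': "E' \<in> T" "dist E' E < D E' / 2" by auto
    have "d \<le> cmod (F (Complex x (Y E')) - E)" for x
    proof -
      have "D E' \<le> cmod (F (Complex x (Y E')) - E')" by (rule YD(4))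
      also have "\<dots> \<le> cmod (F (Complex x (Y E')) - E) + cmod (E - E')"
        using norm_triangle_ineq[of "F (Complex x (Y E')) - E" "E - E'"] by simp
      finally show ?thesis
        using E' d2[OF E'(1)] by (simp add: dist_norm norm_minus_commute)
    qed
    then show ?thesis using YD(1,2) by blast
  qed
  then show ?thesis using d by blast
qed

subsection \<open>Growth of solutions\<close>

text \<open>\<open>sol v (Suc n)\<close> is the determinant of the tridiagonal \<open>n\<close> by
  \<open>n\<close> matrix with diagonal \<open>v\<close> and off-diagonal entries -1; for
  \<open>v k = z - V k\<close> it is the characteristic determinant of \<open>n\<close>
  sites.\<close>

fun sol :: "(nat \<Rightarrow> complex) \<Rightarrow> nat \<Rightarrow> complex" where
  "sol v 0 = 0"
| "sol v (Suc 0) = 1"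
| "sol v (Suc (Suc n)) = v n * sol v (Suc n) - sol v n"

lemma sol_upper:
  assumes "\<And>k. cmod (v k) \<le> \<Lambda> - 1" "1 \<le> \<Lambda>"
  shows "cmod (sol v n) \<le> \<Lambda> ^ n \<and> cmod (sol v (Suc n)) \<le> \<Lambda> ^ n"
proof (induction n)
  case (Suc n)
  have "cmod (sol v (Suc (Suc n))) \<le> cmod (v n) * cmod (sol v (Suc n)) + cmod (sol v n)"
    using norm_triangle_ineq4[of "v n * sol v (Suc n)" "sol v n"] by (simp add: norm_mult)
  also have "\<dots> \<le> (\<Lambda> - 1) * \<Lambda> ^ n + \<Lambda> ^ n"
    using Suc assms by (intro add_mono mult_mono) auto
  also have "\<dots> = \<Lambda> ^ Suc n" by (simp add: algebra_simps)
  finally show ?case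
    using Suc power_increasing[of n "Suc n" \<Lambda>] assms(2) by (auto intro: order_trans)
qed simp

text \<open>That the modulus does not decrease is carried along in the induction: it lets the
  subtracted term cost at most one of the \<open>a + 1\<close>.\<close>

lemma sol_lower:
  assumes "\<And>k. a + 1 \<le> cmod (v k)" "1 \<le> a"
  shows "a ^ n \<le> cmod (sol v (Suc n)) \<and> cmod (sol v n) \<le> cmod (sol v (Suc n))"
proof (induction n)
  case (Suc n)
  have "(a + 1) * cmod (sol v (Suc n)) \<le> cmod (v n) * cmod (sol v (Suc n))"
    by (intro mult_right_mono assms) simp
  then have "a * cmod (sol v (Suc n)) \<le> cmod (v n * sol v (Suc n)) - cmod (sol v n)"
    using Suc by (simp add: norm_mult algebra_simps)
  also have "\<dots> \<le> cmod (sol v (Suc (Suc n)))"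
    using norm_triangle_ineq2[of "v n * sol v (Suc n)" "sol v n"] by simp
  finally have *: "a * cmod (sol v (Suc n)) \<le> cmod (sol v (Suc (Suc n)))" .
  have "a ^ Suc n \<le> a * cmod (sol v (Suc n))"
    using Suc assms(2) by (simp add: mult_left_mono)
  moreover have "1 * cmod (sol v (Suc n)) \<le> a * cmod (sol v (Suc n))"
    using assms(2) by (intro mult_right_mono) auto
  ultimately show ?case using * by simp
qed simp

lemma sol_holomorphic:
  assumes "\<And>k. (\<lambda>w. v w k) holomorphic_on S"
  shows "(\<lambda>w. sol (v w) n) holomorphic_on S"
  using assms by (induction "\<lambda>_::nat. 0::complex" n rule: sol.induct) (auto intro!: holomorphic_intros)

text \<open>The order of quantifiers is the point: \<open>lam_f\<close> comes before everything
  else, and \<open>C\<close> depends on \<open>lam\<close> but not on frequency, phase, energy or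
  length. Energies scale with \<open>lam\<close>, so that after division by \<open>lam\<close> the
  values to be avoided lie in a fixed ball.\<close>

lemma orbit_growth:
  fixes f :: "real \<Rightarrow> real"
  assumes h': "0 < h'" and hol: "F holomorphic_on {w. \<bar>Im w\<bar> < h'}"
    and per: "\<And>w. \<bar>Im w\<bar> < h' \<Longrightarrow> F (w + 1) = F w"
    and ext: "\<And>x. F (of_real x) = of_real (f x)"
    and nonconst: "\<not> f constant_on UNIV" and "0 \<le> Cz"
  shows "\<exists>lam_f\<ge>1. \<forall>lam>lam_f. \<exists>C>0. \<forall>\<omega> q n z \<theta>.
    1 \<le> n \<and> dense_orbit \<omega> q \<and> C * real n \<le> real q \<and> cmod z \<le> lam * Cz \<longrightarrow>
    (\<exists>m. 1 \<le> m \<and> m \<le> q \<and> exp (real n) / 2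
      \<le> cmod (sol (\<lambda>k. z - of_real (lam * f (\<theta> + real (m + k) * \<omega>))) (Suc n)))"
proof -
  define h where "h = h' / 2"
  have h: "0 < h" "h < h'" using h' by (auto simp: h_def)
  have "\<not> F constant_on range complex_of_real"
    using nonconst by (auto simp: constant_on_def ext) (metis Re_complex_of_real)
  \<comment> \<open>At height at most \<open>h / 2\<close> the three lines bound is at most the
    geometric mean of the bounds at heights 0 and \<open>h\<close>.\<close>
  then obtain d where d: "0 < d" "\<And>E. cmod E \<le> Cz \<Longrightarrow>
      \<exists>y. 0 \<le> y \<and> y \<le> h / 2 \<and> (\<forall>x::real. d \<le> cmod (F (Complex x y) - E))"
    using horizontal_line_uniform[OF hol _ _ per, of "h / 2" Cz] h by auto
  obtain w0 where w0: "\<And>w. \<bar>Im w\<bar> \<le> h \<Longrightarrow> cmod (F w) \<le> cmod (F w0)"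
    using periodic_strip_attains_sup[of h' "\<lambda>w. cmod (F w)" h] h per
      holomorphic_on_imp_continuous_on[OF hol] by (auto intro: continuous_on_norm)
  define C1 where "C1 = Cz + cmod (F w0) + 1"
  have C1: "1 \<le> C1" using assms(6) by (simp add: C1_def)
  \<comment> \<open>The bound \<open>4 / d\<close> gives \<open>a >= 2\<close>, hence
    \<open>lam * d >= a + 1\<close>. The other one makes the square of \<open>a\<close>, quadratic
    in \<open>lam\<close>, at least \<open>exp 1 * \<Lambda>\<close>, which is linear in
    \<open>lam\<close>.\<close>
  define lam_f where "lam_f = max 1 (max (4 / d) (4 * C1 * exp 1 / d\<^sup>2))"
  show ?thesis
  proof (rule exI[of _ lam_f], intro conjI allI impI)
    show "1 \<le> lam_f" by (simp add: lam_f_def)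
    fix lam assume "lam_f < lam"
    then have lam: "1 \<le> lam" "4 / d \<le> lam" "4 * C1 * exp 1 / d\<^sup>2 \<le> lam"
      by (auto simp: lam_f_def)
    define \<Lambda> where "\<Lambda> = C1 * lam"
    have \<Lambda>: "1 \<le> \<Lambda>" using C1 lam mult_mono[of 1 C1 1 lam] by (simp add: \<Lambda>_def)
    define a where "a = lam * d / 2"
    have a: "2 \<le> a" using lam(2) d(1) by (simp add: a_def field_simps)
    have ratio: "exp 1 * \<Lambda> \<le> a\<^sup>2"
    proof -
      have "4 * C1 * exp 1 \<le> lam * d\<^sup>2" using lam(3) d(1) by (simp add: field_simps)
      then have "4 * C1 * exp 1 * lam \<le> lam * d\<^sup>2 * lam" using lam(1) by (intro mult_right_mono) auto
      then show ?thesis by (simp add: a_def \<Lambda>_def power2_eq_square field_simps)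
    qed
    show "\<exists>C>0. \<forall>\<omega> q n z \<theta>.
      1 \<le> n \<and> dense_orbit \<omega> q \<and> C * real n \<le> real q \<and> cmod z \<le> lam * Cz \<longrightarrow>
      (\<exists>m. 1 \<le> m \<and> m \<le> q \<and> exp (real n) / 2
        \<le> cmod (sol (\<lambda>k. z - of_real (lam * f (\<theta> + real (m + k) * \<omega>))) (Suc n)))"
    \<comment> \<open>The mesh \<open>2 / q\<close> times the derivative bound
      \<open>S * \<Lambda> * n / h\<close> is then at most \<open>S / 2\<close>, so half of the
      maximum survives at some orbit point.\<close>
    proof (rule exI[of _ "4 * \<Lambda> / h"], intro conjI allI impI)
      show "0 < 4 * \<Lambda> / h" using \<Lambda> h by simp
      fix \<omega> q n z \<theta>
      assume "1 \<le> n \<and> dense_orbit \<omega> q \<and> 4 * \<Lambda> / h * real n \<le> real q \<and> cmod z \<le> lam * Cz"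
      then have n: "1 \<le> n" and q: "dense_orbit \<omega> q" "4 * \<Lambda> / h * real n \<le> real q"
        and z: "cmod z \<le> lam * Cz" by auto
      define v where "v w k = z - of_real lam * F (w + of_real (real k * \<omega>))" for w and k :: nat
      define g where "g w = sol (v w) (Suc n)" for w
      have v_real: "v (of_real x) k = z - of_real (lam * f (x + real k * \<omega>))" for x k
        unfolding v_def using ext[of "x + real k * \<omega>"] by simp
      have ghol: "g holomorphic_on {w. \<bar>Im w\<bar> < h'}"
      proof -
        have "(\<lambda>w. F (w + of_real (real k * \<omega>))) holomorphic_on {w. \<bar>Im w\<bar> < h'}" for k
          by (rule holomorphic_on_compose_gen[OF _ hol, of "\<lambda>w. w + of_real (real k * \<omega>)", unfolded o_def])
            (auto intro!: holomorphic_intros)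
        then show ?thesis
          unfolding g_def v_def by (intro sol_holomorphic holomorphic_intros)
      qed
      have gper: "g (w + 1) = g w" if "\<bar>Im w\<bar> < h'" for w
      proof -
        have "F (w + 1 + of_real (real k * \<omega>)) = F (w + of_real (real k * \<omega>))" for k
          using per[of "w + of_real (real k * \<omega>)"] that by (simp add: add_ac)
        then show ?thesis unfolding g_def v_def by simp
      qed
      have gub: "cmod (g w) \<le> \<Lambda> ^ n" if "\<bar>Im w\<bar> \<le> h" for w
      proof -
        have "cmod (v w k) \<le> \<Lambda> - 1" for k
        proof -
          have "cmod (v w k) \<le> cmod z + lam * cmod (F (w + of_real (real k * \<omega>)))"
            unfolding v_def using norm_triangle_ineq4[of z "of_real lam * F (w + of_real (real k * \<omega>))"] lam(1)
            by (simp add: norm_mult)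
          also have "\<dots> \<le> lam * Cz + lam * cmod (F w0)"
            using w0[of "w + of_real (real k * \<omega>)"] that z lam(1) by (intro add_mono mult_left_mono) auto
          also have "\<dots> \<le> \<Lambda> - 1"
            using lam(1) by (simp add: \<Lambda>_def C1_def algebra_simps)
          finally show ?thesis .
        qed
        then show ?thesis unfolding g_def using sol_upper[of "v w" \<Lambda> n] \<Lambda> by blast
      qed
      obtain w1 where w1: "\<bar>Im w1\<bar> \<le> 0" "\<And>w. \<bar>Im w\<bar> \<le> 0 \<Longrightarrow> cmod (g w) \<le> cmod (g w1)"
        using periodic_strip_attains_sup[of h' "\<lambda>w. cmod (g w)" 0] h' gper
          holomorphic_on_imp_continuous_on[OF ghol] by (auto intro: continuous_on_norm)
      define x1 where "x1 = Re w1"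
      have w1x: "w1 = of_real x1" using w1(1) by (simp add: x1_def complex_eq_iff)
      \<comment> \<open>The \<open>max 1\<close> keeps the logarithm below meaningful until
        \<open>Sbig\<close> shows that the maximum itself exceeds 1.\<close>
      define S where "S = max 1 (cmod (g w1))"
      have S: "1 \<le> S" "\<And>x::real. cmod (g (of_real x)) \<le> S"
        using w1(2)[of "of_real _"] unfolding S_def by (auto simp: le_max_iff_disj)
      have S\<Lambda>: "S \<le> \<Lambda> ^ n"
        using gub[of w1] w1(1) h \<Lambda> by (auto simp: S_def)
      define \<alpha> where "\<alpha> = ln (\<Lambda> ^ n / S) / h"
      have \<alpha>: "0 \<le> \<alpha>" "S * exp (\<alpha> * h) = \<Lambda> ^ n"
        using S S\<Lambda> \<Lambda> h by (auto simp: \<alpha>_def intro!: divide_nonneg_pos ln_ge_zero)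
      have lines: "cmod (g w) \<le> S * exp (\<alpha> * \<bar>Im w\<bar>)" if "\<bar>Im w\<bar> \<le> h" for w
        by (rule periodic_three_lines_both_sides[OF ghol h gper S(2) _ that]) (use gub \<alpha>(2) in auto)
      have Sbig: "exp (real n) \<le> S"
      proof -
        have "cmod (z / of_real lam) \<le> Cz"
          using z lam(1) by (simp add: norm_divide field_simps)
        then obtain y where y: "0 \<le> y" "y \<le> h / 2" "\<And>x::real. d \<le> cmod (F (Complex x y) - z / of_real lam)"
          using d(2) by blast
        have "a + 1 \<le> cmod (v (Complex 0 y) k)" for k
        proof -
          have "v (Complex 0 y) k = - of_real lam * (F (Complex (real k * \<omega>) y) - z / of_real lam)"
            using lam(1) by (simp add: v_def Complex_eq algebra_simps)
          then have "cmod (v (Complex 0 y) k) = lam * cmod (F (Complex (real k * \<omega>) y) - z / of_real lam)"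
            using lam(1) by (simp add: norm_mult)
          moreover have "lam * d \<le> lam * cmod (F (Complex (real k * \<omega>) y) - z / of_real lam)"
            using y(3) lam(1) by (intro mult_left_mono) auto
          ultimately show ?thesis using a by (simp add: a_def)
        qed
        then have "a ^ n \<le> cmod (g (Complex 0 y))"
          unfolding g_def using sol_lower[of a "v (Complex 0 y)" n] a by auto
        also have "\<dots> \<le> S * exp (\<alpha> * y)"
          using lines[of "Complex 0 y"] y h by simp
        also have "\<dots> \<le> S * exp (\<alpha> * (h / 2))"
          using y \<alpha>(1) S(1) by (intro mult_left_mono) (auto intro!: mult_left_mono simp del: times_divide_eq_right)
        \<comment> \<open>Squaring turns half height into full height:
          \<open>a ^ (2 * n) <= S * \<Lambda> ^ n\<close>. With \<open>ratio\<close> this leaves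
          \<open>exp n <= S\<close>.\<close>
        finally have "(a ^ n)\<^sup>2 \<le> (S * exp (\<alpha> * (h / 2)))\<^sup>2"
          using a by (intro power_mono) auto
        also have "\<dots> = S * (S * exp (\<alpha> * h))"
          using exp_add[of "\<alpha> * (h / 2)" "\<alpha> * (h / 2)"] by (simp add: power2_eq_square mult_ac)
        finally have "(a\<^sup>2) ^ n \<le> S * \<Lambda> ^ n"
          unfolding \<alpha>(2) by (simp add: power_mult[symmetric] mult.commute)
        moreover have "(exp 1 * \<Lambda>) ^ n \<le> (a\<^sup>2) ^ n"
          using ratio \<Lambda> by (intro power_mono) auto
        ultimately have "exp (real n) * \<Lambda> ^ n \<le> S * \<Lambda> ^ n"
          using exp_of_nat_mult[of n "1::real"] by (simp add: power_mult_distrib)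
        then show ?thesis using \<Lambda> by simp
      qed
      moreover have "1 < exp (real n)" using n by simp
      ultimately have Seq: "S = cmod (g (of_real x1))"
        by (simp add: S_def w1x max_def split: if_splits)
      \<comment> \<open>Up to height \<open>h / n\<close> the interpolated growth is at most
        \<open>\<Lambda>\<close>, because \<open>\<alpha> * h <= n * ln \<Lambda>\<close>. At a
        fixed height the bound would lose a factor exponential in \<open>n\<close>.\<close>
      define r where "r = h / real n"
      have r: "0 < r" "r \<le> h" using h n by (auto simp: r_def divide_le_eq mult_ge1_I)
      have D: "cmod (g w) \<le> S * \<Lambda>" if "\<bar>Im w\<bar> \<le> r" for w
      proof -
        have "\<alpha> * \<bar>Im w\<bar> \<le> \<alpha> * r" using that \<alpha>(1) by (intro mult_left_mono)
        also have "\<dots> = ln (\<Lambda> ^ n / S) / real n" using h n by (simp add: \<alpha>_def r_def)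
        also have "\<dots> \<le> ln (\<Lambda> ^ n) / real n"
          using S \<Lambda> by (intro divide_right_mono) (auto simp: ln_div)
        also have "\<dots> = ln \<Lambda>" using n \<Lambda> by (simp add: ln_realpow)
        finally have "exp (\<alpha> * \<bar>Im w\<bar>) \<le> \<Lambda>"
          using \<Lambda> exp_le_cancel_iff[of "\<alpha> * \<bar>Im w\<bar>" "ln \<Lambda>"] by simp
        then have "S * exp (\<alpha> * \<bar>Im w\<bar>) \<le> S * \<Lambda>" using S by (intro mult_left_mono) auto
        then show ?thesis using lines[of w] that r by linarith
      qed
      obtain m l :: int where ml: "1 \<le> m" "m \<le> int q"
          "\<bar>\<theta> + of_int m * \<omega> - (x1 + of_int l)\<bar> \<le> 2 / real q"
        using q(1) unfolding dense_orbit_def by blast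
      have q0: "0 < real q" using ml by simp
      have "S \<le> cmod (g (of_real (\<theta> + of_int m * \<omega>))) + S * \<Lambda> / r * (2 / real q)"
        unfolding Seq by (rule sup_le_on_net[OF ghol r(1) _ gper _ ml(3)]) (use D r h Seq in auto)
      moreover have "S * \<Lambda> / r * (2 / real q) \<le> S * (1 / 2)"
      proof -
        have "4 * \<Lambda> * real n \<le> real q * h"
          using q(2) h by (simp add: field_simps)
        then have "2 * \<Lambda> / h * real n / real q \<le> 1 / 2"
          using h q0 by (simp add: field_simps)
        then have "S * (2 * \<Lambda> / h * real n / real q) \<le> S * (1 / 2)"
          using S by (intro mult_left_mono) auto
        then show ?thesis by (simp add: r_def)
      qed
      ultimately have "S / 2 \<le> cmod (g (of_real (\<theta> + of_int m * \<omega>)))" by linarith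
      then have "exp (real n) / 2 \<le> cmod (g (of_real (\<theta> + of_int m * \<omega>)))"
        using Sbig by simp
      moreover have "g (of_real (\<theta> + of_int m * \<omega>))
        = sol (\<lambda>k. z - of_real (lam * f (\<theta> + real (nat m + k) * \<omega>))) (Suc n)"
      proof -
        have "v (of_real (\<theta> + of_int m * \<omega>)) = (\<lambda>k. z - of_real (lam * f (\<theta> + real (nat m + k) * \<omega>)))"
          unfolding v_real using ml(1) by (simp add: algebra_simps)
        then show ?thesis by (simp add: g_def)
      qed
      ultimately show "\<exists>m. 1 \<le> m \<and> m \<le> q \<and> exp (real n) / 2
        \<le> cmod (sol (\<lambda>k. z - of_real (lam * f (\<theta> + real (m + k) * \<omega>))) (Suc n))"
        using ml by (intro exI[of _ "nat m"]) auto
    qed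
  qed
qed

subsection \<open>The resolvent on finite intervals\<close>

text \<open>This is \<open>(z - H) u\<close>: solutions are its zeros, and resolvent columns have a
  point source.\<close>

definition jac :: "complex \<Rightarrow> (int \<Rightarrow> real) \<Rightarrow> (int \<Rightarrow> complex) \<Rightarrow> int \<Rightarrow> complex" where
  "jac z V u n = (z - of_real (V n)) * u n - u (n - 1) - u (n + 1)"

lemma sum_telescope_int:
  fixes c :: "int \<Rightarrow> 'a::ab_group_add"
  assumes "a \<le> b + 1"
  shows "(\<Sum>n\<in>{a..b}. c n - c (n + 1)) = c a - c (b + 1)"
proof -
  have "a - 1 \<le> b" using assms by simp
  then show ?thesis
  proof (induction b rule: int_ge_induct)
    case (step i)
    have "{a..i + 1} = insert (i + 1) {a..i}" using step.hyps by auto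
    then show ?case using step by (simp add: add.assoc)
  qed simp
qed

text \<open>In the imaginary part of the pairing with \<open>u\<close> the hopping terms form a
  current \<open>c\<close> that telescopes, and the Dirichlet conditions remove its boundary
  values.\<close>

lemma jac_energy:
  assumes "a \<le> b + 1" "u (a - 1) = 0" "u (b + 1) = 0"
  shows "Im z * (\<Sum>n\<in>{a..b}. (cmod (u n))\<^sup>2) = Im (\<Sum>n\<in>{a..b}. jac z V u n * cnj (u n))"
proof -
  define c where "c n = Im (u (n - 1) * cnj (u n))" for n
  have "Im (jac z V u n * cnj (u n)) = Im z * (cmod (u n))\<^sup>2 - (c n - c (n + 1))" for n
    unfolding jac_def c_def cmod_power2 by (simp add: algebra_simps power2_eq_square)
  then have "Im (\<Sum>n\<in>{a..b}. jac z V u n * cnj (u n))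
    = Im z * (\<Sum>n\<in>{a..b}. (cmod (u n))\<^sup>2) - (\<Sum>n\<in>{a..b}. c n - c (n + 1))"
    by (simp add: sum_subtractf sum_distrib_left)
  moreover have "c a = 0" "c (b + 1) = 0" using assms by (simp_all add: c_def)
  ultimately show ?thesis using sum_telescope_int[OF assms(1), of c] by simp
qed

text \<open>The resolvent bound \<open>1 / Im z\<close>, read off a single column: the energy
  identity bounds the total mass by \<open>|s| * |u j| / Im z\<close>, which controls first
  \<open>u j\<close> itself and then every \<open>u n\<close>.\<close>

lemma jac_single_source:
  assumes \<eta>: "0 < Im z" and bc: "u (a - 1) = 0" "u (b + 1) = 0"
    and src: "\<And>n. a \<le> n \<Longrightarrow> n \<le> b \<Longrightarrow> jac z V u n = (if n = j then s else 0)"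
    and j: "a \<le> j" "j \<le> b" and n: "a \<le> n" "n \<le> b"
  shows "cmod (u n) \<le> cmod s / Im z"
proof -
  have "(\<Sum>n\<in>{a..b}. jac z V u n * cnj (u n)) = (\<Sum>n\<in>{a..b}. if n = j then s * cnj (u j) else 0)"
    by (rule sum.cong) (auto simp: src)
  also have "\<dots> = s * cnj (u j)" using j by simp
  finally have "Im z * (\<Sum>n\<in>{a..b}. (cmod (u n))\<^sup>2) = Im (s * cnj (u j))"
    using jac_energy[of a b u z V] bc j by simp
  also have "\<dots> \<le> cmod s * cmod (u j)"
    using abs_Im_le_cmod[of "s * cnj (u j)"] by (simp add: norm_mult)
  finally have E: "(\<Sum>n\<in>{a..b}. (cmod (u n))\<^sup>2) \<le> cmod s * cmod (u j) / Im z"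
    using \<eta> by (simp add: field_simps)
  have le: "(cmod (u k))\<^sup>2 \<le> (\<Sum>n\<in>{a..b}. (cmod (u n))\<^sup>2)" if "a \<le> k" "k \<le> b" for k
    using member_le_sum[of k "{a..b}" "\<lambda>n. (cmod (u n))\<^sup>2"] that by simp
  have uj: "cmod (u j) \<le> cmod s / Im z"
  proof (cases "u j = 0")
    case False
    have "cmod (u j) * cmod (u j) \<le> cmod s / Im z * cmod (u j)"
      using le[OF j] E by (simp add: power2_eq_square)
    then show ?thesis by (rule mult_right_le_imp_le) (use False in simp)
  qed (use \<eta> in simp)
  have "(cmod (u n))\<^sup>2 \<le> cmod s / Im z * cmod (u j)"
    using le[OF n] E by simp
  also have "\<dots> \<le> (cmod s / Im z)\<^sup>2"
    unfolding power2_eq_square using uj \<eta> by (intro mult_left_mono) auto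
  finally show ?thesis by (rule power2_le_imp_le) (use \<eta> in simp)
qed

section \<open>Wronskian, Dirichlet solutions and the Green function of an interval\<close>

lemma jac_wronskian:
  assumes "\<And>n. a \<le> n \<Longrightarrow> n \<le> b \<Longrightarrow> jac z V u n = 0" "\<And>n. a \<le> n \<Longrightarrow> n \<le> b \<Longrightarrow> jac z V w n = 0"
    and "a - 1 \<le> n" "n \<le> b"
  shows "u (n + 1) * w n - u n * w (n + 1) = u a * w (a - 1) - u (a - 1) * w a"
  using assms(3,4)
proof (induction n rule: int_ge_induct)
  case (step i)
  have *: "u (i + 1 + 1) = (z - of_real (V (i + 1))) * u (i + 1) - u i"
    "w (i + 1 + 1) = (z - of_real (V (i + 1))) * w (i + 1) - w i"
    using assms(1)[of "i + 1"] assms(2)[of "i + 1"] step.hyps step.prems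
    by (simp_all add: jac_def algebra_simps)
  have "u (i + 1 + 1) * w (i + 1) - u (i + 1) * w (i + 1 + 1) = u (i + 1) * w i - u i * w (i + 1)"
    unfolding * by (simp add: algebra_simps)
  then show ?case using step by simp
qed simp

text \<open>The Dirichlet solution started at site \<open>a\<close>; truncation by
  \<open>nat\<close> makes it vanish at all sites before \<open>a\<close>.\<close>

definition solp :: "complex \<Rightarrow> (int \<Rightarrow> real) \<Rightarrow> int \<Rightarrow> int \<Rightarrow> complex" where
  "solp z V a n = sol (\<lambda>k. z - of_real (V (a + int k))) (nat (n - a + 1))"

lemma solp_init [simp]: "solp z V a (a - 1) = 0" "solp z V a a = 1"
  by (simp_all add: solp_def)

lemma jac_solp:
  assumes "a \<le> n"
  shows "jac z V (solp z V a) n = 0"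
proof -
  obtain k where "n = a + int k" using assms zle_iff_zadd by blast
  moreover have "nat (int k + 2) = Suc (Suc k)" "nat (int k + 1) = Suc k" by auto
  ultimately show ?thesis
    by (simp add: jac_def solp_def add_ac)
qed

lemma jac_reflect: "jac z (\<lambda>n. V (- n)) u (- n) = jac z V (\<lambda>n. u (- n)) n"
  by (simp add: jac_def)

text \<open>Resolvent kernel of \<open>[- L, L]\<close> with source 0: the solution vanishing at the
  left end times the one vanishing at the right end, over their Wronskian. Reflecting the potential
  turns the right solution into a left one, and its value at the reflected site \<open>L + 1\<close>
  is the Wronskian.\<close>

definition green :: "complex \<Rightarrow> (int \<Rightarrow> real) \<Rightarrow> int \<Rightarrow> int \<Rightarrow> complex" where
  "green z V L n = solp z V (- L) (min n 0) * solp z (\<lambda>n. V (- n)) (- L) (- max n 0)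
     / solp z (\<lambda>n. V (- n)) (- L) (L + 1)"

lemma solp_holomorphic: "(\<lambda>z. solp z V a n) holomorphic_on S"
  unfolding solp_def by (intro sol_holomorphic holomorphic_intros)

text \<open>A zero at \<open>L + 1\<close> would make the solution a Dirichlet eigenfunction at a
  nonreal energy; the bound with source \<open>s = 0\<close> contradicts its value 1 at
  \<open>- L\<close>.\<close>

lemma solp_nz:
  assumes "0 < Im z" "0 \<le> L"
  shows "solp z V (- L) (L + 1) \<noteq> 0"
proof
  assume "solp z V (- L) (L + 1) = 0"
  then have "cmod (solp z V (- L) (- L)) \<le> cmod 0 / Im z"
    using assms solp_init(1)[of z V "- L"]
    by (intro jac_single_source[where a = "- L" and b = L and V = V and j = 0]) (auto simp: jac_solp)
  then show False by simp
qed

lemma green_holomorphic: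
  assumes "0 \<le> L"
  shows "(\<lambda>z. green z V L n) holomorphic_on {z. 0 < Im z}"
  unfolding green_def by (intro holomorphic_intros solp_holomorphic) (use solp_nz assms in auto)

lemma green_bc:
  assumes "0 \<le> L"
  shows "green z V L (- L - 1) = 0" "green z V L (L + 1) = 0"
  using assms solp_init(1)[of z V "- L"] solp_init(1)[of z "\<lambda>n. V (- n)" "- L"]
  by (simp_all add: green_def)

text \<open>Away from 0 the kernel follows one of the two solutions; at 0 the mismatch is their
  Wronskian divided by itself.\<close>

lemma jac_green:
  assumes \<eta>: "0 < Im z" and L: "0 \<le> L" and n: "- L \<le> n" "n \<le> L"
  shows "jac z V (green z V L) n = (if n = 0 then 1 else 0)"
proof -
  define u w where "u = solp z V (- L)" and "w n = solp z (\<lambda>n. V (- n)) (- L) (- n)" for n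
  have u: "jac z V u n = 0" if "- L \<le> n" for n
    unfolding u_def using jac_solp that by blast
  have w: "jac z V w n = 0" if "n \<le> L" for n
    unfolding w_def jac_reflect[symmetric] using jac_solp that by simp
  have ubc: "u (- L - 1) = 0" "u (- L) = 1" by (simp_all add: u_def)
  define W where "W = w (- L - 1)"
  have W: "W \<noteq> 0" using solp_nz[OF \<eta> L, of "\<lambda>n. V (- n)"] by (simp add: W_def w_def add.commute)
  have wr: "u 1 * w 0 - u 0 * w 1 = W"
    using jac_wronskian[of "- L" L z V u w 0] u w L ubc by (simp add: W_def)
  have g: "green z V L n = u (min n 0) * w (max n 0) / W" for n
    by (simp add: green_def u_def w_def W_def add.commute)
  consider "n < 0" | "n = 0" | "0 < n" by linarith
  then show ?thesis
  proof cases
    case 1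
    have "jac z V (green z V L) n = jac z V u n * w 0 / W"
      using 1 W by (simp add: jac_def g min_def max_def field_simps)
    then show ?thesis using u[of n] n 1 by simp
  next
    case 3
    have "min (n - 1) 0 = 0" "max (n - 1) 0 = n - 1" "min n 0 = 0" "max n 0 = n"
      "min (n + 1) 0 = 0" "max (n + 1) 0 = n + 1"
      using 3 by auto
    then have "jac z V (green z V L) n = jac z V w n * u 0 / W"
      using W by (simp add: jac_def g field_simps)
    then show ?thesis using w[of n] n 3 by simp
  next
    case 2
    have u1: "(z - of_real (V 0)) * u 0 - u (- 1) = u 1"
      using u[of 0] L by (simp add: jac_def)
    have "jac z V (green z V L) n = (((z - of_real (V 0)) * u 0 - u (- 1)) * w 0 - u 0 * w 1) / W"
      using 2 W by (simp add: jac_def g min_def max_def field_simps)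
    then show ?thesis unfolding u1 wr using W 2 by simp
  qed
qed

lemma green_le:
  assumes "0 < Im z" "0 \<le> L" "- L \<le> n" "n \<le> L"
  shows "cmod (green z V L n) \<le> 1 / Im z"
  using jac_single_source[of z "green z V L" "- L" L V 0 1 n] jac_green green_bc assms by simp

text \<open>The resolvent of the half line \<open>[m, \<infinity>)\<close> is at most \<open>1 / Im z\<close>, and its kernel at \<open>j \<le> k\<close> is
  \<open>\<phi> j * \<psi> k / \<psi> (m - 1)\<close>, so growth of \<open>\<phi>\<close> forces decay of \<open>\<psi>\<close>.\<close>

lemma decay_of_growth:
  assumes \<eta>: "0 < Im z" and bc: "\<psi> (L + 1) = 0"
    and \<psi>: "\<And>n. m \<le> n \<Longrightarrow> n \<le> L \<Longrightarrow> jac z V \<psi> n = 0"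
    and mjk: "m \<le> j" "j \<le> k" "k \<le> L"
  shows "cmod (solp z V m j) * cmod (\<psi> k) \<le> cmod (\<psi> (m - 1)) / Im z"
proof -
  define \<phi> where "\<phi> = solp z V m"
  have \<phi>: "jac z V \<phi> n = 0" if "m \<le> n" for n
    unfolding \<phi>_def using that by (rule jac_solp)
  have wr: "\<phi> (j + 1) * \<psi> j - \<phi> j * \<psi> (j + 1) = \<psi> (m - 1)"
    using jac_wronskian[of m L z V \<phi> \<psi> j] \<phi> \<psi> mjk by (simp add: \<phi>_def)
  define w where "w i = (if i \<le> j then \<phi> i * \<psi> j else \<phi> j * \<psi> i)" for i
  have "jac z V w n = (if n = j then \<psi> (m - 1) else 0)" if n: "m \<le> n" "n \<le> L" for n
  proof -
    consider "n < j" | "n = j" | "j < n" by linarith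
    then show ?thesis
    proof cases
      case 1
      then have "jac z V w n = jac z V \<phi> n * \<psi> j" by (simp add: jac_def w_def algebra_simps)
      then show ?thesis using \<phi> n 1 by simp
    next
      case 3
      have "w (n - 1) = \<phi> j * \<psi> (n - 1)"
        using 3 by (cases "n - 1 = j") (auto simp: w_def)
      then have "jac z V w n = jac z V \<psi> n * \<phi> j" using 3 by (simp add: jac_def w_def algebra_simps)
      then show ?thesis using \<psi> n 3 by simp
    next
      case 2
      have *: "\<phi> (j + 1) = (z - of_real (V j)) * \<phi> j - \<phi> (j - 1)"
        using \<phi>[OF mjk(1)] by (simp add: jac_def)
      have "jac z V w n = \<phi> (j + 1) * \<psi> j - \<phi> j * \<psi> (j + 1)"
        unfolding * using 2 by (simp add: jac_def w_def algebra_simps)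
      then show ?thesis using wr 2 by simp
    qed
  qed
  then have "cmod (w k) \<le> cmod (\<psi> (m - 1)) / Im z"
    using \<eta> bc mjk by (intro jac_single_source[of z w m L V j]) (auto simp: w_def \<phi>_def)
  moreover have "w k = \<phi> j * \<psi> k" using mjk by (auto simp: w_def)
  ultimately show ?thesis by (simp add: norm_mult \<phi>_def)
qed

text \<open>Each block contains a site from which a Dirichlet solution grows to \<open>M\<close>,
  and \<open>decay_of_growth\<close> turns this into a factor \<open>1 / (Im z * M)\<close>. The
  induction starts from the resolvent bound.\<close>

lemma green_decay:
  assumes \<eta>: "0 < Im z" and L: "0 \<le> L" and M: "0 < M"
    and grow: "\<And>s. 0 \<le> s \<Longrightarrow> \<exists>m j. s < m \<and> m \<le> j \<and> j \<le> s + int N \<and> M \<le> cmod (solp z V m j)"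
    and k: "int i * int N \<le> k" "k \<le> L"
  shows "cmod (green z V L k) \<le> 1 / Im z * (1 / (Im z * M)) ^ i"
  using k
proof (induction i arbitrary: k)
  case 0
  then show ?case using green_le[OF \<eta> L] L by simp
next
  case (Suc i)
  obtain m j where mj: "int i * int N < m" "m \<le> j" "j \<le> int i * int N + int N" "M \<le> cmod (solp z V m j)"
    using grow[of "int i * int N"] by auto
  have jk: "j \<le> k" using mj(3) Suc.prems(1) by (simp add: algebra_simps)
  have m: "0 < m" using mj(1) by (meson le_less_trans mult_nonneg_nonneg of_nat_0_le_iff)
  have "M * cmod (green z V L k) \<le> cmod (solp z V m j) * cmod (green z V L k)"
    using mj(4) by (intro mult_right_mono) auto
  also have "\<dots> \<le> cmod (green z V L (m - 1)) / Im z"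
    using m mj jk Suc.prems \<eta> L jac_green[OF \<eta> L] green_bc(2)[OF L] by (intro decay_of_growth) auto
  \<comment> \<open>Since \<open>m\<close> is strictly larger than \<open>i * N\<close>, the site
    \<open>m - 1\<close> still lies beyond \<open>i\<close> blocks and the induction hypothesis
    applies to it.\<close>
  also have "\<dots> \<le> (1 / Im z * (1 / (Im z * M)) ^ i) / Im z"
    using Suc.IH[of "m - 1"] mj jk Suc.prems \<eta> by (intro divide_right_mono) auto
  finally show ?case using M \<eta> by (simp add: field_simps)
qed

subsection \<open>Amplitudes as contour integrals of the resolvent\<close>

definition hop :: "(int \<Rightarrow> real) \<Rightarrow> (int \<Rightarrow> complex) \<Rightarrow> int \<Rightarrow> complex" where
  "hop V u n = u (n - 1) + u (n + 1) + of_real (V n) * u n"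

text \<open>\<open>hpow V k n\<close> is the matrix element of the \<open>k\<close>-th power of the
  operator between sites 0 and \<open>n\<close>; \<open>amp\<close> and \<open>nres\<close> are the
  entries of its exponential series and its Neumann series. Working with entries postpones the
  Hilbert space.\<close>

primrec hpow :: "(int \<Rightarrow> real) \<Rightarrow> nat \<Rightarrow> int \<Rightarrow> complex" where
  "hpow V 0 = (\<lambda>n. if n = 0 then 1 else 0)"
| "hpow V (Suc k) = hop V (hpow V k)"

definition amp :: "(int \<Rightarrow> real) \<Rightarrow> real \<Rightarrow> int \<Rightarrow> complex" where
  "amp V t n = (\<Sum>k. (- \<i> * of_real t) ^ k / fact k * hpow V k n)"

definition nres :: "(int \<Rightarrow> real) \<Rightarrow> complex \<Rightarrow> int \<Rightarrow> complex" where
  "nres V z n = (\<Sum>k. hpow V k n / z ^ Suc k)"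

lemma hop_le:
  assumes "\<And>n. cmod (u n) \<le> c" "\<bar>V n\<bar> \<le> B"
  shows "cmod (hop V u n) \<le> (B + 2) * c"
proof -
  have "0 \<le> c" using assms(1) norm_ge_zero order_trans by blast
  have "cmod (hop V u n) \<le> cmod (u (n - 1)) + cmod (u (n + 1)) + \<bar>V n\<bar> * cmod (u n)"
    unfolding hop_def by (intro norm_triangle_le add_mono) (auto simp: norm_mult)
  also have "\<dots> \<le> c + c + B * c"
    using assms \<open>0 \<le> c\<close> by (intro add_mono mult_mono) auto
  finally show ?thesis by (simp add: algebra_simps)
qed

lemma hpow_support: "int k < \<bar>n\<bar> \<Longrightarrow> hpow V k n = 0"
proof (induction k arbitrary: n)
  case (Suc k)
  then show ?case by (simp add: hop_def)
qed simp

lemma higher_deriv_exp_mult: "(deriv ^^ k) (\<lambda>z. exp (c * z)) = (\<lambda>z. c ^ k * exp (c * z :: complex))"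
proof (induction k)
  case (Suc k)
  have "deriv (\<lambda>z. c ^ k * exp (c * z)) z = c ^ Suc k * exp (c * z)" for z
    by (rule DERIV_imp_deriv) (auto intro!: derivative_eq_intros)
  then show ?case using Suc by auto
qed simp

text \<open>On the arc \<open>exp (t * Im z)\<close> can be far too large. As the integrand is
  holomorphic in the upper half plane, Cauchy's theorem replaces the arc by its chord, which lies on
  \<open>Im z = \<eta>\<close> and has length at most \<open>2 * R\<close>.\<close>

lemma upper_arc_le:
  assumes \<alpha>: "0 < \<alpha>" "\<alpha> < pi / 2" and R: "0 < R" and \<eta>: "\<eta> = R * sin \<alpha>" and t: "0 \<le> t"
    and g: "g holomorphic_on {z. 0 < Im z}"
    and bd: "\<And>E. \<bar>E\<bar> \<le> R \<Longrightarrow> cmod (g (Complex E \<eta>)) \<le> G"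
  shows "(\<lambda>z. exp (- \<i> * of_real t * z) * g z) contour_integrable_on part_circlepath 0 R \<alpha> (pi - \<alpha>)"
    and "cmod (contour_integral (part_circlepath 0 R \<alpha> (pi - \<alpha>)) (\<lambda>z. exp (- \<i> * of_real t * z) * g z))
      \<le> exp (\<eta> * t) * G * (2 * R)"
proof -
  define F where "F z = exp (- \<i> * of_real t * z) * g z" for z
  define U where "U = {z::complex. 0 < Im z}"
  have U: "open U" "convex U" unfolding U_def by (auto simp: open_halfspace_Im_gt convex_halfspace_Im_gt)
  have F: "F holomorphic_on U" unfolding F_def U_def by (intro holomorphic_intros g)
  have \<eta>0: "0 < \<eta>" using \<alpha> R by (simp add: \<eta> sin_gt_zero)
  have G0: "0 \<le> G" by (rule order_trans[OF norm_ge_zero bd[of 0]]) (use R in simp)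
  define A where "A = part_circlepath 0 R \<alpha> (pi - \<alpha>)"
  define a b where "a = pathstart A" and "b = pathfinish A"
  have ab: "Im a = \<eta>" "Im b = \<eta>" "cmod a = R" "cmod b = R"
    using R by (simp_all add: a_def b_def A_def \<eta> norm_mult Im_exp)
  have "path_image A \<subseteq> U"
  proof
    fix z assume "z \<in> path_image A"
    then obtain x where x: "\<alpha> \<le> x" "x \<le> pi - \<alpha>" "z = R * exp (\<i> * of_real x)"
      using \<alpha> unfolding A_def by (auto simp: path_image_part_circlepath)
    then have "0 < sin x" using \<alpha> by (intro sin_gt_zero) auto
    then show "z \<in> U" using R by (simp add: U_def x(3) Im_exp)
  qed
  have segsub: "closed_segment b a \<subseteq> {z. Im z = \<eta>} \<inter> cball 0 R"
  proof (rule closed_segment_subset)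
    have "{z. Im z = \<eta>} = {z. Im z \<le> \<eta>} \<inter> {z. Im z \<ge> \<eta>}" by auto
    then show "convex ({z. Im z = \<eta>} \<inter> cball 0 R)"
      by (auto intro!: convex_Int convex_halfspace_Im_le convex_halfspace_Im_ge)
  qed (use ab in auto)
  then have segU: "path_image (linepath b a) \<subseteq> U" using \<eta>0 by (auto simp: U_def)
  have vA: "valid_path A" by (simp add: A_def)
  have int: "F contour_integrable_on A" "F contour_integrable_on linepath b a"
    using contour_integrable_holomorphic_simple[OF F U(1)] vA \<open>path_image A \<subseteq> U\<close> segU by auto
  have "(F has_contour_integral 0) (A +++ linepath b a)"
    using F U(2) vA \<open>path_image A \<subseteq> U\<close> segU
    by (intro Cauchy_theorem_convex_simple[where S = U])
      (auto simp: path_image_join a_def b_def valid_path_join)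
  then have "contour_integral A F = - contour_integral (linepath b a) F"
    using contour_integral_join[OF int vA valid_path_linepath] contour_integral_unique
    by (metis eq_neg_iff_add_eq_0)
  moreover have "cmod (contour_integral (linepath b a) F) \<le> exp (\<eta> * t) * G * cmod (a - b)"
  proof (rule contour_integral_bound_linepath[OF int(2)])
    show "0 \<le> exp (\<eta> * t) * G" using G0 by simp
    fix z assume "z \<in> closed_segment b a"
    then have z: "Im z = \<eta>" "cmod z \<le> R" using segsub by auto
    then have "z = Complex (Re z) \<eta>" "\<bar>Re z\<bar> \<le> R"
      using abs_Re_le_cmod[of z] by (auto simp: complex_eq_iff)
    then have "cmod (g z) \<le> G" using bd by metis
    then show "norm (F z) \<le> exp (\<eta> * t) * G"
      using z by (simp add: F_def norm_mult mult.commute)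
  qed
  moreover have "cmod (a - b) \<le> 2 * R"
    using norm_triangle_ineq4[of a b] ab by simp
  moreover have "exp (\<eta> * t) * G * cmod (a - b) \<le> exp (\<eta> * t) * G * (2 * R)"
    using calculation(3) G0 by (intro mult_left_mono) auto
  ultimately have "cmod (contour_integral A F) \<le> exp (\<eta> * t) * G * (2 * R)"
    by (metis norm_minus_cancel order_trans)
  then show "cmod (contour_integral (part_circlepath 0 R \<alpha> (pi - \<alpha>)) (\<lambda>z. exp (- \<i> * of_real t * z) * g z))
      \<le> exp (\<eta> * t) * G * (2 * R)"
    by (simp add: A_def F_def[abs_def])
  show "(\<lambda>z. exp (- \<i> * of_real t * z) * g z) contour_integrable_on part_circlepath 0 R \<alpha> (pi - \<alpha>)"
    using int(1) by (simp add: A_def F_def[abs_def])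
qed

context
  fixes V :: "int \<Rightarrow> real" and B :: real
  assumes V: "\<And>n. \<bar>V n\<bar> \<le> B"
begin

lemma B_nonneg: "0 \<le> B" using V[of 0] by simp

lemma hpow_le: "cmod (hpow V k n) \<le> (B + 2) ^ k"
proof (induction k arbitrary: n)
  case (Suc k)
  then show ?case using hop_le[OF Suc V] by simp
qed simp

lemma amp_summable_norm:
  "summable (\<lambda>k. cmod ((- \<i> * of_real t) ^ k / fact k * hpow V k n))"
proof (rule summable_comparison_test'[where N = 0])
  show "summable (\<lambda>k. inverse (fact k) * ((B + 2) * \<bar>t\<bar>) ^ k)"
    by (rule summable_exp)
  fix k :: nat
  have "cmod ((- \<i> * of_real t) ^ k / fact k * hpow V k n) = \<bar>t\<bar> ^ k / fact k * cmod (hpow V k n)"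
    by (simp add: norm_mult norm_divide norm_power)
  also have "\<dots> \<le> \<bar>t\<bar> ^ k / fact k * (B + 2) ^ k"
    by (intro mult_left_mono hpow_le) auto
  also have "\<dots> = inverse (fact k) * ((B + 2) * \<bar>t\<bar>) ^ k"
    by (simp add: power_mult_distrib divide_inverse)
  finally show "norm (cmod ((- \<i> * of_real t) ^ k / fact k * hpow V k n)) \<le> inverse (fact k) * ((B + 2) * \<bar>t\<bar>) ^ k"
    unfolding real_norm_def abs_norm_cancel .
qed

lemma nres_term_le:
  assumes "cmod z = 2 * (B + 2)"
  shows "cmod (hpow V k n / z ^ Suc k) \<le> (1 / 2) ^ k / (2 * (B + 2))"
proof -
  have "cmod (hpow V k n / z ^ Suc k) = cmod (hpow V k n) / (2 * (B + 2)) ^ Suc k"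
    by (simp add: norm_divide norm_mult norm_power assms)
  also have "\<dots> \<le> (B + 2) ^ k / (2 * (B + 2)) ^ Suc k"
    using B_nonneg by (intro divide_right_mono hpow_le) auto
  also have "\<dots> = (1 / 2) ^ k / (2 * (B + 2))"
  proof -
    have *: "x ^ k / (2 * x) ^ Suc k = (1 / 2) ^ k / (2 * x)" if "0 < x" for x :: real
      using that by (simp add: power_mult_distrib power_one_over field_simps)
    show ?thesis by (rule *) (use B_nonneg in simp)
  qed
  finally show ?thesis .
qed

lemma nres_summable:
  assumes "cmod z = 2 * (B + 2)"
  shows "summable (\<lambda>k. hpow V k n / z ^ Suc k)"
proof (rule summable_comparison_test'[where N = 0])
  show "summable (\<lambda>k. (1 / 2) ^ k / (2 * (B + 2)))"
    by (intro summable_divide summable_geometric) simp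
qed (rule nres_term_le[OF assms])

text \<open>Powers below \<open>|n|\<close> do not reach site \<open>n\<close>, so the series starts
  at \<open>|n|\<close>, and on a circle of twice the operator bound the bounds of its terms halve
  at each step.\<close>

lemma nres_le:
  assumes z: "cmod z = 2 * (B + 2)"
  shows "cmod (nres V z n) \<le> (1 / 2) ^ nat \<bar>n\<bar> / (B + 2)"
proof -
  define m where "m = nat \<bar>n\<bar>"
  let ?f = "\<lambda>k. hpow V (k + m) n / z ^ Suc (k + m)"
  let ?g = "\<lambda>k. (1 / 2) ^ m * ((1 / 2) ^ k / (2 * (B + 2)))"
  have "nres V z n = suminf ?f"
    unfolding nres_def using suminf_split_initial_segment[OF nres_summable[OF z], of n m]
    by (simp add: hpow_support m_def)
  moreover have "norm (?f k) \<le> ?g k" for k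
    using nres_term_le[OF z, of "k + m" n] by (simp add: power_add mult.commute)
  moreover have g: "?g sums ((1 / 2) ^ m * (2 / (2 * (B + 2))))"
    by (intro sums_mult sums_divide) (use geometric_sums[of "1/2::real"] in simp)
  ultimately have "cmod (nres V z n) \<le> suminf ?g"
    using norm_suminf_le[of ?f ?g, OF _ sums_summable[OF g]] by simp
  also have "suminf ?g = (1 / 2) ^ m * (2 / (2 * (B + 2)))"
    using g by (rule sums_unique[symmetric])
  also have "2 / (2 * (B + 2)) = 1 / (B + 2)"
    using B_nonneg by (simp add: field_simps)
  finally show ?thesis by (simp add: m_def)
qed

lemma jac_nres:
  assumes z: "cmod z = 2 * (B + 2)"
  shows "jac z V (nres V z) n = (if n = 0 then 1 else 0)"
proof -
  have z0: "z \<noteq> 0" using z B_nonneg by auto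
  have s: "summable (\<lambda>k. hpow V k m / z ^ Suc k)" for m by (rule nres_summable[OF z])
  have "(\<lambda>k. z * (hpow V k n / z ^ Suc k)) sums (z * nres V z n)"
    unfolding nres_def by (intro sums_mult summable_sums s)
  then have "(\<lambda>k. hpow V k n / z ^ k) sums (z * nres V z n)"
    using z0 by simp
  then have "(\<lambda>k. hpow V (Suc k) n / z ^ Suc k) sums (z * nres V z n - hpow V 0 n)"
    by (subst sums_Suc_iff) simp
  moreover have "(\<lambda>k. hpow V k (n - 1) / z ^ Suc k + hpow V k (n + 1) / z ^ Suc k
      + of_real (V n) * (hpow V k n / z ^ Suc k)) sums hop V (nres V z) n"
    unfolding hop_def nres_def by (intro sums_add sums_mult summable_sums s)
  then have "(\<lambda>k. hpow V (Suc k) n / z ^ Suc k) sums hop V (nres V z) n"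
    by (simp add: hop_def add_divide_distrib)
  ultimately have "z * nres V z n - hpow V 0 n = hop V (nres V z) n"
    by (rule sums_unique2)
  then show ?thesis by (auto simp: jac_def hop_def algebra_simps split: if_splits)
qed

text \<open>A maximum principle: inside the interval the difference solves
  \<open>z * D = H D\<close>, impossible at a nonzero maximum as \<open>|z|\<close> is twice
  \<open>B + 2\<close>. So it is controlled by the two boundary sites, where the Green function
  vanishes and the Neumann series is small.\<close>

lemma nres_minus_green_le:
  assumes z: "cmod z = 2 * (B + 2)" and im: "0 < Im z" and L: "0 \<le> L" and n: "\<bar>n\<bar> \<le> L"
  shows "cmod (nres V z n - green z V L n) \<le> (1 / 2) ^ nat (L + 1) / (B + 2)"
proof -
  define D where "D m = nres V z m - green z V L m" for m
  define I where "I = {- L - 1..L + 1}"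
  have I: "finite I" "I \<noteq> {}" using L by (auto simp: I_def)
  have "Max ((\<lambda>m. cmod (D m)) ` I) \<in> (\<lambda>m. cmod (D m)) ` I"
    using I by (intro Max_in) auto
  then obtain k where k: "k \<in> I" "Max ((\<lambda>m. cmod (D m)) ` I) = cmod (D k)" by auto
  have kmax: "cmod (D m) \<le> cmod (D k)" if "m \<in> I" for m
    unfolding k(2)[symmetric] using I that by (intro Max_ge) auto
  have "cmod (D k) \<le> (1 / 2) ^ nat (L + 1) / (B + 2)"
  proof (cases "\<bar>k\<bar> \<le> L")
    case True
    have "jac z V D k = jac z V (nres V z) k - jac z V (green z V L) k"
      by (simp add: jac_def D_def algebra_simps)
    then have "jac z V D k = 0"
      using jac_nres[OF z] jac_green[OF im L, of k V] True by simp
    then have "z * D k = hop V D k"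
      by (simp add: jac_def hop_def algebra_simps)
    moreover have "cmod (hop V D k) \<le> (B + 2) * cmod (D k)"
    proof -
      have "cmod (hop V D k) \<le> cmod (D (k - 1)) + cmod (D (k + 1)) + \<bar>V k\<bar> * cmod (D k)"
        unfolding hop_def by (intro norm_triangle_le add_mono) (auto simp: norm_mult)
      also have "\<dots> \<le> cmod (D k) + cmod (D k) + B * cmod (D k)"
        using True V by (intro add_mono mult_right_mono kmax) (auto simp: I_def)
      finally show ?thesis by (simp add: algebra_simps)
    qed
    ultimately have "2 * (B + 2) * cmod (D k) \<le> (B + 2) * cmod (D k)"
      using z by (metis norm_mult)
    then have "(B + 2) * cmod (D k) \<le> 0"
      unfolding mult.assoc by linarith
    then have "cmod (D k) = 0" using B_nonneg by (simp add: mult_le_0_iff)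
    then show ?thesis using B_nonneg by simp
  next
    case False
    then have "k = L + 1 \<or> k = - L - 1" using k(1) by (auto simp: I_def)
    then have "D k = nres V z k" "nat \<bar>k\<bar> = nat (L + 1)"
      using green_bc[OF L] L by (auto simp: D_def)
    then show ?thesis using nres_le[OF z, of k] by simp
  qed
  moreover have "n \<in> I" using n by (auto simp: I_def)
  ultimately show ?thesis using kmax[of n] by (simp add: D_def)
qed

text \<open>The \<open>k\<close>-th derivative of \<open>exp (c * z)\<close> at 0 is
  \<open>c ^ k\<close>, so Cauchy's formula turns the Neumann series term by term into the
  exponential series.\<close>

lemma amp_contour:
  defines "R \<equiv> 2 * (B + 2)"
  shows "(\<lambda>z. exp (- \<i> * of_real t * z) * nres V z n) contour_integrable_on circlepath 0 R"
    and "contour_integral (circlepath 0 R) (\<lambda>z. exp (- \<i> * of_real t * z) * nres V z n)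
      = 2 * pi * \<i> * amp V t n"
proof -
  have R: "0 < R" using B_nonneg by (simp add: R_def)
  define c where "c = - \<i> * complex_of_real t"
  define T where "T k z = exp (c * z) * (hpow V k n / z ^ Suc k)" for k z
  have T: "(T k has_contour_integral 2 * pi * \<i> * (c ^ k / fact k * hpow V k n)) (circlepath 0 R)" for k
  proof -
    have "((\<lambda>z. exp (c * z) / (z - 0) ^ Suc k) has_contour_integral
        (2 * pi * \<i>) / fact k * (deriv ^^ k) (\<lambda>z. exp (c * z)) 0) (circlepath 0 R)"
      by (rule Cauchy_has_contour_integral_higher_derivative_circlepath)
        (use R in \<open>auto intro!: continuous_intros holomorphic_intros\<close>)
    then have "((\<lambda>z. exp (c * z) / z ^ Suc k * hpow V k n) has_contour_integral
        (2 * pi * \<i>) / fact k * c ^ k * hpow V k n) (circlepath 0 R)"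
      unfolding higher_deriv_exp_mult by (intro has_contour_integral_rmul) simp
    then show ?thesis by (simp add: T_def[abs_def] mult_ac)
  qed
  define S where "S m z = (\<Sum>k<m. T k z)" for m z
  have S: "(S m has_contour_integral (\<Sum>k<m. 2 * pi * \<i> * (c ^ k / fact k * hpow V k n))) (circlepath 0 R)" for m
    unfolding S_def by (intro has_contour_integral_sum T) simp
  have unif: "uniform_limit (sphere 0 R) S (\<lambda>z. \<Sum>k. T k z) sequentially"
    unfolding S_def
  proof (rule Weierstrass_m_test)
    show "summable (\<lambda>k. exp (cmod c * R) * ((1 / 2) ^ k / R))"
      by (intro summable_mult summable_divide summable_geometric) simp
    fix k z assume z: "z \<in> sphere (0::complex) R"
    have "cmod (exp (c * z)) \<le> exp (cmod c * R)"
      using z norm_exp[of "c * z"] by (simp add: norm_mult)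
    then show "norm (T k z) \<le> exp (cmod c * R) * ((1 / 2) ^ k / R)"
      unfolding T_def norm_mult using z nres_term_le[of z k n]
      by (intro mult_mono) (auto simp: R_def)
  qed
  have F: "(\<Sum>k. T k z) = exp (c * z) * nres V z n" if "z \<in> sphere 0 R" for z
    unfolding T_def nres_def using nres_summable[of z n] that
    by (intro suminf_mult) (auto simp: R_def)
  have unif': "uniform_limit (sphere 0 R) S (\<lambda>z. exp (c * z) * nres V z n) sequentially"
    using unif by (rule uniform_limit_cong'[THEN iffD1, rotated 2]) (auto simp: F)
  have ev: "\<forall>\<^sub>F m in sequentially. S m contour_integrable_on circlepath 0 R"
    using S by (auto simp: contour_integrable_on_def intro!: always_eventually)
  have lim: "(\<lambda>z. exp (c * z) * nres V z n) contour_integrable_on circlepath 0 R"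
    "(\<lambda>m. contour_integral (circlepath 0 R) (S m)) \<longlonglongrightarrow>
      contour_integral (circlepath 0 R) (\<lambda>z. exp (c * z) * nres V z n)"
    using contour_integral_uniform_limit_circlepath[OF ev unif' _ R] by auto
  show "(\<lambda>z. exp (- \<i> * of_real t * z) * nres V z n) contour_integrable_on circlepath 0 R"
    using lim(1) unfolding c_def .
  have "(\<lambda>k. c ^ k / fact k * hpow V k n) sums amp V t n"
    unfolding amp_def c_def by (rule summable_sums[OF summable_norm_cancel[OF amp_summable_norm]])
  then have "(\<lambda>k. 2 * pi * \<i> * (c ^ k / fact k * hpow V k n)) sums (2 * pi * \<i> * amp V t n)"
    by (rule sums_mult)
  then have "(\<lambda>m. contour_integral (circlepath 0 R) (S m)) \<longlonglongrightarrow> 2 * pi * \<i> * amp V t n"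
    unfolding sums_def contour_integral_unique[OF S] .
  from LIMSEQ_unique[OF lim(2) this]
  show "contour_integral (circlepath 0 R) (\<lambda>z. exp (- \<i> * of_real t * z) * nres V z n)
      = 2 * pi * \<i> * amp V t n"
    unfolding c_def .
qed

end

section \<open>Amplitude bounds from Green function decay\<close>

context
  fixes V :: "int \<Rightarrow> real" and B :: real
  assumes V: "\<And>n. \<bar>V n\<bar> \<le> B"
begin

text \<open>Off the middle arc \<open>Im z <= \<eta>\<close> and the Neumann series is small enough
  by itself. On the middle arc it is exchanged for the Green function of \<open>[- m, m]\<close>,
  which is holomorphic in the upper half plane and can be moved down to the line
  \<open>Im z = \<eta>\<close>.\<close>

lemma amp_le:
  defines "R \<equiv> 2 * (B + 2)"
  assumes t: "0 \<le> t" and \<eta>: "0 < \<eta>" "\<eta> < R"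
    and G: "\<And>E L. \<bar>E\<bar> \<le> R \<Longrightarrow> \<bar>n\<bar> \<le> L \<Longrightarrow> cmod (green (Complex E \<eta>) V L n) \<le> G"
  shows "cmod (amp V t n) \<le> exp (\<eta> * t) * (R * G + 2 * (1 / 2) ^ nat \<bar>n\<bar>)"
proof -
  have B: "0 \<le> B" using V[of 0] by simp
  have R: "0 < R" using B by (simp add: R_def)
  \<comment> \<open>The angle at which the circle crosses \<open>Im z = \<eta>\<close>.\<close>
  define \<alpha> where "\<alpha> = arcsin (\<eta> / R)"
  have "0 < \<eta> / R" "\<eta> / R < 1" using \<eta> R by auto
  then have \<alpha>: "0 < \<alpha>" "\<alpha> < pi / 2" "\<eta> = R * sin \<alpha>"
    using arcsin_lt_bounded[of "\<eta> / R"] arcsin_less_arcsin[of 0 "\<eta> / R"] R by (auto simp: \<alpha>_def)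
  have \<alpha>pi: "\<alpha> < pi - \<alpha>" "pi - \<alpha> < 2 * pi" using \<alpha> by auto
  define F where "F z = exp (- \<i> * of_real t * z) * nres V z n" for z
  define g where "g s = F (0 + R * cis s) * R * \<i> * cis s" for s
  have ci: "F contour_integrable_on part_circlepath 0 R 0 (2 * pi)"
    "contour_integral (part_circlepath 0 R 0 (2 * pi)) F = 2 * pi * \<i> * amp V t n"
    using amp_contour[OF V, where t = t and n = n] by (simp_all add: F_def[abs_def] R_def circlepath_def)
  have gi: "g integrable_on {0..2 * pi}"
    using ci(1) contour_integrable_part_circlepath_iff[of 0 "2 * pi" F 0 R] by (simp add: g_def[abs_def])
  have int: "F contour_integrable_on part_circlepath 0 R a b" if "0 \<le> a" "a < b" "b \<le> 2 * pi" for a b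
    unfolding contour_integrable_part_circlepath_iff[OF that(2)] g_def[symmetric, abs_def]
    by (rule integrable_on_subinterval[OF gi]) (use that in auto)
  have eq: "contour_integral (part_circlepath 0 R a b) F = integral {a..b} g" if "a < b" for a b
    unfolding contour_integral_part_circlepath_eq[OF that] by (simp add: g_def[abs_def])
  have "integral {0..2 * pi} g = integral {0..\<alpha>} g + integral {\<alpha>..2 * pi} g"
    using \<alpha> by (intro Henstock_Kurzweil_Integration.integral_combine[symmetric] gi) auto
  also have "integral {\<alpha>..2 * pi} g = integral {\<alpha>..pi - \<alpha>} g + integral {pi - \<alpha>..2 * pi} g"
    using \<alpha> \<alpha>pi by (intro Henstock_Kurzweil_Integration.integral_combine[symmetric] integrable_on_subinterval[OF gi]) auto
  finally have split: "2 * pi * \<i> * amp V t n = contour_integral (part_circlepath 0 R 0 \<alpha>) F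
      + contour_integral (part_circlepath 0 R \<alpha> (pi - \<alpha>)) F
      + contour_integral (part_circlepath 0 R (pi - \<alpha>) (2 * pi)) F"
    using \<alpha> \<alpha>pi ci(2) by (simp add: eq add.assoc)
  define b where "b = exp (\<eta> * t) * ((1 / 2) ^ nat \<bar>n\<bar> / (B + 2))"
  have low: "cmod (contour_integral (part_circlepath 0 R a c) F) \<le> b * R * (c - a)"
    if ac: "0 \<le> a" "a < c" "c \<le> 2 * pi" and sin: "\<And>x. a \<le> x \<Longrightarrow> x \<le> c \<Longrightarrow> sin x \<le> sin \<alpha>" for a c
  proof (rule has_contour_integral_bound_part_circlepath[OF has_contour_integral_integral[OF int[OF ac]]])
    show "0 \<le> b" using B by (simp add: b_def)
    fix z assume "z \<in> path_image (part_circlepath 0 R a c)"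
    then obtain x where x: "a \<le> x" "x \<le> c" "z = R * exp (\<i> * of_real x)"
      using ac(2) by (auto simp: path_image_part_circlepath)
    have "R * sin x \<le> R * sin \<alpha>"
      using sin[OF x(1,2)] R by (intro mult_left_mono) auto
    then have "Im z \<le> \<eta>" by (simp add: x(3) \<alpha>(3) Im_exp)
    moreover have "cmod z = R" using R by (simp add: x(3) norm_mult)
    moreover have "cmod (exp (- \<i> * of_real t * z)) = exp (t * Im z)" by simp
    ultimately have "cmod (exp (- \<i> * of_real t * z)) \<le> exp (\<eta> * t)" "cmod z = 2 * (B + 2)"
      using t mult_left_mono[of "Im z" \<eta> t] by (simp_all add: mult.commute R_def)
    then show "norm (F z) \<le> b"
      unfolding F_def b_def norm_mult by (intro mult_mono nres_le[OF V]) auto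
  qed (use R ac in auto)
  have low1: "cmod (contour_integral (part_circlepath 0 R 0 \<alpha>) F) \<le> b * R * (\<alpha> - 0)"
    using \<alpha> by (intro low) (auto intro!: sin_monotone_2pi_le)
  have low3: "cmod (contour_integral (part_circlepath 0 R (pi - \<alpha>) (2 * pi)) F) \<le> b * R * (2 * pi - (pi - \<alpha>))"
  proof (rule low)
    fix x assume x: "pi - \<alpha> \<le> x" "x \<le> 2 * pi"
    show "sin x \<le> sin \<alpha>"
    proof (cases "x \<le> pi")
      case True
      have "sin (pi - x) \<le> sin \<alpha>" using x True \<alpha> by (intro sin_monotone_2pi_le) auto
      then show ?thesis by simp
    next
      case False
      have "0 \<le> sin (x - pi)" using x False by (intro sin_ge_zero) auto
      moreover have "0 \<le> sin \<alpha>" using \<alpha> by (intro sin_ge_zero) auto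
      ultimately show ?thesis by (simp add: sin_diff)
    qed
  qed (use \<alpha> in auto)
  have mid: "cmod (contour_integral (part_circlepath 0 R \<alpha> (pi - \<alpha>)) F) \<le> exp (\<eta> * t) * G * (2 * R)"
  proof -
    \<comment> \<open>The exchange costs a multiple of \<open>(1 / 2) ^ m\<close>. The factor
      \<open>c\<close> is exponential in \<open>t\<close> but independent of \<open>m\<close>, so
      \<open>m\<close> tending to infinity removes the error.\<close>
    define c where "c = exp (t * R) / (B + 2) * R * (pi - \<alpha> - \<alpha>)"
    have "cmod (contour_integral (part_circlepath 0 R \<alpha> (pi - \<alpha>)) F)
        \<le> exp (\<eta> * t) * G * (2 * R) + c * (1 / 2) ^ Suc m" if m: "nat \<bar>n\<bar> \<le> m" for m
    proof -
      define FL where "FL z = exp (- \<i> * of_real t * z) * green z V (int m) n" for z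
      have FL: "FL contour_integrable_on part_circlepath 0 R \<alpha> (pi - \<alpha>)"
        "cmod (contour_integral (part_circlepath 0 R \<alpha> (pi - \<alpha>)) FL) \<le> exp (\<eta> * t) * G * (2 * R)"
        unfolding FL_def
        using upper_arc_le[OF \<alpha>(1,2) R \<alpha>(3) t green_holomorphic[of "int m" V n], of G] G m by auto
      have Fi: "F contour_integrable_on part_circlepath 0 R \<alpha> (pi - \<alpha>)"
        using \<alpha> by (intro int) auto
      have "cmod (contour_integral (part_circlepath 0 R \<alpha> (pi - \<alpha>)) F
          - contour_integral (part_circlepath 0 R \<alpha> (pi - \<alpha>)) FL)
        \<le> (exp (t * R) * ((1 / 2) ^ Suc m / (B + 2))) * R * (pi - \<alpha> - \<alpha>)"
      proof (rule has_contour_integral_bound_part_circlepath)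
        show "((\<lambda>z. F z - FL z) has_contour_integral contour_integral (part_circlepath 0 R \<alpha> (pi - \<alpha>)) F
          - contour_integral (part_circlepath 0 R \<alpha> (pi - \<alpha>)) FL) (part_circlepath 0 R \<alpha> (pi - \<alpha>))"
          using Fi FL(1) by (intro has_contour_integral_diff has_contour_integral_integral)
        fix z assume "z \<in> path_image (part_circlepath 0 R \<alpha> (pi - \<alpha>))"
        then obtain x where x: "\<alpha> \<le> x" "x \<le> pi - \<alpha>" "z = R * exp (\<i> * of_real x)"
          using \<alpha> by (auto simp: path_image_part_circlepath)
        have "0 < sin x" using x \<alpha> by (intro sin_gt_zero) auto
        then have z0: "0 < Im z" "cmod z = R" using R by (auto simp: x(3) Im_exp norm_mult)
        then have z: "0 < Im z" "cmod z = 2 * (B + 2)" "cmod z = R" by (simp_all add: R_def)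
        have "cmod (nres V z n - green z V (int m) n) \<le> (1 / 2) ^ nat (int m + 1) / (B + 2)"
          using m by (intro nres_minus_green_le[OF V z(2,1)]) auto
        moreover have "nat (int m + 1) = Suc m" by simp
        moreover have "cmod (exp (- \<i> * of_real t * z)) \<le> exp (t * R)"
          using abs_Im_le_cmod[of z] z t by (simp add: mult_left_mono)
        ultimately have "cmod (exp (- \<i> * of_real t * z) * (nres V z n - green z V (int m) n))
            \<le> exp (t * R) * ((1 / 2) ^ Suc m / (B + 2))"
          unfolding norm_mult by (intro mult_mono) auto
        then show "cmod (F z - FL z) \<le> exp (t * R) * ((1 / 2) ^ Suc m / (B + 2))"
          by (simp add: F_def FL_def right_diff_distrib)
      qed (use R \<alpha> B in auto)
      then have "cmod (contour_integral (part_circlepath 0 R \<alpha> (pi - \<alpha>)) F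
          - contour_integral (part_circlepath 0 R \<alpha> (pi - \<alpha>)) FL) \<le> c * (1 / 2) ^ Suc m"
        by (simp add: c_def mult_ac)
      then show ?thesis
        using FL(2) norm_triangle_sub[of "contour_integral (part_circlepath 0 R \<alpha> (pi - \<alpha>)) F"
            "contour_integral (part_circlepath 0 R \<alpha> (pi - \<alpha>)) FL"] by linarith
    qed
    moreover have "(\<lambda>m. exp (\<eta> * t) * G * (2 * R) + c * (1 / 2) ^ Suc m) \<longlonglongrightarrow> exp (\<eta> * t) * G * (2 * R) + c * 0"
      by (intro tendsto_intros LIMSEQ_Suc LIMSEQ_power_zero) simp
    ultimately show ?thesis
      using LIMSEQ_le_const[of _ "exp (\<eta> * t) * G * (2 * R) + c * 0"] by force
  qed
  have "2 * pi * cmod (amp V t n) = cmod (2 * pi * \<i> * amp V t n)"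
    by (simp add: norm_mult)
  also have "\<dots> \<le> b * R * (\<alpha> - 0) + exp (\<eta> * t) * G * (2 * R) + b * R * (2 * pi - (pi - \<alpha>))"
    unfolding split using low1 low3 mid by (intro norm_triangle_le add_mono) auto
  also have "\<dots> = exp (\<eta> * t) * G * (2 * R) + b * R * (pi + 2 * \<alpha>)"
    by (simp add: algebra_simps)
  also have "b * R = 2 * (exp (\<eta> * t) * (1 / 2) ^ nat \<bar>n\<bar>)"
  proof -
    have *: "e * (y / c) * (2 * c) = 2 * (e * y)" if "c \<noteq> 0" for e y c :: real
      using that by simp
    show ?thesis unfolding b_def R_def by (rule *) (use B in simp)
  qed
  also have "2 * (exp (\<eta> * t) * (1 / 2) ^ nat \<bar>n\<bar>) * (pi + 2 * \<alpha>)
      \<le> 2 * (exp (\<eta> * t) * (1 / 2) ^ nat \<bar>n\<bar>) * (2 * pi)"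
    using \<alpha> by (intro mult_left_mono) auto
  finally have "2 * pi * cmod (amp V t n)
      \<le> exp (\<eta> * t) * G * (2 * R) + 2 * (exp (\<eta> * t) * (1 / 2) ^ nat \<bar>n\<bar>) * (2 * pi)"
    by simp
  moreover have "exp (\<eta> * t) * G * (2 * R) \<le> exp (\<eta> * t) * G * (2 * R) * pi"
  proof -
    have "0 \<le> G" by (rule order_trans[OF norm_ge_zero G[of 0 "\<bar>n\<bar>"]]) (use R in auto)
    then have "exp (\<eta> * t) * G * (2 * R) * 1 \<le> exp (\<eta> * t) * G * (2 * R) * pi"
      using R pi_gt3 by (intro mult_left_mono) auto
    then show ?thesis by simp
  qed
  ultimately have "2 * pi * cmod (amp V t n) \<le> 2 * pi * (exp (\<eta> * t) * (R * G + 2 * (1 / 2) ^ nat \<bar>n\<bar>))"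
    by (simp add: algebra_simps)
  then show ?thesis by simp
qed

text \<open>Each block gains \<open>1 / (\<eta> * M) <= \<eta> * exp (- 1)\<close>. One factor
  \<open>\<eta>\<close>, available because \<open>i >= 1\<close>, pays for the
  \<open>1 / \<eta>\<close> of the resolvent bound; hence the order of \<open>M\<close>. With
  \<open>N >= 2\<close> the Neumann remainder decays at least at the same rate
  \<open>exp (- i)\<close>.\<close>

lemma amp_decay:
  defines "R \<equiv> 2 * (B + 2)"
  assumes t: "0 \<le> t" and \<eta>: "0 < \<eta>" "\<eta> \<le> 1" and M: "exp 1 / \<eta>\<^sup>2 \<le> M"
    and grow: "\<And>E s. \<bar>E\<bar> \<le> R \<Longrightarrow> 0 \<le> s \<Longrightarrow>
      \<exists>m j. s < m \<and> m \<le> j \<and> j \<le> s + int N \<and> M \<le> cmod (solp (Complex E \<eta>) V m j)"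
    and N: "2 \<le> N" and i: "1 \<le> i" and k: "int i * int N \<le> k"
  shows "cmod (amp V t k) \<le> exp (\<eta> * t) * ((R + 2) * exp (- real i))"
proof -
  have R: "4 \<le> R" using V[of 0] by (simp add: R_def)
  have M0: "0 < M" using M \<eta> by (meson divide_pos_pos exp_gt_zero less_le_trans zero_less_power)
  have k0: "0 \<le> k" using k by (meson mult_nonneg_nonneg of_nat_0_le_iff order_trans)
  have "1 / (\<eta> * M) \<le> \<eta> * exp (- 1)"
    using M M0 \<eta> by (simp add: exp_minus field_simps power2_eq_square)
  then have "(1 / (\<eta> * M)) ^ i \<le> (\<eta> * exp (- 1)) ^ i"
    using \<eta> M0 by (intro power_mono) auto
  also have "\<dots> = \<eta> ^ i * exp (- real i)"
    using exp_of_nat_mult[of i "-1::real"] by (simp add: power_mult_distrib)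
  also have "\<dots> \<le> \<eta> * exp (- real i)"
    using \<eta> i power_decreasing[of 1 i \<eta>] by (intro mult_right_mono) auto
  finally have G: "1 / \<eta> * (1 / (\<eta> * M)) ^ i \<le> exp (- real i)"
    using mult_left_mono[of "(1 / (\<eta> * M)) ^ i" "\<eta> * exp (- real i)" "1 / \<eta>"] \<eta> by simp
  have "cmod (amp V t k) \<le> exp (\<eta> * t) * (R * exp (- real i) + 2 * (1 / 2) ^ nat \<bar>k\<bar>)"
    unfolding R_def
  proof (rule amp_le[OF t \<eta>(1)])
    show "\<eta> < 2 * (B + 2)" using \<eta> R by (simp add: R_def)
    fix E L assume E: "\<bar>E\<bar> \<le> 2 * (B + 2)" and L: "\<bar>k\<bar> \<le> L"
    have "cmod (green (Complex E \<eta>) V L k) \<le> 1 / Im (Complex E \<eta>) * (1 / (Im (Complex E \<eta>) * M)) ^ i"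
      using grow[of E] E L k \<eta> by (intro green_decay[OF _ _ M0, where N = N]) (auto simp: R_def)
    then show "cmod (green (Complex E \<eta>) V L k) \<le> exp (- real i)"
      using G by simp
  qed
  also have "(1 / 2) ^ nat \<bar>k\<bar> \<le> exp (- real i)"
  proof -
    have "2 * i \<le> N * i" using N by (intro mult_right_mono) auto
    also have "int (N * i) \<le> k" using k by (simp add: mult.commute)
    then have "N * i \<le> nat \<bar>k\<bar>" by linarith
    finally have "(1 / 2 :: real) ^ nat \<bar>k\<bar> \<le> (1 / 2) ^ (2 * i)"
      by (intro power_decreasing) auto
    also have "\<dots> = (1 / 4) ^ i" by (simp add: power_mult power2_eq_square)
    also have "\<dots> \<le> (exp (- 1)) ^ i"
      using exp_le by (intro power_mono) (auto simp: exp_minus field_simps)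
    also have "\<dots> = exp (- real i)"
      using exp_of_nat_mult[of i "-1::real"] by simp
    finally show ?thesis .
  qed
  then have "exp (\<eta> * t) * (R * exp (- real i) + 2 * (1 / 2) ^ nat \<bar>k\<bar>)
      \<le> exp (\<eta> * t) * (R * exp (- real i) + 2 * exp (- real i))"
    by (intro mult_left_mono add_left_mono) auto
  finally show ?thesis by (simp add: algebra_simps)
qed

end

subsection \<open>Unitarity\<close>

lemma hpow_reflect: "hpow (\<lambda>n. V (- n)) k n = hpow V k (- n)"
proof (induction k arbitrary: n)
  case (Suc k)
  have e: "- (n - 1) = - n + 1" "- (n + 1) = - n - 1" by auto
  show ?case by (simp only: hpow.simps hop_def Suc e) (simp only: add.commute[of "hpow V k (- n + 1)"])
qed simp

text \<open>Reduces sites left of 0 to sites right of 0; for a quasiperiodic potential the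
  reflection changes the sign of the frequency.\<close>

lemma amp_reflect: "amp (\<lambda>n. V (- n)) t n = amp V t (- n)"
  by (simp add: amp_def hpow_reflect)

text \<open>Conservation of the total mass is used twice: it bounds amplitudes by 1 where no decay
  is available, and it keeps the logarithms of the moments nonnegative.\<close>

definition mass :: "(int \<Rightarrow> real) \<Rightarrow> nat \<Rightarrow> real \<Rightarrow> real" where
  "mass V L t = (\<Sum>n\<in>{- int L..int L}. (cmod (amp V t n))\<^sup>2)"

context
  fixes V :: "int \<Rightarrow> real" and B :: real
  assumes V: "\<And>n. \<bar>V n\<bar> \<le> B"
begin

lemma amp_has_vector_derivative:
  "((\<lambda>t. amp V t n) has_vector_derivative (- \<i> * hop V (amp V t) n)) (at t)"
proof -
  define c where "c n k = (- \<i>) ^ k / fact k * hpow V k n" for n k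
  define A where "A n z = (\<Sum>k. c n k * z ^ k)" for n z
  have cr: "c n k * of_real r ^ k = (- \<i> * of_real r) ^ k / fact k * hpow V k n" for n k r
    unfolding c_def power_mult_distrib by (simp add: mult_ac)
  have summ: "summable (\<lambda>k. c n k * z ^ k)" for n z
  proof (rule powser_inside)
    show "summable (\<lambda>k. c n k * of_real (cmod z + 1) ^ k)"
      unfolding cr by (rule summable_norm_cancel[OF amp_summable_norm[OF V]])
  qed auto
  have amp: "amp V t n = A n (of_real t)" for t n
    unfolding amp_def A_def cr ..
  have "(A n has_field_derivative (\<Sum>k. diffs (c n) k * of_real t ^ k)) (at (of_real t))"
    unfolding A_def[abs_def] by (rule termdiffs_strong_converges_everywhere[OF summ])
  moreover have "(\<lambda>k. diffs (c n) k * of_real t ^ k) sums (- \<i> * hop V (amp V t) n)"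
  proof -
    have "diffs (c n) k * z = - \<i> * (c (n - 1) k * z + c (n + 1) k * z + of_real (V n) * (c n k * z))" for k z
      unfolding diffs_def c_def by (simp add: hop_def field_simps del: of_nat_Suc)
    moreover have "(\<lambda>k. - \<i> * (c (n - 1) k * of_real t ^ k + c (n + 1) k * of_real t ^ k
        + of_real (V n) * (c n k * of_real t ^ k))) sums (- \<i> * hop V (amp V t) n)"
      unfolding hop_def amp A_def by (intro sums_mult sums_add summable_sums summ)
    ultimately show ?thesis by simp
  qed
  ultimately have "(A n has_field_derivative (- \<i> * hop V (amp V t) n)) (at (of_real t))"
    by (simp add: sums_iff)
  then show ?thesis
    unfolding amp[abs_def] by (rule has_vector_derivative_real_field)
qed

lemma amp_continuous: "continuous_on S (\<lambda>t. amp V t n)"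
  by (rule continuous_on_subset[of UNIV])
    (auto simp: continuous_on_eq_continuous_at intro!: has_vector_derivative_continuous[OF amp_has_vector_derivative])

lemma amp_zero: "amp V 0 n = (if n = 0 then 1 else 0)"
proof -
  have "(\<lambda>k. (- \<i> * of_real 0) ^ k / fact k * hpow V k n) sums (\<Sum>k\<in>{0}. (- \<i> * of_real 0) ^ k / fact k * hpow V k n)"
    by (rule sums_finite) auto
  then show ?thesis by (simp add: amp_def sums_iff)
qed

text \<open>Only powers \<open>k >= |n|\<close> contribute. Doubling the time in the exponential
  series releases a factor \<open>(1 / 2) ^ k\<close>, at most \<open>(1 / 2) ^ |n|\<close>.\<close>

lemma amp_tail_le: "cmod (amp V t n) \<le> (1 / 2) ^ nat \<bar>n\<bar> * exp (2 * (B + 2) * \<bar>t\<bar>)"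
proof -
  have B: "0 \<le> B" using V[of 0] by simp
  let ?g = "\<lambda>k. (1 / 2) ^ nat \<bar>n\<bar> * (inverse (fact k) * (2 * (B + 2) * \<bar>t\<bar>) ^ k)"
  have g: "?g sums ((1 / 2) ^ nat \<bar>n\<bar> * exp (2 * (B + 2) * \<bar>t\<bar>))"
    by (intro sums_mult) (simp add: exp_def divide_inverse scaleR_conv_of_real summable_sums[OF summable_exp])
  have "norm ((- \<i> * of_real t) ^ k / fact k * hpow V k n) \<le> ?g k" for k
  proof (cases "nat \<bar>n\<bar> \<le> k")
    case True
    have "norm ((- \<i> * of_real t) ^ k / fact k * hpow V k n) = \<bar>t\<bar> ^ k / fact k * cmod (hpow V k n)"
      by (simp add: norm_mult norm_divide norm_power)
    also have "\<dots> \<le> \<bar>t\<bar> ^ k / fact k * (B + 2) ^ k"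
      by (intro mult_left_mono hpow_le[of V B, OF V]) auto
    also have "\<dots> = (1 / 2) ^ k * (inverse (fact k) * (2 * (B + 2) * \<bar>t\<bar>) ^ k)"
    proof -
      have "a ^ k / d * c ^ k = (1 / 2) ^ k * (inverse d * (2 * c * a) ^ k)" for a c d :: real
      proof -
        have "(1 / 2) ^ k * (inverse d * (2 * c * a) ^ k) = ((1 / 2) ^ k * 2 ^ k) * (inverse d * (c ^ k * a ^ k))"
          unfolding power_mult_distrib by (simp only: mult_ac)
        also have "(1 / 2) ^ k * 2 ^ k = (1 :: real)"
          by (simp flip: power_mult_distrib)
        finally have e: "(1 / 2) ^ k * (inverse d * (2 * c * a) ^ k) = 1 * (inverse d * (c ^ k * a ^ k))" .
        show ?thesis unfolding e by (simp add: divide_inverse)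
      qed
      then show ?thesis .
    qed
    also have "\<dots> \<le> ?g k"
      using True B by (intro mult_right_mono power_decreasing) auto
    finally show ?thesis .
  next
    case False
    then have "hpow V k n = 0" by (intro hpow_support) linarith
    then show ?thesis using B by simp
  qed
  then have "cmod (amp V t n) \<le> suminf ?g"
    unfolding amp_def by (rule norm_suminf_le[OF _ sums_summable[OF g]])
  then show ?thesis using sums_unique[OF g] by simp
qed

lemma mass_has_derivative:
  defines "c \<equiv> \<lambda>t n. Im (amp V t (n - 1) * cnj (amp V t n))"
  shows "(mass V L has_real_derivative 2 * (c t (- int L) - c t (int L + 1))) (at t)"
proof -
  have "((\<lambda>t. (cmod (amp V t n))\<^sup>2) has_real_derivative 2 * (c t n - c t (n + 1))) (at t)" for n
  proof -
    have "((\<lambda>t. amp V t n \<bullet> amp V t n) has_vector_derivative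
        (amp V t n \<bullet> (- \<i> * hop V (amp V t) n) + (- \<i> * hop V (amp V t) n) \<bullet> amp V t n)) (at t)"
      by (intro bounded_bilinear.has_vector_derivative[OF bounded_bilinear_inner] amp_has_vector_derivative)
    moreover have "amp V t n \<bullet> (- \<i> * hop V (amp V t) n) + (- \<i> * hop V (amp V t) n) \<bullet> amp V t n
        = 2 * (c t n - c t (n + 1))"
      by (simp add: inner_complex_def hop_def c_def algebra_simps)
    ultimately show ?thesis
      by (simp add: power2_norm_eq_inner has_real_derivative_iff_has_vector_derivative)
  qed
  then have "(mass V L has_real_derivative (\<Sum>n\<in>{- int L..int L}. 2 * (c t n - c t (n + 1)))) (at t)"
    unfolding mass_def[abs_def] by (intro DERIV_sum)
  also have "(\<Sum>n\<in>{- int L..int L}. 2 * (c t n - c t (n + 1))) = 2 * (c t (- int L) - c t (int L + 1))"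
    unfolding sum_distrib_left[symmetric] by (subst sum_telescope_int) auto
  finally show ?thesis .
qed

text \<open>The mass of a window changes only by the currents at its edges \<open>- L\<close> and
  \<open>L + 1\<close>, and these carry the tail factor \<open>(1 / 2) ^ L\<close>; at time 0 the
  mass is 1.\<close>

lemma mass_near_1:
  assumes "0 \<le> t"
  shows "\<bar>mass V L t - 1\<bar> \<le> 4 * t * exp (4 * (B + 2) * t) * (1 / 2) ^ L"
proof -
  have B: "0 \<le> B" using V[of 0] by simp
  have m0: "mass V L 0 = 1"
  proof -
    have "mass V L 0 = (\<Sum>n\<in>{- int L..int L}. if n = 0 then 1 else 0)"
      unfolding mass_def by (intro sum.cong) (auto simp: amp_zero)
    then show ?thesis by simp
  qed
  define c where "c s n = Im (amp V s (n - 1) * cnj (amp V s n))" for s n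
  have c: "\<bar>c s n\<bar> \<le> exp (4 * (B + 2) * t) * (1 / 2) ^ L" if s: "0 \<le> s" "s \<le> t" and n: "n = - int L \<or> n = int L + 1" for s n
  proof -
    let ?e = "exp (2 * (B + 2) * t)"
    have e: "exp (2 * (B + 2) * \<bar>s\<bar>) \<le> ?e" using s B by (simp add: mult_left_mono)
    have a: "cmod (amp V s k) \<le> ?e * (1 / 2) ^ nat \<bar>k\<bar>" for k
      using order_trans[OF amp_tail_le mult_left_mono[OF e]] by (subst mult.commute) auto
    have a1: "cmod (amp V s k) \<le> ?e" for k
    proof -
      have "?e * (1 / 2) ^ nat \<bar>k\<bar> \<le> ?e * 1"
        by (intro mult_left_mono power_le_one) auto
      then show ?thesis using a[of k] by linarith
    qed
    have "\<bar>c s n\<bar> \<le> cmod (amp V s (n - 1)) * cmod (amp V s n)"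
      unfolding c_def using abs_Im_le_cmod[of "amp V s (n - 1) * cnj (amp V s n)"] by (simp add: norm_mult)
    also have "\<dots> \<le> ?e * (?e * (1 / 2) ^ nat \<bar>n\<bar>)"
      by (intro mult_mono a a1) auto
    also have "\<dots> = exp (4 * (B + 2) * t) * (1 / 2) ^ nat \<bar>n\<bar>"
    proof -
      have "2 * (B + 2) * t + 2 * (B + 2) * t = 4 * (B + 2) * t" by simp
      then have "?e * ?e = exp (4 * (B + 2) * t)" by (simp flip: exp_add)
      then show ?thesis by (metis mult.assoc)
    qed
    also have "\<dots> \<le> exp (4 * (B + 2) * t) * (1 / 2) ^ L"
      using n by (intro mult_left_mono power_decreasing) auto
    finally show ?thesis .
  qed
  have "norm (mass V L t - mass V L 0) \<le> (4 * exp (4 * (B + 2) * t) * (1 / 2) ^ L) * norm (t - 0)"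
  proof (rule field_differentiable_bound[where S = "{0..t}" and f' = "\<lambda>s. 2 * (c s (- int L) - c s (int L + 1))"])
    fix s assume s: "s \<in> {0..t}"
    show "(mass V L has_field_derivative 2 * (c s (- int L) - c s (int L + 1))) (at s within {0..t})"
      unfolding c_def by (rule has_field_derivative_at_within[OF mass_has_derivative])
    show "norm (2 * (c s (- int L) - c s (int L + 1))) \<le> 4 * exp (4 * (B + 2) * t) * (1 / 2) ^ L"
    proof -
      have "\<bar>c s (- int L)\<bar> \<le> exp (4 * (B + 2) * t) * (1 / 2) ^ L"
        "\<bar>c s (int L + 1)\<bar> \<le> exp (4 * (B + 2) * t) * (1 / 2) ^ L"
        using s by (intro c; simp)+
      moreover have "\<bar>2 * (x - y)\<bar> \<le> 4 * K" if "\<bar>x\<bar> \<le> K" "\<bar>y\<bar> \<le> K" for x y K :: real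
        using that abs_triangle_ineq4[of x y] by (simp add: abs_mult)
      ultimately have "\<bar>2 * (c s (- int L) - c s (int L + 1))\<bar> \<le> 4 * (exp (4 * (B + 2) * t) * (1 / 2) ^ L)"
        by blast
      then show ?thesis by (simp only: real_norm_def mult.assoc)
    qed
  qed (use assms in auto)
  then have "\<bar>mass V L t - 1\<bar> \<le> (4 * exp (4 * (B + 2) * t) * (1 / 2) ^ L) * t"
    unfolding m0 real_norm_def diff_0_right abs_of_nonneg[OF assms] .
  then show ?thesis by (simp only: mult_ac)
qed

lemma mass_tendsto_1:
  assumes "0 \<le> t"
  shows "(\<lambda>L. mass V L t) \<longlonglongrightarrow> 1"
proof -
  have "(\<lambda>L. 4 * t * exp (4 * (B + 2) * t) * (1 / 2) ^ L) \<longlonglongrightarrow> 4 * t * exp (4 * (B + 2) * t) * 0"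
    by (rule tendsto_mult_left, rule LIMSEQ_power_zero) simp
  then have "(\<lambda>L. 4 * t * exp (4 * (B + 2) * t) * (1 / 2) ^ L) \<longlonglongrightarrow> 0"
    by simp
  moreover have "\<forall>\<^sub>F L in sequentially. norm (mass V L t - 1) \<le> 4 * t * exp (4 * (B + 2) * t) * (1 / 2) ^ L"
    using mass_near_1[OF assms] by (intro always_eventually allI) simp
  ultimately have "(\<lambda>L. mass V L t - 1) \<longlonglongrightarrow> 0"
    by (rule Lim_null_comparison[rotated])
  then show ?thesis by (simp add: LIM_zero_iff)
qed

lemma mass_le_1:
  assumes "0 \<le> t"
  shows "mass V L t \<le> 1"
proof (rule LIMSEQ_le_const[OF mass_tendsto_1[OF assms]])
  show "\<exists>N. \<forall>n\<ge>N. mass V L t \<le> mass V n t"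
    unfolding mass_def by (intro exI[of _ L] allI impI sum_mono2) auto
qed

lemma amp_le_1:
  assumes "0 \<le> t"
  shows "cmod (amp V t n) \<le> 1"
proof -
  have "(cmod (amp V t n))\<^sup>2 \<le> mass V (nat \<bar>n\<bar>) t"
    unfolding mass_def by (intro member_le_sum) auto
  also have "\<dots> \<le> 1" by (rule mass_le_1[OF assms])
  finally show ?thesis by (simp add: abs_square_le_1)
qed

end

subsection \<open>The evolution of the Schroedinger operator\<close>

text \<open>A source at \<open>j\<close> is moved to 0 by translating the potential, which for a
  quasiperiodic potential only shifts the phase by \<open>j * \<omega>\<close>. This is why the
  source 0 suffices elsewhere.\<close>

lemma op_power_apply:
  fixes H :: "ell2 \<Rightarrow>\<^sub>L ell2"
  assumes "\<And>u n. ell2_fun (H u) n = hop V (ell2_fun u) n"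
  shows "ell2_fun ((((\<lambda>B. (scalar_op c o\<^sub>L H) o\<^sub>L B) ^^ k) id_blinfun) (ket j)) n
    = c ^ k * hpow (\<lambda>n. V (n + j)) k (n - j)"
proof (induction k arbitrary: n)
  case 0
  then show ?case by (simp add: ket.rep_eq)
next
  case (Suc k)
  let ?u = "(((\<lambda>B. (scalar_op c o\<^sub>L H) o\<^sub>L B) ^^ k) id_blinfun) (ket j)"
  have "ell2_fun ((((\<lambda>B. (scalar_op c o\<^sub>L H) o\<^sub>L B) ^^ Suc k) id_blinfun) (ket j)) n
    = c * hop V (ell2_fun ?u) n"
    by (simp add: scalar_op_apply assms)
  also have "ell2_fun ?u = (\<lambda>n. c ^ k * hpow (\<lambda>n. V (n + j)) k (n - j))"
    using Suc by auto
  finally show ?case by (simp add: hop_def algebra_simps)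
qed

lemma bounded_linear_ell2_fun: "bounded_linear (\<lambda>u. ell2_fun u n)"
  by (rule bounded_linear_intro[where K = 1])
    (auto simp: plus_ell2.rep_eq scaleR_ell2.rep_eq scaleR_conv_of_real ell2_coord_le)

lemma evolution_ket:
  fixes H :: "ell2 \<Rightarrow>\<^sub>L ell2"
  assumes "\<And>u n. ell2_fun (H u) n = hop V (ell2_fun u) n"
  shows "ell2_fun (evolution H t (ket j)) n = amp (\<lambda>n. V (n + j)) t (n - j)"
proof -
  define c where "c = - \<i> * complex_of_real t"
  let ?P = "\<lambda>k. ((\<lambda>B. (scalar_op c o\<^sub>L H) o\<^sub>L B) ^^ k) id_blinfun"
  have bl: "bounded_linear (\<lambda>A :: ell2 \<Rightarrow>\<^sub>L ell2. ell2_fun (A (ket j)) n)"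
    by (rule bounded_linear_compose[OF bounded_linear_ell2_fun
      bounded_bilinear.bounded_linear_left[OF bounded_bilinear_blinfun_apply]])
  have "ell2_fun (evolution H t (ket j)) n = (\<Sum>k. ell2_fun ((?P k /\<^sub>R fact k) (ket j)) n)"
    unfolding evolution_def op_exp_def c_def[symmetric]
    by (rule bounded_linear.suminf[OF bl op_exp_summable])
  also have "(\<lambda>k. ell2_fun ((?P k /\<^sub>R fact k) (ket j)) n) = (\<lambda>k. c ^ k / fact k * hpow (\<lambda>n. V (n + j)) k (n - j))"
    by (rule ext) (simp add: blinfun.scaleR_left scaleR_ell2.rep_eq op_power_apply[OF assms] divide_inverse)
  finally show ?thesis by (simp add: amp_def c_def)
qed

lemma cinner_ket: "cinner u (ket n) = ell2_fun u n"
proof -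
  have "cinner u (ket n) = (\<Sum>\<^sub>\<infinity>m. ell2_fun u m * cnj (if m = n then 1 else 0))"
    by (simp add: cinner.rep_eq ket.rep_eq)
  also have "\<dots> = (\<Sum>\<^sub>\<infinity>m\<in>{n}. ell2_fun u m)"
    by (rule infsum_cong_neutral) auto
  finally show ?thesis by simp
qed

lemma transition_prob_amp:
  assumes "bounded (range f)"
  shows "transition_prob (schroedinger f lam \<omega> \<theta>) n t =
    ((cmod (amp (\<lambda>n. lam * f (of_int n * \<omega> + \<theta>)) t n))\<^sup>2
      + (cmod (amp (\<lambda>n. lam * f (of_int n * \<omega> + (\<omega> + \<theta>))) t (n - 1)))\<^sup>2) / 2"
proof -
  have H: "ell2_fun (schroedinger f lam \<omega> \<theta> u) n = hop (\<lambda>n. lam * f (of_int n * \<omega> + \<theta>)) (ell2_fun u) n" for u n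
    unfolding hop_def by (rule schroedinger_apply[OF assms])
  show ?thesis
    unfolding transition_prob_def cinner_ket evolution_ket[OF H] by (simp add: algebra_simps)
qed

subsection \<open>Weighted sums and time averages\<close>

lemma sum_exp_abs_le:
  fixes x :: real
  assumes x: "0 < x" "x \<le> 1" and F: "finite F"
  shows "(\<Sum>n\<in>F. exp (- x * \<bar>real_of_int n\<bar>)) \<le> 4 / x"
proof -
  define r where "r = exp (- x)"
  have r: "0 < r" "r < 1" using x by (auto simp: r_def)
  have e: "exp (- x * \<bar>real_of_int n\<bar>) = r ^ nat \<bar>n\<bar>" for n
    using exp_of_nat_mult[of "nat \<bar>n\<bar>" "- x"] by (simp add: r_def mult.commute)
  have part: "(\<Sum>n\<in>A. r ^ nat \<bar>n\<bar>) \<le> 1 / (1 - r)" if "finite A" "inj_on (\<lambda>n. nat \<bar>n\<bar>) A" for A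
  proof -
    have "(\<Sum>n\<in>A. r ^ nat \<bar>n\<bar>) = (\<Sum>k\<in>(\<lambda>n. nat \<bar>n\<bar>) ` A. r ^ k)"
      by (simp add: sum.reindex[OF that(2)])
    also have "\<dots> \<le> (\<Sum>k. r ^ k)"
      using r that(1) by (intro sum_le_suminf summable_geometric) auto
    also have "\<dots> = 1 / (1 - r)" using r by (intro suminf_geometric) auto
    finally show ?thesis .
  qed
  have "x / 2 \<le> 1 - r"
  proof -
    \<comment> \<open>With \<open>1 + x <= exp x\<close> this gives
      \<open>1 - exp (- x) >= x / 2\<close>, so each half line sums to at most
      \<open>2 / x\<close>.\<close>
    have "1 \<le> (1 - x / 2) * (1 + x)"
    proof -
      have "x * x \<le> x * 1" using x by (intro mult_left_mono) auto
      then show ?thesis by (simp add: algebra_simps)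
    qed
    also have "\<dots> \<le> (1 - x / 2) * exp x"
      using x exp_ge_add_one_self[of x] by (intro mult_left_mono) auto
    finally have "1 * exp (- x) \<le> (1 - x / 2) * exp x * exp (- x)"
      by (intro mult_right_mono) auto
    then show ?thesis by (simp add: r_def mult.assoc flip: exp_add)
  qed
  then have "1 / (1 - r) \<le> 1 / (x / 2)" using x r by (intro divide_left_mono) auto
  then have two: "1 / (1 - r) \<le> 2 / x" by simp
  have "(\<Sum>n\<in>F. r ^ nat \<bar>n\<bar>) = (\<Sum>n\<in>F \<inter> {0..}. r ^ nat \<bar>n\<bar>) + (\<Sum>n\<in>F - {0..}. r ^ nat \<bar>n\<bar>)"
    using F by (rule sum.Int_Diff)
  also have "\<dots> \<le> 2 / x + 2 / x"
  proof (rule add_mono)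
    have "inj_on (\<lambda>n. nat \<bar>n\<bar>) (F \<inter> {0..})" by (auto simp: inj_on_def)
    then show "(\<Sum>n\<in>F \<inter> {0..}. r ^ nat \<bar>n\<bar>) \<le> 2 / x"
      using part[of "F \<inter> {0..}"] F two by simp
    have "inj_on (\<lambda>n. nat \<bar>n\<bar>) (F - {0..})" by (auto simp: inj_on_def)
    then show "(\<Sum>n\<in>F - {0..}. r ^ nat \<bar>n\<bar>) \<le> 2 / x"
      using part[of "F - {0..}"] F two by simp
  qed
  finally show ?thesis unfolding e by simp
qed

text \<open>For \<open>u = (1 + y) / N\<close>, the inequality \<open>ln v <= v - 1\<close> at
  \<open>v = u / p\<close> gives \<open>u powr p <= p powr p * exp u\<close>; the excess
  \<open>1 / N\<close> of \<open>u\<close> over \<open>y / N\<close> goes into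
  \<open>exp 1\<close>.\<close>

lemma powr_exp_le:
  fixes N p y :: real
  assumes p: "0 < p" and N: "1 \<le> N" and y: "0 \<le> y"
  shows "(1 + y) powr p * exp (- y / N) \<le> p powr p * exp 1 * N powr p"
proof -
  define u where "u = (1 + y) / N"
  have u: "0 < u" "1 + y = N * u" using N y by (auto simp: u_def)
  have "ln (u / p) \<le> u / p - 1" using u(1) p by (intro ln_le_minus_one) simp
  then have "p * ln (u / p) \<le> p * (u / p - 1)" using p by (intro mult_left_mono) auto
  then have "p * ln u \<le> p * ln p + u"
    using u(1) p by (simp add: ln_div algebra_simps)
  then have "u powr p \<le> p powr p * exp u"
    using u(1) p unfolding powr_def by (simp flip: exp_add)
  then have "(1 + y) powr p * exp (- y / N) \<le> N powr p * (p powr p * exp u) * exp (- y / N)"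
    unfolding u(2) using N u(1) by (simp add: powr_mult)
  also have "\<dots> = p powr p * N powr p * exp (u - y / N)"
    by (simp add: exp_diff exp_minus field_simps)
  also have "u - y / N = 1 / N" by (simp add: u_def add_divide_distrib)
  also have "p powr p * N powr p * exp (1 / N) \<le> p powr p * N powr p * exp 1"
    using N by (intro mult_left_mono) auto
  finally show ?thesis by (simp add: mult_ac)
qed

text \<open>Half of the decay rate absorbs the weight at the price \<open>N powr p\<close>; the
  other half sums to at most \<open>4 * N\<close>.\<close>

lemma weighted_sum_le:
  fixes N p :: real
  assumes p: "0 < p" and N: "1 \<le> N" and D: "0 \<le> D"
    and a: "\<And>n. a n \<le> D * exp (- 2 * \<bar>real_of_int n\<bar> / N)" and F: "finite F"
  shows "(\<Sum>n\<in>F. (1 + \<bar>real_of_int n\<bar>) powr p * a n) \<le> D * (4 * p powr p * exp 1) * N powr (p + 1)"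
proof -
  define K where "K = p powr p * exp 1 * N powr p"
  have "(1 + \<bar>real_of_int n\<bar>) powr p * a n \<le> D * K * exp (- (1 / N) * \<bar>real_of_int n\<bar>)" for n
  proof -
    let ?y = "\<bar>real_of_int n\<bar>"
    have "(1 + ?y) powr p * a n \<le> (1 + ?y) powr p * (D * exp (- 2 * ?y / N))"
      by (intro mult_left_mono a) simp
    also have "exp (- 2 * ?y / N) = exp (- ?y / N) * exp (- (1 / N) * ?y)"
      by (simp flip: exp_add)
    also have "(1 + ?y) powr p * (D * (exp (- ?y / N) * exp (- (1 / N) * ?y)))
      = D * ((1 + ?y) powr p * exp (- ?y / N)) * exp (- (1 / N) * ?y)"
      by (simp only: mult_ac)
    also have "\<dots> \<le> D * K * exp (- (1 / N) * ?y)"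
      unfolding K_def using D by (intro mult_right_mono mult_left_mono powr_exp_le p N) auto
    finally show ?thesis .
  qed
  then have "(\<Sum>n\<in>F. (1 + \<bar>real_of_int n\<bar>) powr p * a n)
      \<le> D * K * (\<Sum>n\<in>F. exp (- (1 / N) * \<bar>real_of_int n\<bar>))"
    unfolding sum_distrib_left by (intro sum_mono)
  also have "\<dots> \<le> D * K * (4 / (1 / N))"
    using N D by (intro mult_left_mono sum_exp_abs_le F) (auto simp: K_def)
  also have "\<dots> = D * (4 * p powr p * exp 1) * N powr (p + 1)"
    using N by (simp add: K_def powr_add)
  finally show ?thesis .
qed

lemma infsum_le_if_finite_sums_le:
  fixes g :: "'a \<Rightarrow> real"
  assumes "\<And>n. 0 \<le> g n" "\<And>F. finite F \<Longrightarrow> sum g F \<le> b"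
  shows "infsum g UNIV \<le> b"
proof (rule infsum_le_finite_sums)
  show "g summable_on UNIV"
    by (rule nonneg_bdd_above_summable_on) (use assms in \<open>auto simp: bdd_above_def\<close>)
qed (use assms in auto)

text \<open>If the series diverges, \<open>infsum\<close> is \<open>0\<close> and so is its logarithm.\<close>

lemma ln_weighted_infsum_nonneg:
  assumes p: "0 < p" and a: "\<And>n. 0 \<le> a n"
    and lim: "(\<lambda>L. \<Sum>n\<in>{- int L..int L}. a n) \<longlonglongrightarrow> 1"
  shows "0 \<le> ln (\<Sum>\<^sub>\<infinity>n. (1 + \<bar>real_of_int n\<bar>) powr p * a n)"
proof (cases "(\<lambda>n. (1 + \<bar>real_of_int n\<bar>) powr p * a n) summable_on UNIV")
  case True
  have "1 \<le> (\<Sum>\<^sub>\<infinity>n. (1 + \<bar>real_of_int n\<bar>) powr p * a n)"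
  proof (rule LIMSEQ_le_const2[OF lim], intro exI allI impI)
    fix L :: nat
    have "(\<Sum>n\<in>{- int L..int L}. a n) \<le> (\<Sum>n\<in>{- int L..int L}. (1 + \<bar>real_of_int n\<bar>) powr p * a n)"
    proof (rule sum_mono)
      fix n :: int
      have "1 \<le> (1 + \<bar>real_of_int n\<bar>) powr p" using p by (intro ge_one_powr_ge_zero) auto
      then show "a n \<le> (1 + \<bar>real_of_int n\<bar>) powr p * a n"
        using mult_right_mono[of 1 "(1 + \<bar>real_of_int n\<bar>) powr p" "a n"] a[of n] by simp
    qed
    also have "\<dots> \<le> (\<Sum>\<^sub>\<infinity>n. (1 + \<bar>real_of_int n\<bar>) powr p * a n)"
      by (intro finite_sum_le_infsum True) (auto simp: a)
    finally show "(\<Sum>n\<in>{- int L..int L}. a n) \<le> (\<Sum>\<^sub>\<infinity>n. (1 + \<bar>real_of_int n\<bar>) powr p * a n)" .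
  qed
  then show ?thesis by simp
qed (simp add: infsum_not_exists)

section \<open>Exponential time averages\<close>

lemma has_bochner_integral_exp_atLeast:
  fixes c :: real
  assumes "0 < c"
  shows "has_bochner_integral lborel (\<lambda>t. indicator {0..} t * exp (- c * t)) (1 / c)"
proof (rule has_bochner_integral_nn_integral)
  have "(\<integral>\<^sup>+t. ennreal (exp (- c * t)) * indicator {0..} t \<partial>lborel) = ennreal (0 - (- exp (- c * 0) / c))"
  proof (rule nn_integral_FTC_atLeast)
    show "((\<lambda>t. - exp (- c * t) / c) has_real_derivative exp (- c * t)) (at t)" for t
      using assms by (auto intro!: derivative_eq_intros)
    have "LIM t at_top. c * t :> at_top"
      using assms by (intro filterlim_tendsto_pos_mult_at_top[OF tendsto_const _ filterlim_ident])
    then have "LIM t at_top. - (c * t) :> at_bot"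
      by (simp add: filterlim_uminus_at_bot)
    then have "((\<lambda>t. exp (- (c * t))) \<longlongrightarrow> 0) at_top"
      by (rule filterlim_compose[OF exp_at_bot])
    then show "((\<lambda>t. - exp (- c * t) / c) \<longlongrightarrow> 0) at_top"
      using tendsto_divide[OF tendsto_minus, of "\<lambda>t. exp (- (c * t))" 0 at_top "\<lambda>_. c" c] assms by simp
  qed auto
  moreover have "(\<integral>\<^sup>+t. ennreal (indicator {0..} t * exp (- c * t)) \<partial>lborel)
      = (\<integral>\<^sup>+t. ennreal (exp (- c * t)) * indicator {0..} t \<partial>lborel)"
    by (intro nn_integral_cong) (auto simp: indicator_def)
  ultimately show "(\<integral>\<^sup>+t. ennreal (indicator {0..} t * exp (- c * t)) \<partial>lborel) = ennreal (1 / c)"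
    by simp
qed (use assms in auto)

text \<open>Against the weight \<open>exp (- 2 * t / T)\<close> the growth
  \<open>exp (t / T)\<close> leaves \<open>exp (- t / T)\<close>, of integral \<open>T\<close>; the
  prefactor \<open>2 / T\<close> leaves the constant 2.\<close>

lemma avg_transition_prob_le:
  assumes T: "0 < T" and D: "0 \<le> D"
    and le: "\<And>t. 0 \<le> t \<Longrightarrow> transition_prob H n t \<le> D * exp (t / T)"
  shows "avg_transition_prob H n T \<le> 2 * D"
proof -
  have hb: "has_bochner_integral lborel (\<lambda>t. D * (indicator {0..} t * exp (- (1 / T) * t))) (D * (1 / (1 / T)))"
    using T by (intro has_bochner_integral_mult_right has_bochner_integral_exp_atLeast) auto
  have "(LBINT t:{0..}. exp (- 2 * t / T) * transition_prob H n t)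
      \<le> (\<integral>t. D * (indicator {0..} t * exp (- (1 / T) * t)) \<partial>lborel)"
    unfolding set_lebesgue_integral_def
  proof (rule integral_mono')
    show "integrable lborel (\<lambda>t. D * (indicator {0..} t * exp (- (1 / T) * t)))"
      using hb by (simp only: has_bochner_integral_iff)
    fix t :: real
    show "0 \<le> D * (indicator {0..} t * exp (- (1 / T) * t))" using D by simp
    show "indicator {0..} t *\<^sub>R (exp (- 2 * t / T) * transition_prob H n t)
        \<le> D * (indicator {0..} t * exp (- (1 / T) * t))"
    proof (cases "0 \<le> t")
      case True
      have "exp (- 2 * t / T) * transition_prob H n t \<le> exp (- 2 * t / T) * (D * exp (t / T))"
        by (intro mult_left_mono le True) simp
      also have "\<dots> = D * (exp (- 2 * t / T) * exp (t / T))"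
        by (simp only: mult_ac)
      also have "exp (- 2 * t / T) * exp (t / T) = exp (- (1 / T) * t)"
        by (simp flip: exp_add)
      finally show ?thesis using True by simp
    qed simp
  qed
  also have "\<dots> = D * T" using has_bochner_integral_integral_eq[OF hb] by simp
  finally have "2 / T * (LBINT t:{0..}. exp (- 2 * t / T) * transition_prob H n t) \<le> 2 / T * (D * T)"
    using T by (intro mult_left_mono) auto
  then show ?thesis using T by (simp add: avg_transition_prob_def)
qed

lemma transition_prob_nonneg: "0 \<le> transition_prob H n t"
  by (simp add: transition_prob_def)

lemma avg_transition_prob_nonneg: "0 < T \<Longrightarrow> 0 \<le> avg_transition_prob H n T"
  unfolding avg_transition_prob_def set_lebesgue_integral_def
  by (intro mult_nonneg_nonneg Bochner_Integration.integral_nonneg) (auto simp: transition_prob_nonneg)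

text \<open>Dominated convergence with the averaging weight as majorant: conservation of probability
  at each time supplies both the bound and the limit.\<close>

lemma avg_transition_prob_sum_tendsto:
  assumes T: "0 < T" and cont: "\<And>n. continuous_on UNIV (transition_prob H n)"
    and le: "\<And>t L. 0 \<le> t \<Longrightarrow> (\<Sum>n\<in>{- int L..int L}. transition_prob H n t) \<le> 1"
    and lim: "\<And>t. 0 \<le> t \<Longrightarrow> (\<lambda>L. \<Sum>n\<in>{- int L..int L}. transition_prob H n t) \<longlonglongrightarrow> 1"
  shows "(\<lambda>L. \<Sum>n\<in>{- int L..int L}. avg_transition_prob H n T) \<longlonglongrightarrow> 1"
proof -
  define g where "g n t = indicator {0..} t * (exp (- 2 * t / T) * transition_prob H n t)" for n t
  define w where "w t = indicator {0..} t * exp (- (2 / T) * t)" for t :: real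
  have w: "has_bochner_integral lborel w (1 / (2 / T))"
    unfolding w_def[abs_def] using T by (intro has_bochner_integral_exp_atLeast) auto
  have wi: "integrable lborel w" using w by (simp only: has_bochner_integral_iff)
  have [measurable]: "transition_prob H n \<in> borel_measurable borel" for n
    by (rule borel_measurable_continuous_onI[OF cont])
  have gm: "g n \<in> borel_measurable lborel" for n
    unfolding g_def[abs_def] by measurable
  have le1: "transition_prob H n t \<le> 1" if "0 \<le> t" for n t
  proof -
    have "transition_prob H n t \<le> (\<Sum>k\<in>{- int (nat \<bar>n\<bar>)..int (nat \<bar>n\<bar>)}. transition_prob H k t)"
      by (intro member_le_sum) (auto simp: transition_prob_nonneg)
    then show ?thesis using le[OF that, of "nat \<bar>n\<bar>"] by linarith
  qed
  have gi: "integrable lborel (g n)" for n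
  proof (rule Bochner_Integration.integrable_bound[OF wi gm])
    have "norm (g n t) \<le> norm (w t)" for t
      using le1[of t n] transition_prob_nonneg[of H n t] mult_left_mono[of "transition_prob H n t" 1 "exp (- (2 * t / T))"]
      by (cases "0 \<le> t") (auto simp: g_def w_def)
    then show "AE t in lborel. norm (g n t) \<le> norm (w t)" by simp
  qed
  have avg: "avg_transition_prob H n T = 2 / T * (\<integral>t. g n t \<partial>lborel)" for n
    by (simp add: avg_transition_prob_def set_lebesgue_integral_def g_def[abs_def])
  have sum_g: "(\<Sum>n\<in>A. g n t) = w t * (\<Sum>n\<in>A. transition_prob H n t)" for A t
    by (simp add: g_def w_def sum_distrib_left mult.assoc)
  have "(\<lambda>L. \<integral>t. (\<Sum>n\<in>{- int L..int L}. g n t) \<partial>lborel) \<longlonglongrightarrow> (\<integral>t. w t \<partial>lborel)"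
  proof (rule integral_dominated_convergence[where w = w])
    show "w \<in> borel_measurable lborel" using wi by (rule borel_measurable_integrable)
    show "(\<lambda>t. \<Sum>n\<in>{- int L..int L}. g n t) \<in> borel_measurable lborel" for L
      by (intro borel_measurable_sum gm)
    have "(\<lambda>L. \<Sum>n\<in>{- int L..int L}. g n t) \<longlonglongrightarrow> w t" for t
    proof (cases "0 \<le> t")
      case True
      have "(\<lambda>L. w t * (\<Sum>n\<in>{- int L..int L}. transition_prob H n t)) \<longlonglongrightarrow> w t * 1"
        by (rule tendsto_mult_left[OF lim[OF True]])
      then show ?thesis unfolding sum_g by simp
    next
      case False
      then show ?thesis unfolding sum_g by (simp add: w_def)
    qed
    then show "AE t in lborel. (\<lambda>L. \<Sum>n\<in>{- int L..int L}. g n t) \<longlonglongrightarrow> w t" by simp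
    have "norm (\<Sum>n\<in>{- int L..int L}. g n t) \<le> w t" for L t
    proof (cases "0 \<le> t")
      case True
      have "0 \<le> w t" by (simp add: w_def)
      moreover have "0 \<le> (\<Sum>n\<in>{- int L..int L}. transition_prob H n t)"
        by (intro sum_nonneg transition_prob_nonneg)
      ultimately show ?thesis
        unfolding sum_g using mult_left_mono[OF le[OF True, of L], of "w t"] by simp
    next
      case False
      then show ?thesis unfolding sum_g by (simp add: w_def)
    qed
    then show "AE t in lborel. norm (\<Sum>n\<in>{- int L..int L}. g n t) \<le> w t" for L by simp
  qed (rule wi)
  moreover have "(\<integral>t. (\<Sum>n\<in>{- int L..int L}. g n t) \<partial>lborel) = (\<Sum>n\<in>{- int L..int L}. \<integral>t. g n t \<partial>lborel)" for L
    by (intro Bochner_Integration.integral_sum gi)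
  ultimately have "(\<lambda>L. 2 / T * (\<Sum>n\<in>{- int L..int L}. \<integral>t. g n t \<partial>lborel)) \<longlonglongrightarrow> 2 / T * (\<integral>t. w t \<partial>lborel)"
    by (intro tendsto_mult_left) simp
  then show ?thesis
    using has_bochner_integral_integral_eq[OF w] T by (simp add: avg sum_distrib_left)
qed

subsection \<open>Localization up to polynomial time scales\<close>

lemma amp_localized:
  fixes f :: "real \<Rightarrow> real"
  defines "R \<equiv> \<lambda>b lam. 2 * (lam * b + 2)"
  assumes b: "\<And>x. \<bar>f x\<bar> \<le> b" and lam: "0 \<le> lam" and \<eta>: "0 < \<eta>" "\<eta> \<le> 1"
    and n: "1 \<le> n" "exp 1 / \<eta>\<^sup>2 \<le> exp (real n) / 2" and q: "1 \<le> q"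
    and grow: "\<And>z \<theta>. cmod z \<le> R b lam + 1 \<Longrightarrow> \<exists>m. 1 \<le> m \<and> m \<le> q \<and> exp (real n) / 2
      \<le> cmod (sol (\<lambda>k. z - of_real (lam * f (\<theta> + real (m + k) * \<omega>))) (Suc n))"
    and t: "0 \<le> t" and k: "0 \<le> k"
  shows "cmod (amp (\<lambda>n. lam * f (of_int n * \<omega> + \<theta>)) t k)
    \<le> exp (\<eta> * t) * ((R b lam + 2) * exp (1 - real_of_int k / (real q + real n)))"
proof -
  define V where "V n = lam * f (of_int n * \<omega> + \<theta>)" for n :: int
  have V: "\<bar>V n\<bar> \<le> lam * b" for n
    unfolding V_def abs_mult using lam by (intro mult_mono b) auto
  have b0: "0 \<le> b" using b[of 0] by simp
  \<comment> \<open>A block holds an orbit start \<open>m <= q\<close> followed by \<open>n\<close>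
    steps of growth.\<close>
  define N where "N = q + n"
  have N: "2 \<le> N" using n q by (simp add: N_def)
  define i where "i = nat k div N"
  have kN: "real_of_int k / (real q + real n) \<le> real i + 1"
  proof -
    have "nat k \<le> N * i + N"
      using N mod_less_divisor[of N "nat k"] mult_div_mod_eq[of N "nat k"]
      unfolding i_def by linarith
    then have "real (nat k) \<le> real N * (real i + 1)"
      by (metis distrib_left mult.right_neutral of_nat_add of_nat_le_iff of_nat_mult)
    then show ?thesis using k N by (simp add: N_def divide_le_eq mult.commute)
  qed
  have R2: "1 \<le> R b lam + 2" using lam b0 by (simp add: R_def)
  have "cmod (amp V t k) \<le> exp (\<eta> * t) * ((R b lam + 2) * exp (- real i))"
  proof (cases "i = 0")
    case True
    \<comment> \<open>In the first block there is no decay to use, and unitarity gives the bound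
      1.\<close>
    have "1 * (1 * 1) \<le> exp (\<eta> * t) * ((R b lam + 2) * exp (- real i))"
      using True \<eta> t R2 by (intro mult_mono) auto
    then show ?thesis using amp_le_1[of V "lam * b" t k, OF V t] by linarith
  next
    case False
    show ?thesis
      unfolding R_def
    proof (rule amp_decay[OF V t \<eta> n(2) _ N])
      show "1 \<le> i" using False by simp
      have "int (i * N) \<le> int (nat k)"
        using div_times_less_eq_dividend[of "nat k" N] unfolding i_def of_nat_le_iff .
      then show "int i * int N \<le> k" using k by simp
      fix E :: real and s :: int
      assume E: "\<bar>E\<bar> \<le> 2 * (lam * b + 2)" and s: "0 \<le> s"
      have "cmod (Complex E \<eta>) \<le> R b lam + 1"
        using cmod_le[of "Complex E \<eta>"] E \<eta> by (simp add: R_def)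
      \<comment> \<open>Starting at site \<open>s\<close> amounts to the phase
        \<open>s * \<omega> + \<theta>\<close>; uniformity in the phase makes all blocks
        alike.\<close>
      then obtain m where m: "1 \<le> m" "m \<le> q" "exp (real n) / 2
          \<le> cmod (sol (\<lambda>k. Complex E \<eta> - of_real (lam * f ((of_int s * \<omega> + \<theta>) + real (m + k) * \<omega>))) (Suc n))"
        using grow[of "Complex E \<eta>" "of_int s * \<omega> + \<theta>"] by blast
      have "solp (Complex E \<eta>) V (s + int m) (s + int m + int n)
        = sol (\<lambda>k. Complex E \<eta> - of_real (lam * f ((of_int s * \<omega> + \<theta>) + real (m + k) * \<omega>))) (Suc n)"
      proof -
        have "V (s + int m + int k) = lam * f ((of_int s * \<omega> + \<theta>) + real (m + k) * \<omega>)" for k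
          by (simp add: V_def algebra_simps)
        moreover have "nat (s + int m + int n - (s + int m) + 1) = Suc n" by simp
        ultimately show ?thesis unfolding solp_def by presburger
      qed
      then show "\<exists>m j. s < m \<and> m \<le> j \<and> j \<le> s + int N \<and> exp (real n) / 2 \<le> cmod (solp (Complex E \<eta>) V m j)"
        using m by (intro exI[of _ "s + int m"] exI[of _ "s + int m + int n"]) (auto simp: N_def)
    qed
  qed
  also have "\<dots> \<le> exp (\<eta> * t) * ((R b lam + 2) * exp (1 - real_of_int k / (real q + real n)))"
    using kN R2 by (intro mult_left_mono) auto
  finally show ?thesis by (simp add: V_def[abs_def])
qed

text \<open>The bound covers all times at once with the loss \<open>exp (t / T)\<close>, so one
  choice of \<open>q\<close>, \<open>n\<close> and \<open>T\<close> serves the moment at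
  \<open>t = T\<close> and the average at scale \<open>T\<close>. The constants depend on
  \<open>f\<close> and \<open>lam\<close> only.\<close>

lemma localization:
  fixes f :: "real \<Rightarrow> real"
  assumes f: "analytic_on_circle f" and nonconst: "\<not> f constant_on UNIV"
  shows "\<exists>lam_f>0. \<forall>lam>lam_f. \<exists>C\<ge>1. \<exists>D\<ge>1. \<forall>\<omega> q n T \<theta> t k.
    1 \<le> n \<and> dense_orbit \<omega> q \<and> C * real n \<le> real q \<and> 1 \<le> T \<and> 2 * ln T + 4 \<le> real n \<and> 0 \<le> t \<longrightarrow>
    transition_prob (schroedinger f lam \<omega> \<theta>) k t
      \<le> D * exp (t / T) * exp (- 2 * \<bar>real_of_int k\<bar> / (real q + real n))"
proof -
  obtain b where b: "\<And>x. \<bar>f x\<bar> \<le> b"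
    using analytic_on_circle_bounded[OF f] by (auto simp: bounded_iff)
  have b0: "0 \<le> b" using b[of 0] by simp
  obtain h F where hF: "h > 0" "F holomorphic_on {w. \<bar>Im w\<bar> < h}"
    "\<And>w. \<bar>Im w\<bar> < h \<Longrightarrow> F (w + 1) = F w" "\<And>x. F (of_real x) = of_real (f x)"
    using analytic_on_circle_extends[OF f] by blast
  \<comment> \<open>Energies on the segment have modulus at most \<open>2 * lam * b + 5\<close>,
    hence at most \<open>lam * (2 * b + 5)\<close> as \<open>lam >= 1\<close>.\<close>
  obtain lam_f where lam_f: "lam_f \<ge> 1" and grow: "\<And>lam. lam > lam_f \<Longrightarrow> \<exists>C>0. \<forall>\<omega> q n z \<theta>.
    1 \<le> n \<and> dense_orbit \<omega> q \<and> C * real n \<le> real q \<and> cmod z \<le> lam * (2 * b + 5) \<longrightarrow>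
    (\<exists>m. 1 \<le> m \<and> m \<le> q \<and> exp (real n) / 2
      \<le> cmod (sol (\<lambda>k. z - of_real (lam * f (\<theta> + real (m + k) * \<omega>))) (Suc n)))"
    using orbit_growth[OF hF nonconst, of "2 * b + 5"] b0 by auto
  show ?thesis
  proof (rule exI[of _ lam_f], intro conjI allI impI)
    show "0 < lam_f" using lam_f by simp
    fix lam assume "lam_f < lam"
    then have lam: "1 \<le> lam" using lam_f by simp
    obtain C where C: "C > 0" "\<And>\<omega> q n z \<theta>. 1 \<le> n \<Longrightarrow> dense_orbit \<omega> q \<Longrightarrow> C * real n \<le> real q \<Longrightarrow>
      cmod z \<le> lam * (2 * b + 5) \<Longrightarrow> \<exists>m. 1 \<le> m \<and> m \<le> q \<and> exp (real n) / 2
      \<le> cmod (sol (\<lambda>k. z - of_real (lam * f (\<theta> + real (m + k) * \<omega>))) (Suc n))"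
      using grow[OF \<open>lam_f < lam\<close>] by blast
    define R where "R = 2 * (lam * b + 2)"
    have Rz: "R + 1 \<le> lam * (2 * b + 5)"
      using lam by (simp add: R_def algebra_simps)
    have R0: "0 \<le> R" using lam b0 by (simp add: R_def)
    \<comment> \<open>The factor \<open>exp 4\<close> is the square of two losses
      \<open>exp 1\<close>: rounding to whole blocks, and the shift by one site for the source at
      1.\<close>
    define D where "D = (R + 2)\<^sup>2 * exp 4"
    have D: "1 \<le> D"
    proof -
      have "1\<^sup>2 \<le> (R + 2)\<^sup>2" using R0 by (intro power_mono) auto
      moreover have "1 \<le> exp (4::real)" by simp
      ultimately show ?thesis unfolding D_def using mult_mono[of 1 "(R + 2)\<^sup>2" 1 "exp 4"] by simp
    qed
    have "transition_prob (schroedinger f lam \<omega> \<theta>) k t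
        \<le> D * exp (t / T) * exp (- 2 * \<bar>real_of_int k\<bar> / (real q + real n))"
      if n: "1 \<le> n" and q: "dense_orbit \<omega> q" "max 1 C * real n \<le> real q" and T: "1 \<le> T"
        and nT: "2 * ln T + 4 \<le> real n" and t: "0 \<le> t" for \<omega> q n T \<theta> t and k :: int
    proof -
      \<comment> \<open>Chosen so that the square of \<open>exp (\<eta> * t)\<close> is
        \<open>exp (t / T)\<close>.\<close>
      define \<eta> where "\<eta> = 1 / (2 * T)"
      have \<eta>: "0 < \<eta>" "\<eta> \<le> 1" using T by (auto simp: \<eta>_def)
      have Cq: "C * real n \<le> real q" "1 \<le> q"
      proof -
        have "C * real n \<le> max 1 C * real n" "1 * real n \<le> max 1 C * real n"
          by (intro mult_right_mono; simp)+
        then show "C * real n \<le> real q" "1 \<le> q" using q(2) n by linarith+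
      qed
      \<comment> \<open>In terms of \<open>T\<close> this asks that \<open>8 * exp 1 * T^2\<close>
        be at most \<open>exp n\<close>; since \<open>8 <= exp 3\<close>, it follows from
        \<open>n >= 2 * ln T + 4\<close>.\<close>
      have M: "exp 1 / \<eta>\<^sup>2 \<le> exp (real n) / 2"
      proof -
        have "(8::real) \<le> exp 3"
        proof -
          have "(2::real) ^ 3 \<le> exp 1 ^ 3" using exp_ge_add_one_self[of "1::real"] by (intro power_mono) auto
          then show ?thesis using exp_of_nat_mult[of 3 "1::real"] by simp
        qed
        have "8 * exp 1 * T\<^sup>2 \<le> exp 3 * exp 1 * T\<^sup>2"
          using \<open>8 \<le> exp 3\<close> by (intro mult_right_mono) auto
        also have "\<dots> = exp (2 * ln T + 4)"
        proof -
          have "exp (2 * ln T) = T\<^sup>2" using T exp_of_nat_mult[of 2 "ln T"] by simp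
          moreover have "exp 3 * exp 1 = exp (4::real)" by (simp flip: exp_add)
          ultimately show ?thesis by (simp add: exp_add)
        qed
        also have "\<dots> \<le> exp (real n)" using nT by simp
        finally show ?thesis by (simp add: \<eta>_def power2_eq_square)
      qed
      define N where "N = real q + real n"
      have N: "1 \<le> N" using Cq n by (simp add: N_def)
      define X where "X = exp (\<eta> * t) * (R + 2)"
      have X: "0 \<le> X" using R0 by (simp add: X_def)
      have right: "cmod (amp (\<lambda>n. lam * f (of_int n * \<omega>' + \<theta>')) t j) \<le> X * exp (1 - real_of_int j / N)"
        if "dense_orbit \<omega>' q" "0 \<le> j" for \<omega>' \<theta>' j
      proof -
        have "cmod (amp (\<lambda>n. lam * f (of_int n * \<omega>' + \<theta>')) t j)
            \<le> exp (\<eta> * t) * ((2 * (lam * b + 2) + 2) * exp (1 - real_of_int j / (real q + real n)))"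
        proof (rule amp_localized[OF b _ \<eta> n M Cq(2) _ t that(2)])
          fix z :: complex and \<theta>'' :: real assume "cmod z \<le> 2 * (lam * b + 2) + 1"
          then have "cmod z \<le> lam * (2 * b + 5)" using Rz by (simp add: R_def)
          then show "\<exists>m\<ge>1. m \<le> q \<and> exp (real n) / 2
              \<le> cmod (sol (\<lambda>k. z - of_real (lam * f (\<theta>'' + real (m + k) * \<omega>'))) (Suc n))"
            by (rule C(2)[OF n that(1) Cq(1)])
        qed (use lam in simp)
        then show ?thesis by (simp only: X_def R_def N_def mult.assoc)
      qed
      have both: "cmod (amp (\<lambda>n. lam * f (of_int n * \<omega> + \<theta>')) t j) \<le> X * exp (1 - \<bar>real_of_int j\<bar> / N)" for \<theta>' j
      proof (cases "0 \<le> j")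
        case True
        then show ?thesis using right[OF q(1) True, of \<theta>'] by simp
      next
        case False
        have "amp (\<lambda>n. lam * f (of_int n * \<omega> + \<theta>')) t j = amp (\<lambda>n. lam * f (of_int n * (- \<omega>) + \<theta>')) t (- j)"
          using amp_reflect[of "\<lambda>n. lam * f (of_int n * \<omega> + \<theta>')" t "- j"] by simp
        then show ?thesis using right[OF dense_orbit_uminus[OF q(1)], of "- j" \<theta>'] False by simp
      qed
      have sq: "(cmod (amp (\<lambda>n. lam * f (of_int n * \<omega> + \<theta>')) t j))\<^sup>2 \<le> X\<^sup>2 * exp (4 - 2 * \<bar>real_of_int k\<bar> / N)"
        if "\<bar>k\<bar> \<le> \<bar>j\<bar> + 1" for \<theta>' j
      proof -
        have "\<bar>real_of_int k\<bar> \<le> \<bar>real_of_int j\<bar> + 1" using that by linarith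
        then have "\<bar>real_of_int k\<bar> / N \<le> (\<bar>real_of_int j\<bar> + 1) / N"
          using N by (intro divide_right_mono) auto
        also have "\<dots> \<le> \<bar>real_of_int j\<bar> / N + 1"
          using N by (simp add: add_divide_distrib)
        finally have "exp (1 - \<bar>real_of_int j\<bar> / N) \<le> exp (2 - \<bar>real_of_int k\<bar> / N)" by simp
        then have "X * exp (1 - \<bar>real_of_int j\<bar> / N) \<le> X * exp (2 - \<bar>real_of_int k\<bar> / N)"
          using X by (intro mult_left_mono)
        with both[of \<theta>' j] have "cmod (amp (\<lambda>n. lam * f (of_int n * \<omega> + \<theta>')) t j) \<le> X * exp (2 - \<bar>real_of_int k\<bar> / N)"
          by (rule order_trans)
        then have "(cmod (amp (\<lambda>n. lam * f (of_int n * \<omega> + \<theta>')) t j))\<^sup>2 \<le> (X * exp (2 - \<bar>real_of_int k\<bar> / N))\<^sup>2"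
          by (intro power_mono) auto
        also have "\<dots> = X\<^sup>2 * exp (4 - 2 * \<bar>real_of_int k\<bar> / N)"
          unfolding power_mult_distrib by (simp add: power2_eq_square flip: exp_add)
        finally show ?thesis .
      qed
      have "transition_prob (schroedinger f lam \<omega> \<theta>) k t \<le> X\<^sup>2 * exp (4 - 2 * \<bar>real_of_int k\<bar> / N)"
        unfolding transition_prob_amp[OF analytic_on_circle_bounded[OF f]]
      proof -
        have "\<bar>k\<bar> \<le> \<bar>k - 1\<bar> + 1" by linarith
        then show "((cmod (amp (\<lambda>n. lam * f (of_int n * \<omega> + \<theta>)) t k))\<^sup>2
            + (cmod (amp (\<lambda>n. lam * f (of_int n * \<omega> + (\<omega> + \<theta>))) t (k - 1)))\<^sup>2) / 2
          \<le> X\<^sup>2 * exp (4 - 2 * \<bar>real_of_int k\<bar> / N)"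
          using sq[of k \<theta>] sq[of "k - 1" "\<omega> + \<theta>"] by simp
      qed
      also have "X\<^sup>2 = (R + 2)\<^sup>2 * exp (t / T)"
      proof -
        have "(exp (\<eta> * t))\<^sup>2 = exp (t / T)"
          using exp_of_nat_mult[of 2 "\<eta> * t"] by (simp add: \<eta>_def)
        then show ?thesis by (simp add: X_def power_mult_distrib mult.commute)
      qed
      also have "exp (4 - 2 * \<bar>real_of_int k\<bar> / N) = exp 4 * exp (- 2 * \<bar>real_of_int k\<bar> / N)"
        by (simp flip: exp_add)
      finally show ?thesis by (simp add: D_def N_def mult_ac)
    qed
    then show "\<exists>C\<ge>1. \<exists>D\<ge>1. \<forall>\<omega> q n T \<theta> t k.
      1 \<le> n \<and> dense_orbit \<omega> q \<and> C * real n \<le> real q \<and> 1 \<le> T \<and> 2 * ln T + 4 \<le> real n \<and> 0 \<le> t \<longrightarrow>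
      transition_prob (schroedinger f lam \<omega> \<theta>) k t
        \<le> D * exp (t / T) * exp (- 2 * \<bar>real_of_int k\<bar> / (real q + real n))"
      using D by (intro exI[of _ "max 1 C"] conjI exI[of _ D]) auto
  qed
qed

text \<open>The source at site 1 sees a window shifted by one site, which is caught between two
  centred windows.\<close>

lemma transition_prob_sum:
  assumes f: "bounded (range f)" and t: "0 \<le> t"
  shows "(\<Sum>n\<in>{- int L..int L}. transition_prob (schroedinger f lam \<omega> \<theta>) n t) \<le> 1" (is ?le)
    and "(\<lambda>L. \<Sum>n\<in>{- int L..int L}. transition_prob (schroedinger f lam \<omega> \<theta>) n t) \<longlonglongrightarrow> 1" (is ?lim)
proof -
  obtain b where b: "\<And>x. \<bar>f x\<bar> \<le> b" using f by (auto simp: bounded_iff)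
  define V where "V \<theta> n = lam * f (of_int n * \<omega> + \<theta>)" for \<theta> and n :: int
  have V: "\<bar>V \<theta> n\<bar> \<le> \<bar>lam\<bar> * b" for \<theta> n
    unfolding V_def abs_mult by (intro mult_left_mono b) auto
  define P where "P = transition_prob (schroedinger f lam \<omega> \<theta>)"
  have P: "P n t = ((cmod (amp (V \<theta>) t n))\<^sup>2 + (cmod (amp (V (\<omega> + \<theta>)) t (n - 1)))\<^sup>2) / 2" for n t
    unfolding P_def transition_prob_amp[OF f] V_def ..
  define S where "S L = (\<Sum>n\<in>{- int L..int L}. (cmod (amp (V (\<omega> + \<theta>)) t (n - 1)))\<^sup>2)" for L
  have S: "S L = (\<Sum>n\<in>{- int L - 1..int L - 1}. (cmod (amp (V (\<omega> + \<theta>)) t n))\<^sup>2)" for L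
    unfolding S_def by (rule sum.reindex_bij_witness[where i = "\<lambda>n. n + 1" and j = "\<lambda>n. n - 1"]) auto
  have sumP: "(\<Sum>n\<in>{- int L..int L}. P n t) = (mass (V \<theta>) L t + S L) / 2" for L
    unfolding P mass_def S_def by (simp add: sum.distrib flip: sum_divide_distrib)
  have up: "S L \<le> mass (V (\<omega> + \<theta>)) (Suc L) t" for L
    unfolding S mass_def by (intro sum_mono2) auto
  have low: "mass (V (\<omega> + \<theta>)) L t \<le> S (Suc L)" for L
    unfolding S mass_def by (intro sum_mono2) auto
  have m1: "mass (V \<theta>') L t \<le> 1" for \<theta>' L by (rule mass_le_1[OF V t])
  have lim1: "(\<lambda>L. mass (V \<theta>') L t) \<longlonglongrightarrow> 1" for \<theta>' by (rule mass_tendsto_1[OF V t])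
  show ?le using m1[of \<theta> L] up[of L] m1[of "\<omega> + \<theta>" "Suc L"] unfolding P_def[symmetric] sumP by simp
  have "(\<lambda>L. S (Suc L)) \<longlonglongrightarrow> 1"
  proof (rule tendsto_sandwich[OF _ _ lim1 tendsto_const])
    show "\<forall>\<^sub>F L in sequentially. mass (V (\<omega> + \<theta>)) L t \<le> S (Suc L)" using low by simp
    have "S (Suc L) \<le> 1" for L
      using up[of "Suc L"] m1[of "\<omega> + \<theta>" "Suc (Suc L)"] by linarith
    then show "\<forall>\<^sub>F L in sequentially. S (Suc L) \<le> 1" by simp
  qed
  then have "S \<longlonglongrightarrow> 1" by (rule LIMSEQ_imp_Suc)
  then have "(\<lambda>L. (mass (V \<theta>) L t + S L) / 2) \<longlonglongrightarrow> (1 + 1) / 2"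
    by (intro tendsto_intros lim1) auto
  then show ?lim unfolding P_def[symmetric] sumP by simp
qed

lemma transition_prob_continuous:
  assumes f: "bounded (range f)"
  shows "continuous_on UNIV (transition_prob (schroedinger f lam \<omega> \<theta>) n)"
proof -
  obtain b where b: "\<And>x. \<bar>f x\<bar> \<le> b" using f by (auto simp: bounded_iff)
  define V where "V \<theta> n = lam * f (of_int n * \<omega> + \<theta>)" for \<theta> and n :: int
  have V: "\<bar>V \<theta> n\<bar> \<le> \<bar>lam\<bar> * b" for \<theta> n
    unfolding V_def abs_mult by (intro mult_left_mono b) auto
  have "continuous_on UNIV (\<lambda>t. ((cmod (amp (V \<theta>) t n))\<^sup>2 + (cmod (amp (V (\<omega> + \<theta>)) t (n - 1)))\<^sup>2) / 2)"
    by (intro continuous_intros amp_continuous[OF V]) simp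
  moreover have "transition_prob (schroedinger f lam \<omega> \<theta>) n
    = (\<lambda>t. ((cmod (amp (V \<theta>) t n))\<^sup>2 + (cmod (amp (V (\<omega> + \<theta>)) t (n - 1)))\<^sup>2) / 2)"
    by (rule ext) (simp only: transition_prob_amp[OF f] V_def[abs_def])
  ultimately show ?thesis by simp
qed

subsection \<open>Transport exponents\<close>

lemma moments_nonneg:
  assumes f: "bounded (range f)" and p: "0 < p" and T: "0 < T"
  shows "0 \<le> ln (moment (schroedinger f lam \<omega> \<theta>) p T)"
    and "0 \<le> ln (avg_moment (schroedinger f lam \<omega> \<theta>) p T)"
proof -
  show "0 \<le> ln (moment (schroedinger f lam \<omega> \<theta>) p T)"
    unfolding moment_def using T
    by (intro ln_weighted_infsum_nonneg[OF p transition_prob_nonneg] transition_prob_sum(2)[OF f]) simp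
  show "0 \<le> ln (avg_moment (schroedinger f lam \<omega> \<theta>) p T)"
    unfolding avg_moment_def
  proof (rule ln_weighted_infsum_nonneg[OF p avg_transition_prob_nonneg[OF T]])
    show "(\<lambda>L. \<Sum>n\<in>{- int L..int L}. avg_transition_prob (schroedinger f lam \<omega> \<theta>) n T) \<longlonglongrightarrow> 1"
      by (rule avg_transition_prob_sum_tendsto[OF T transition_prob_continuous[OF f]
        transition_prob_sum(1)[OF f] transition_prob_sum(2)[OF f]])
  qed
qed

text \<open>The value 0, which \<open>infsum\<close> also takes on divergent series, has
  \<open>ln 0 = 0\<close>; the hypothesis \<open>1 <= b\<close> covers it.\<close>

lemma ln_infsum_le:
  assumes "\<And>n. 0 \<le> a n" "infsum a UNIV \<le> b" "1 \<le> b"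
  shows "ln (infsum a UNIV) \<le> ln (b :: real)"
  using infsum_nonneg[of UNIV a] assms by (cases "infsum a UNIV = 0") auto

text \<open>At \<open>t = T\<close> the loss is \<open>exp 1\<close>, and averaging loses 2, which
  is smaller, so one constant serves both. The \<open>max 1\<close> gives \<open>K >= 1\<close>
  without estimating \<open>p powr p\<close> from below.\<close>

lemma moments_le:
  assumes p: "0 < p" and T: "1 \<le> T" and N: "1 \<le> N" and D: "1 \<le> D"
    and le: "\<And>k t. 0 \<le> t \<Longrightarrow> transition_prob H k t \<le> D * exp (t / T) * exp (- 2 * \<bar>real_of_int k\<bar> / N)"
  defines "K \<equiv> exp 1 * D * (4 * max 1 (p powr p) * exp 1)"
  shows "ln (moment H p T) \<le> ln K + (p + 1) * ln N" "ln (avg_moment H p T) \<le> ln K + (p + 1) * ln N"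
proof -
  have e: "2 \<le> exp (1::real)" using exp_ge_add_one_self[of "1::real"] by simp
  have K1: "1 \<le> K"
  proof -
    have "1 * 1 * (1 * 1 * 1) \<le> exp 1 * D * (4 * max 1 (p powr p) * exp 1)"
      using e D by (intro mult_mono) auto
    then show ?thesis by (simp add: K_def)
  qed
  have b1: "1 \<le> K * N powr (p + 1)"
    using mult_mono[of 1 K 1 "N powr (p + 1)"] K1 ge_one_powr_ge_zero[OF N, of "p + 1"] p by simp
  have b2: "ln (K * N powr (p + 1)) = ln K + (p + 1) * ln N"
    using K1 N by (simp add: ln_mult)
  have w: "ln (\<Sum>\<^sub>\<infinity>n. (1 + \<bar>real_of_int n\<bar>) powr p * a n) \<le> ln K + (p + 1) * ln N"
    if a: "\<And>n. 0 \<le> a n" "\<And>n. a n \<le> exp 1 * D * exp (- 2 * \<bar>real_of_int n\<bar> / N)" for a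
    unfolding b2[symmetric]
  proof (rule ln_infsum_le[OF _ _ b1])
    show "0 \<le> (1 + \<bar>real_of_int n\<bar>) powr p * a n" for n using a(1) by simp
    show "(\<Sum>\<^sub>\<infinity>n. (1 + \<bar>real_of_int n\<bar>) powr p * a n) \<le> K * N powr (p + 1)"
    proof (rule infsum_le_if_finite_sums_le)
      show "0 \<le> (1 + \<bar>real_of_int n\<bar>) powr p * a n" for n using a(1) by simp
      fix F :: "int set" assume "finite F"
      then have "(\<Sum>n\<in>F. (1 + \<bar>real_of_int n\<bar>) powr p * a n)
          \<le> exp 1 * D * (4 * p powr p * exp 1) * N powr (p + 1)"
        using D by (intro weighted_sum_le[OF p N _ a(2)]) auto
      also have "\<dots> \<le> K * N powr (p + 1)"
        unfolding K_def using D by (intro mult_right_mono mult_left_mono) auto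
      finally show "(\<Sum>n\<in>F. (1 + \<bar>real_of_int n\<bar>) powr p * a n) \<le> K * N powr (p + 1)" .
    qed
  qed
  show "ln (moment H p T) \<le> ln K + (p + 1) * ln N"
    unfolding moment_def
  proof (rule w[OF transition_prob_nonneg])
    show "transition_prob H n T \<le> exp 1 * D * exp (- 2 * \<bar>real_of_int n\<bar> / N)" for n
      using le[of T n] T by (simp add: mult.commute)
  qed
  show "ln (avg_moment H p T) \<le> ln K + (p + 1) * ln N"
    unfolding avg_moment_def
  proof (rule w)
    show "0 \<le> avg_transition_prob H n T" for n using T by (intro avg_transition_prob_nonneg) simp
    show "avg_transition_prob H n T \<le> exp 1 * D * exp (- 2 * \<bar>real_of_int n\<bar> / N)" for n
    proof -
      have "avg_transition_prob H n T \<le> 2 * (D * exp (- 2 * \<bar>real_of_int n\<bar> / N))"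
        using T D le[of _ n] by (intro avg_transition_prob_le) (auto simp: mult_ac)
      also have "\<dots> \<le> exp 1 * (D * exp (- 2 * \<bar>real_of_int n\<bar> / N))"
        using e D by (intro mult_right_mono) auto
      finally show ?thesis by (simp add: mult.assoc)
    qed
  qed
qed

lemma beta_plus_zero:
  assumes p: "0 < p" and nonneg: "\<And>t. 1 \<le> t \<Longrightarrow> 0 \<le> ln (moment H p t)"
    and le: "\<forall>\<^sub>F t in at_top. ln (moment H p t) \<le> g t"
    and g: "((\<lambda>t. g t / (p * ln t)) \<longlongrightarrow> 0) at_top"
  shows "beta_plus H p = 0"
proof -
  have "((\<lambda>t. ln (moment H p t) / (p * ln t)) \<longlongrightarrow> 0) at_top"
  proof (rule tendsto_sandwich[OF _ _ tendsto_const g])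
    show "\<forall>\<^sub>F t in at_top. 0 \<le> ln (moment H p t) / (p * ln t)"
      using eventually_ge_at_top[of 1] by eventually_elim (use p nonneg in simp)
    show "\<forall>\<^sub>F t in at_top. ln (moment H p t) / (p * ln t) \<le> g t / (p * ln t)"
      using eventually_ge_at_top[of 1] le by eventually_elim (use p in \<open>simp add: divide_right_mono\<close>)
  qed
  then have "((\<lambda>t. ereal (ln (moment H p t) / (p * ln t))) \<longlongrightarrow> ereal 0) at_top"
    by (rule tendsto_ereal)
  then show ?thesis
    unfolding beta_plus_def using lim_imp_Limsup[OF trivial_limit_at_top_linorder] by (metis zero_ereal_def)
qed

text \<open>A positive lower limit would keep the quotient above some \<open>e > 0\<close> at all
  large times, so an upper bound at arbitrarily large times suffices to exclude it.\<close>

lemma beta_minus_zero: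
  assumes p: "0 < p" and nonneg: "\<And>t. 1 \<le> t \<Longrightarrow> 0 \<le> ln (avg_moment H p t)"
    and le: "\<exists>\<^sub>F t in at_top. ln (avg_moment H p t) \<le> g t"
    and g: "((\<lambda>t. g t / (p * ln t)) \<longlongrightarrow> 0) at_top"
  shows "beta_minus H p = 0"
proof (rule antisym)
  define X where "X t = ln (avg_moment H p t) / (p * ln t)" for t
  show "0 \<le> beta_minus H p"
    unfolding beta_minus_def
  proof (rule Liminf_bounded)
    show "\<forall>\<^sub>F t in at_top. 0 \<le> ereal (ln (avg_moment H p t) / (p * ln t))"
      using eventually_ge_at_top[of 1] by eventually_elim (use p nonneg in simp)
  qed
  show "beta_minus H p \<le> 0"
  proof (rule ccontr)
    assume "\<not> beta_minus H p \<le> 0"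
    then obtain e where e: "0 < e" "ereal e < Liminf at_top (\<lambda>t. ereal (X t))"
      unfolding beta_minus_def X_def using ereal_dense2[of 0] by (metis ereal_less(2) not_le)
    then have "\<forall>\<^sub>F t in at_top. e < X t"
      using less_LiminfD[of "ereal e"] by fastforce
    moreover have "\<forall>\<^sub>F t in at_top. g t / (p * ln t) < e"
      using order_tendstoD(2)[OF g e(1)] .
    moreover have "\<forall>\<^sub>F t::real in at_top. 1 \<le> t" by (rule eventually_ge_at_top)
    ultimately have "\<forall>\<^sub>F t in at_top. \<not> ln (avg_moment H p t) \<le> g t"
    proof eventually_elim
      case (elim t)
      show ?case
      proof
        assume "ln (avg_moment H p t) \<le> g t"
        then have "X t \<le> g t / (p * ln t)"
          unfolding X_def using elim(3) p by (intro divide_right_mono) auto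
        then show False using elim by linarith
      qed
    qed
    then show False using le by (simp add: frequently_def)
  qed
qed

lemma polylog_tendsto_0:
  fixes a b c p :: real
  assumes "0 < c" "0 < p"
  shows "((\<lambda>t. (a + b * ln (c * (2 * ln t + 6))) / (p * ln t)) \<longlongrightarrow> 0) at_top"
  using assms by real_asymp

text \<open>Constant \<open>f\<close> has to be excluded: the operator is then a shifted discrete
  Laplacian, whose transport is ballistic at every coupling.\<close>

theorem corollary1p11:
  fixes f :: "real \<Rightarrow> real"
  assumes "analytic_on_circle f"
    and "\<not> f constant_on UNIV"
  shows "\<exists>lam_f>0. \<forall>lam>lam_f. \<forall>\<omega>. \<omega> \<notin> \<rat> \<longrightarrow>
    (\<forall>\<theta> p. p > 0 \<longrightarrow> beta_minus (schroedinger f lam \<omega> \<theta>) p = 0) \<and>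
    (diophantine \<omega> \<longrightarrow> (\<forall>\<theta> p. p > 0 \<longrightarrow> beta_plus (schroedinger f lam \<omega> \<theta>) p = 0))"
proof -
  have bdd: "bounded (range f)" by (rule analytic_on_circle_bounded[OF assms(1)])
  obtain lam_f where lam_f: "lam_f > 0" and loc: "\<And>lam. lam > lam_f \<Longrightarrow> \<exists>C\<ge>1. \<exists>D\<ge>1. \<forall>\<omega> q n T \<theta> t k.
    1 \<le> n \<and> dense_orbit \<omega> q \<and> C * real n \<le> real q \<and> 1 \<le> T \<and> 2 * ln T + 4 \<le> real n \<and> 0 \<le> t \<longrightarrow>
    transition_prob (schroedinger f lam \<omega> \<theta>) k t
      \<le> D * exp (t / T) * exp (- 2 * \<bar>real_of_int k\<bar> / (real q + real n))"
    using localization[OF assms] by blast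
  have "(\<forall>\<theta> p. p > 0 \<longrightarrow> beta_minus (schroedinger f lam \<omega> \<theta>) p = 0) \<and>
    (diophantine \<omega> \<longrightarrow> (\<forall>\<theta> p. p > 0 \<longrightarrow> beta_plus (schroedinger f lam \<omega> \<theta>) p = 0))"
    if lam: "lam_f < lam" and \<omega>: "\<omega> \<notin> \<rat>" for lam \<omega>
  proof -
    from loc[OF lam] obtain C D where CD: "1 \<le> C" "1 \<le> D" and all: "\<forall>\<omega> q n T \<theta> t k.
      1 \<le> n \<and> dense_orbit \<omega> q \<and> C * real n \<le> real q \<and> 1 \<le> T \<and> 2 * ln T + 4 \<le> real n \<and> 0 \<le> t \<longrightarrow>
      transition_prob (schroedinger f lam \<omega> \<theta>) k t
        \<le> D * exp (t / T) * exp (- 2 * \<bar>real_of_int k\<bar> / (real q + real n))"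
      by (elim exE conjE)
    have loc': "transition_prob (schroedinger f lam \<omega> \<theta>) k t
        \<le> D * exp (t / T) * exp (- 2 * \<bar>real_of_int k\<bar> / (real q + real n))"
      if "1 \<le> n" "dense_orbit \<omega> q" "C * real n \<le> real q" "1 \<le> T" "2 * ln T + 4 \<le> real n" "0 \<le> t"
      for q n T \<theta> t k
      by (rule all[rule_format]) (use that in simp)
    define K where "K p = ln (exp 1 * D * (4 * max 1 (p powr p) * exp 1))" for p
    have bounds: "ln (moment (schroedinger f lam \<omega> \<theta>) p T) \<le> K p + (p + 1) * ln (real q + real n)"
      "ln (avg_moment (schroedinger f lam \<omega> \<theta>) p T) \<le> K p + (p + 1) * ln (real q + real n)"
      if "1 \<le> n" "dense_orbit \<omega> q" "C * real n \<le> real q" "1 \<le> T" "2 * ln T + 4 \<le> real n" "0 < p"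
      for q n T \<theta> p
    proof -
      have "1 \<le> real q + real n" using that(1) by simp
      note le = moments_le[OF that(6,4) this CD(2) loc'[where \<theta> = \<theta>, OF that(1-5)]]
      show "ln (moment (schroedinger f lam \<omega> \<theta>) p T) \<le> K p + (p + 1) * ln (real q + real n)"
        "ln (avg_moment (schroedinger f lam \<omega> \<theta>) p T) \<le> K p + (p + 1) * ln (real q + real n)"
        using le unfolding K_def by blast+
    qed
    show ?thesis
    proof (intro conjI allI impI)
      fix \<theta> p :: real assume p: "0 < p"
      show "beta_minus (schroedinger f lam \<omega> \<theta>) p = 0"
      proof (rule beta_minus_zero[OF p])
        let ?g = "\<lambda>t. K p + (p + 1) * ln ((C + 1) * (2 * ln t + 6))"
        show "0 \<le> ln (avg_moment (schroedinger f lam \<omega> \<theta>) p t)" if "1 \<le> t" for t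
          using that by (intro moments_nonneg bdd p) simp
        show "((\<lambda>t. ?g t / (p * ln t)) \<longlongrightarrow> 0) at_top"
          using CD p by (intro polylog_tendsto_0) auto
        show "\<exists>\<^sub>F t in at_top. ln (avg_moment (schroedinger f lam \<omega> \<theta>) p t) \<le> ?g t"
          unfolding frequently_def eventually_at_top_linorder
        proof clarify
          fix t0 assume *: "\<forall>t\<ge>t0. \<not> ln (avg_moment (schroedinger f lam \<omega> \<theta>) p t) \<le> ?g t"
          define n0 where "n0 = nat \<lceil>2 * ln (max 1 t0) + 4\<rceil>"
          \<comment> \<open>Denominators may have huge gaps, so \<open>q\<close> is chosen first and
            the time is fitted to it: \<open>n\<close> is the largest length that \<open>q\<close>
            admits and \<open>T\<close> the largest scale that \<open>n\<close> admits, which keeps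
            \<open>q + n\<close> of order \<open>ln T\<close>.\<close>
          obtain q where q: "nat \<lceil>C * real n0\<rceil> \<le> q" "dense_orbit \<omega> q"
            using dense_orbit_ge[OF \<omega>] by blast
          define n where "n = nat \<lfloor>real q / C\<rfloor>"
          have nq: "real n \<le> real q / C" "real q / C < real n + 1"
            unfolding n_def using CD by (auto simp: floor_less_iff)
          have n0: "2 * ln (max 1 t0) + 4 \<le> real n0" unfolding n0_def by linarith
          have "C * real n0 \<le> real q" using q(1) by linarith
          then have "real n0 \<le> real q / C" using CD by (simp add: field_simps)
          then have "n0 \<le> n" unfolding n_def by (simp add: le_nat_floor)
          define T where "T = exp ((real n - 4) / 2)"
          have "ln T = (real n - 4) / 2" unfolding T_def by (rule ln_exp)
          then have lnT: "2 * ln T + 4 = real n" by (simp add: field_simps)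
          have "real n0 \<le> real n" using \<open>n0 \<le> n\<close> by simp
          then have "2 * ln (max 1 t0) \<le> 2 * ln T" using lnT n0 by linarith
          then have "ln (max 1 t0) \<le> ln T" by simp
          moreover have "0 < T" by (simp add: T_def)
          ultimately have T: "max 1 t0 \<le> T"
            by (subst (asm) ln_le_cancel_iff) auto
          have "real q + real n \<le> (C + 1) * (real n + 1)"
            using nq(2) CD by (simp add: field_simps)
          also have "\<dots> \<le> (C + 1) * (2 * ln T + 6)"
            using lnT CD by (intro mult_left_mono) auto
          finally have N: "real q + real n \<le> (C + 1) * (2 * ln T + 6)" .
          have n1: "1 \<le> n"
          proof -
            have "0 \<le> ln (max 1 t0)" by simp
            then have "4 \<le> real n" using n0 \<open>n0 \<le> n\<close> by linarith
            then show ?thesis by simp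
          qed
          have "ln (avg_moment (schroedinger f lam \<omega> \<theta>) p T) \<le> K p + (p + 1) * ln (real q + real n)"
            using n1 q(2) nq(1) T lnT p CD by (intro bounds(2)) (auto simp: field_simps)
          also have "\<dots> \<le> ?g T"
            using N n1 p by (intro add_left_mono mult_left_mono) auto
          finally show False using * T by auto
        qed
      qed
    next
      fix \<theta> p :: real assume dio: "diophantine \<omega>" and p: "0 < p"
      obtain \<kappa> x0 where \<kappa>: "0 < \<kappa>"
        and x0: "\<And>x. x0 \<le> x \<Longrightarrow> \<exists>q. x \<le> real q \<and> real q \<le> x powr (1 + \<kappa>) \<and> dense_orbit \<omega> q"
        using dense_orbit_between[OF \<omega> dio] unfolding eventually_at_top_linorder by blast
      show "beta_plus (schroedinger f lam \<omega> \<theta>) p = 0"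
      proof (rule beta_plus_zero[OF p])
        let ?g = "\<lambda>t. (K p + (p + 1) * ln 2) + (p + 1) * (1 + \<kappa>) * ln (C * (2 * ln t + 6))"
        show "0 \<le> ln (moment (schroedinger f lam \<omega> \<theta>) p t)" if "1 \<le> t" for t
          using that by (intro moments_nonneg bdd p) simp
        show "((\<lambda>t. ?g t / (p * ln t)) \<longlongrightarrow> 0) at_top"
          using CD p by (intro polylog_tendsto_0) auto
        have "ln (moment (schroedinger f lam \<omega> \<theta>) p t) \<le> ?g t" if t: "max 1 (exp x0) \<le> t" for t
        proof -
          have t1: "1 \<le> t" "0 \<le> ln t" using t by auto
          have "exp x0 \<le> t" using t by simp
          then have "x0 \<le> ln t" using t1 by (simp add: ln_ge_iff)
          \<comment> \<open>Here the time is given and fixes \<open>n\<close> and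
            \<open>x = C * n\<close>. The Diophantine condition supplies \<open>q\<close> between
            \<open>x\<close> and a power of \<open>x\<close>, so \<open>ln (q + n)\<close> remains
            of order \<open>ln (ln t)\<close>.\<close>
          define n where "n = nat \<lceil>2 * ln t + 4\<rceil>"
          have n: "2 * ln t + 4 \<le> real n" "real n \<le> 2 * ln t + 6"
            using t1(2) unfolding n_def by linarith+
          have n1: "1 \<le> n" using n(1) t1(2) by linarith
          define x where "x = C * real n"
          have nx: "real n \<le> x" using CD n1 by (simp add: x_def)
          then have "x0 \<le> x" using n(1) \<open>x0 \<le> ln t\<close> t1(2) by linarith
          then obtain q where q: "x \<le> real q" "real q \<le> x powr (1 + \<kappa>)" "dense_orbit \<omega> q"
            using x0 by blast
          have x1: "1 \<le> x" using nx n1 by linarith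
          have "real q + real n \<le> 2 * x powr (1 + \<kappa>)"
            using q nx by linarith
          also have "\<dots> \<le> 2 * (C * (2 * ln t + 6)) powr (1 + \<kappa>)"
            using x1 n(2) CD \<kappa> unfolding x_def by (intro mult_left_mono powr_mono2) auto
          finally have "real q + real n \<le> 2 * (C * (2 * ln t + 6)) powr (1 + \<kappa>)" .
          moreover have "0 < real q + real n" using n1 by simp
          ultimately have N: "ln (real q + real n) \<le> ln (2 * (C * (2 * ln t + 6)) powr (1 + \<kappa>))"
            by (subst ln_le_cancel_iff) linarith+
          have "0 < C * (2 * ln t + 6)" using CD t1(2) by (intro mult_pos_pos) auto
          moreover have "ln (2 * y powr r) = ln 2 + r * ln y" if "0 < y" for y r :: real
            using that by (simp add: ln_mult)
          ultimately have eq: "ln (2 * (C * (2 * ln t + 6)) powr (1 + \<kappa>)) = ln 2 + (1 + \<kappa>) * ln (C * (2 * ln t + 6))"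
            by blast
          have "ln (moment (schroedinger f lam \<omega> \<theta>) p t) \<le> K p + (p + 1) * ln (real q + real n)"
            by (rule bounds(1)[OF n1 q(3) _ t1(1) n(1) p]) (use q(1) in \<open>simp add: x_def\<close>)
          also have "\<dots> \<le> K p + (p + 1) * (ln 2 + (1 + \<kappa>) * ln (C * (2 * ln t + 6)))"
            using N p unfolding eq by (intro add_left_mono mult_left_mono) auto
          also have "\<dots> = ?g t" by (simp add: algebra_simps)
          finally show ?thesis .
        qed
        then show "\<forall>\<^sub>F t in at_top. ln (moment (schroedinger f lam \<omega> \<theta>) p t) \<le> ?g t"
          by (rule eventually_mono[OF eventually_ge_at_top])
      qed
    qed
  qed
  then show ?thesis using lam_f by blast
qed

end
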